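(* Let $V$ be a spectrally negative Lévy process which is not the opposite of a subordinator, with Laplace exponent $\Psi_V$, let $V^{\uparrow}$ be $V$ conditioned to stay positive (starting from $0$), and let $I(V^{\uparrow}) := \int_0^{+\infty} e^{-V^{\uparrow}(t)}\,dt$. (i) Assume that there are $\alpha>1$ and a positive constant $C$ such that $\Psi_V(\lambda) \leq C\lambda^{\alpha}$ for all $\lambda$ large enough. Then for all $\delta\in]0,1[$ and all $x>0$ small enough (depending on $\delta$), $$\mathbb{P}\left(I(V^{\uparrow})\leq x\right) \leq \exp\left(-\frac{\delta(\alpha-1)}{(Cx)^{1/(\alpha-1)}}\right).$$ (ii) Assume that there are $\alpha>1$ and a positive constant $c$ such that $\Psi_V(\lambda) \geq c\lambda^{\alpha}$ for all $\lambda$ large enough. Then for all $\delta>1$ and all $x>0$ small enough (depending on $\delta$), $$\mathbb{P}\left(I(V^{\uparrow})\leq x\right) \geq \exp\left(-\frac{\delta\,\alpha^{\alpha/(\alpha-1)}}{(cx)^{1/(\alpha-1)}}\right).$$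
   Context: A spectrally negative Lévy process is a real-valued càdlàg Lévy process $V$ with $V(0)=0$ and no positive jumps. Its Laplace exponent $\Psi_V$ is given by $\mathbb{E}[e^{\lambda V(t)}] = e^{t\Psi_V(\lambda)}$ for $t,\lambda \geq 0$. If $V$ drifts to $-\infty$ (i.e. $V(t)\to-\infty$ a.s.), $\kappa := \inf\{\lambda>0 : \Psi_V(\lambda)=0\}$; otherwise $\kappa := 0$. Write $V_x := x+V$. Scale function: $W:[0,+\infty[\to[0,+\infty[$ is the continuous increasing function with $\int_0^{+\infty} e^{-\lambda x}W(x)\,dx = 1/\Psi_V(\lambda)$ for all $\lambda>\kappa$. $V$ conditioned to stay positive: for $x>0$, $V^{\uparrow}_x$ is the Markov process started from $x$, with values in $]0,+\infty[$ and infinite lifetime, whose transition semigroup is $p^{\uparrow}_t(x,dy) := \frac{W(y)}{W(x)}\,\mathbb{P}\left(V_x(t)\in dy,\ \inf_{[0,t]}V_x>0\right)$. $V^{\uparrow}=V^{\uparrow}_0$ is the process started from $0$ obtained as the limit in distribution of $V^{\uparrow}_x$ as $x\to 0+$; it is a Feller process whose transition laws restricted to $]0,+\infty[$ are given by $p^{\uparrow}_t$. *)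

theory Defs
  imports "HOL-Probability.Probability"
begin

text \<open>Processes are indexed by \<^typ>\<open>real\<close>; only times \<open>t \<ge> 0\<close> are ever constrained or used.\<close>

definition cadlag :: "(real \<Rightarrow> real) \<Rightarrow> bool" where
  "cadlag f \<longleftrightarrow>
     (\<forall>t\<ge>0. continuous (at_right t) f) \<and> (\<forall>t>0. \<exists>l. (f \<longlongrightarrow> l) (at_left t))"

locale levy_process = prob_space M
  for M :: "'a measure" and V :: "real \<Rightarrow> 'a \<Rightarrow> real" +
  assumes measurable_V: "t \<ge> 0 \<Longrightarrow> V t \<in> borel_measurable M"
    and V_start: "\<omega> \<in> space M \<Longrightarrow> V 0 \<omega> = 0"
    and V_cadlag: "\<omega> \<in> space M \<Longrightarrow> cadlag (\<lambda>t. V t \<omega>)"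
    and stationary_increments: "s \<ge> 0 \<Longrightarrow> h \<ge> 0 \<Longrightarrow>
      distr M borel (\<lambda>\<omega>. V (s + h) \<omega> - V s \<omega>) = distr M borel (V h)"
    and independent_increments: "(ts :: nat \<Rightarrow> real) 0 \<ge> 0 \<Longrightarrow> incseq ts \<Longrightarrow>
      indep_vars (\<lambda>_. borel) (\<lambda>i \<omega>. V (ts (Suc i)) \<omega> - V (ts i) \<omega>) {..<n}"

locale spectrally_negative_levy_process = levy_process M V
  for M :: "'a measure" and V :: "real \<Rightarrow> 'a \<Rightarrow> real" +
  assumes no_positive_jumps: "\<omega> \<in> space M \<Longrightarrow> t > 0 \<Longrightarrow>
    ((\<lambda>s. V s \<omega>) \<longlongrightarrow> l) (at_left t) \<Longrightarrow> V t \<omega> \<le> l"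

definition subordinator :: "'a measure \<Rightarrow> (real \<Rightarrow> 'a \<Rightarrow> real) \<Rightarrow> bool" where
  "subordinator M S \<longleftrightarrow> levy_process M S \<and> (AE \<omega> in M. mono_on {0..} (\<lambda>t. S t \<omega>))"

text \<open>The equation forces \<open>exp (l * V t)\<close> to be integrable, since the Bochner integral of a
  non-integrable function is \<open>0\<close>.\<close>

definition is_laplace_exponent ::
    "'a measure \<Rightarrow> (real \<Rightarrow> 'a \<Rightarrow> real) \<Rightarrow> (real \<Rightarrow> real) \<Rightarrow> bool" where
  "is_laplace_exponent M V \<Psi> \<longleftrightarrow>
     (\<forall>t\<ge>0. \<forall>l\<ge>0. (\<integral>\<omega>. exp (l * V t \<omega>) \<partial>M) = exp (t * \<Psi> l))"

definition drifts_to_minus_infinity :: "'a measure \<Rightarrow> (real \<Rightarrow> 'a \<Rightarrow> real) \<Rightarrow> bool" where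
  "drifts_to_minus_infinity M V \<longleftrightarrow> (AE \<omega> in M. filterlim (\<lambda>t. V t \<omega>) at_bot at_top)"

definition kappa ::
    "'a measure \<Rightarrow> (real \<Rightarrow> 'a \<Rightarrow> real) \<Rightarrow> (real \<Rightarrow> real) \<Rightarrow> real" where
  "kappa M V \<Psi> = (if drifts_to_minus_infinity M V then Inf {l. l > 0 \<and> \<Psi> l = 0} else 0)"

definition is_scale_function ::
    "'a measure \<Rightarrow> (real \<Rightarrow> 'a \<Rightarrow> real) \<Rightarrow> (real \<Rightarrow> real) \<Rightarrow> (real \<Rightarrow> real) \<Rightarrow> bool" where
  "is_scale_function M V \<Psi> W \<longleftrightarrow>
     (\<forall>x\<ge>0. W x \<ge> 0) \<and> continuous_on {0..} W \<and> mono_on {0..} W \<and>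
     (\<forall>l>kappa M V \<Psi>.
        set_integrable lborel {0..} (\<lambda>x. exp (- l * x) * W x) \<and>
        (LINT x:{0..}|lborel. exp (- l * x) * W x) = 1 / \<Psi> l)"

text \<open>The sub-probability measure \<open>P(V\<^sub>x(t) \<in> dy, inf V\<^sub>x > 0 on [0,t])\<close>, where
  \<open>V\<^sub>x = x + V\<close>.\<close>

definition killed_kernel ::
    "'a measure \<Rightarrow> (real \<Rightarrow> 'a \<Rightarrow> real) \<Rightarrow> real \<Rightarrow> real \<Rightarrow> real measure" where
  "killed_kernel M V t x =
     distr (density M (indicator {\<omega> \<in> space M. (INF s\<in>{0..t}. x + V s \<omega>) > 0})) borel
       (\<lambda>\<omega>. x + V t \<omega>)"

text \<open>Only used for \<open>x > 0\<close>. The killed kernel is carried by \<open>]0,\<infinity>[\<close>; the indicator merely keeps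
  the density measurable, since \<open>W\<close> is not constrained on the negative half-line.\<close>

definition conditioned_kernel ::
    "'a measure \<Rightarrow> (real \<Rightarrow> 'a \<Rightarrow> real) \<Rightarrow> (real \<Rightarrow> real) \<Rightarrow> real \<Rightarrow> real \<Rightarrow> real measure" where
  "conditioned_kernel M V W t x =
     density (killed_kernel M V t x) (\<lambda>y. indicator {0<..} y * ennreal (W y / W x))"

definition natural_filtration ::
    "'b measure \<Rightarrow> (real \<Rightarrow> 'b \<Rightarrow> real) \<Rightarrow> real \<Rightarrow> 'b measure" where
  "natural_filtration N X s =
     sigma (space N) (\<Union>u\<in>{0..s}. {X u -` B \<inter> space N | B. B \<in> sets borel})"

definition markov_process ::
    "'b measure \<Rightarrow> (real \<Rightarrow> 'b \<Rightarrow> real) \<Rightarrow> real set \<Rightarrow>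
     (real \<Rightarrow> real \<Rightarrow> real measure) \<Rightarrow> real \<Rightarrow> bool" where
  "markov_process N X E p x \<longleftrightarrow>
     prob_space N \<and>
     (\<forall>t\<ge>0. X t \<in> borel_measurable N) \<and>
     (\<forall>t\<ge>0. \<forall>\<omega>\<in>space N. X t \<omega> \<in> E) \<and>
     (\<forall>\<omega>\<in>space N. X 0 \<omega> = x) \<and>
     (\<forall>s\<ge>0. \<forall>t\<ge>0. \<forall>B\<in>sets borel. AE \<omega> in N.
        real_cond_exp N (natural_filtration N X s) (\<lambda>\<omega>. indicator B (X (s + t) \<omega>)) \<omega>
          = measure (p t (X s \<omega>)) B)"

definition vanishing_continuous :: "(real \<Rightarrow> real) \<Rightarrow> bool" where
  "vanishing_continuous f \<longleftrightarrow> continuous_on {0..} f \<and> (f \<longlongrightarrow> 0) at_top"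

text \<open>Conservative Feller semigroups of kernels on the state space \<open>[0,\<infinity>[\<close>; the integrals are
  restricted to \<open>[0,\<infinity>[\<close> because functions and kernels are arbitrary at negative points.\<close>

definition feller_semigroup :: "(real \<Rightarrow> real \<Rightarrow> real measure) \<Rightarrow> bool" where
  "feller_semigroup p \<longleftrightarrow>
     (\<forall>t\<ge>0. \<forall>x\<ge>0. prob_space (p t x) \<and> sets (p t x) = sets borel \<and> emeasure (p t x) {0..} = 1) \<and>
     (\<forall>x\<ge>0. p 0 x = return borel x) \<and>
     (\<forall>s\<ge>0. \<forall>t\<ge>0. \<forall>x\<ge>0. \<forall>B\<in>sets borel.
        emeasure (p (s + t) x) B = (\<integral>\<^sup>+y\<in>{0..}. emeasure (p t y) B \<partial>p s x)) \<and>
     (\<forall>f. vanishing_continuous f \<longrightarrow>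
        (\<forall>t\<ge>0. vanishing_continuous (\<lambda>x. LINT y:{0..}|p t x. f y)) \<and>
        uniform_limit {0..} (\<lambda>t x. LINT y:{0..}|p t x. f y) f (at_right 0))"

text \<open>Limit in distribution of the processes \<open>X x\<close> (on \<open>N x\<close>) as \<open>x \<rightarrow> 0+\<close>, in the sense of
  weak convergence of all finite-dimensional distributions. Bounded continuous functions of
  \<open>n\<close> variables are represented by functions on sequences, evaluated at sequences padded by
  \<open>0\<close>.\<close>

definition limit_in_distribution_at_0 ::
    "(real \<Rightarrow> 'b measure) \<Rightarrow> (real \<Rightarrow> real \<Rightarrow> 'b \<Rightarrow> real) \<Rightarrow>
     'b measure \<Rightarrow> (real \<Rightarrow> 'b \<Rightarrow> real) \<Rightarrow> bool" where
  "limit_in_distribution_at_0 N X N' X' \<longleftrightarrow>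
     (\<forall>(n::nat) (ts::nat \<Rightarrow> real) (f::(nat \<Rightarrow> real) \<Rightarrow> real).
        (\<forall>i<n. ts i \<ge> 0) \<longrightarrow> continuous_on UNIV f \<longrightarrow> bounded (range f) \<longrightarrow>
        ((\<lambda>x. \<integral>\<omega>. f (\<lambda>i. if i < n then X x (ts i) \<omega> else 0) \<partial>N x)
           \<longlongrightarrow> (\<integral>\<omega>. f (\<lambda>i. if i < n then X' (ts i) \<omega> else 0) \<partial>N')) (at_right 0))"

text \<open>\<open>X x\<close>, defined on \<open>N x\<close>, is \<open>V\<close> conditioned to stay positive and started from \<open>x \<ge> 0\<close>.
  The starting point \<open>0\<close> is the limit of the positive ones; it lives on \<open>[0,\<infinity>[\<close> and is
  Feller with a semigroup extending that of the \<open>X x\<close>, \<open>x > 0\<close>.\<close>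

definition conditioned_to_stay_positive ::
    "'a measure \<Rightarrow> (real \<Rightarrow> 'a \<Rightarrow> real) \<Rightarrow> (real \<Rightarrow> real) \<Rightarrow>
     (real \<Rightarrow> 'b measure) \<Rightarrow> (real \<Rightarrow> real \<Rightarrow> 'b \<Rightarrow> real) \<Rightarrow> bool" where
  "conditioned_to_stay_positive M V W N X \<longleftrightarrow>
     (\<forall>x>0. markov_process (N x) (X x) {0<..} (conditioned_kernel M V W) x) \<and>
     limit_in_distribution_at_0 N X (N 0) (X 0) \<and>
     (\<forall>\<omega>\<in>space (N 0). cadlag (\<lambda>t. X 0 t \<omega>)) \<and>
     (\<exists>p. feller_semigroup p \<and>
          (\<forall>t\<ge>0. \<forall>x>0. p t x = conditioned_kernel M V W t x) \<and>
          markov_process (N 0) (X 0) {0..} p 0)"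

definition exponential_functional :: "(real \<Rightarrow> 'b \<Rightarrow> real) \<Rightarrow> 'b \<Rightarrow> ennreal" where
  "exponential_functional X \<omega> = (\<integral>\<^sup>+t\<in>{0..}. ennreal (exp (- X t \<omega>)) \<partial>lborel)"

end

theory Submission
  imports Defs
begin

text \<open>
  Write \<open>I\<close> for the exponential functional of the conditioned process \<open>X\<close> started from \<open>0\<close>.
  Everything rests on the formula \<open>E[exp (- l * I)] = 1 / (\<Sum>k. l ^ k * c k)\<close>, where
  \<open>c k = (\<Prod>j<k. 1 / \<Psi> (\<theta> + 1 + j))\<close> up to finitely many factors of the product, and
  \<open>exp (- \<theta> * y)\<close> is the limit of \<open>W (x - y) / W x\<close> as \<open>x\<close> tends to infinity. With \<open>\<Psi> l \<le> C * l powr \<alpha>\<close> or \<open>\<Psi> l \<ge> c * l powr \<alpha>\<close> the series grows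
  like \<open>exp (\<alpha> * (l / C) powr (1 / \<alpha>))\<close>, and Markov's inequality applied to \<open>exp (- l * I)\<close>,
  respectively the bound \<open>P(I \<le> x) \<ge> E[exp (- l * I)] - exp (- l * x)\<close>, with the right choice of \<open>l\<close>
  gives the two claims.

  The Laplace transform comes from the functions \<open>F k\<close> with \<open>F 0 = 1\<close> and
  \<open>W * F (k + 1)\<close> the convolution of \<open>W\<close> with \<open>exp (- y) * W y * F k y\<close>. The potential identity
  \<open>p t (F (k + 1)) = F (k + 1) + (\<integral>s\<le>t. p s (exp (- y) * F k))\<close> makes
  \<open>(\<Sum>k\<le>n. l ^ k * F k (X t)) * exp (- l * (\<integral>s\<le>t. exp (- X s)))\<close> a supermartingale, and a
  martingale in the limit \<open>n \<rightarrow> \<infinity>\<close>; it starts from \<open>1\<close>, and the sum tends to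
  \<open>\<Sum>k\<le>n. l ^ k * c k\<close> when \<open>X t\<close> is large.

  The potential identity is derived from discrete approximations, without stopping times. It uses the
  measure \<open>P h W - W\<close>, which is nonnegative because \<open>W\<close> is invariant for the killed process, and
  which, divided by \<open>h\<close>, converges to the Dirac mass at \<open>0\<close> because its Laplace transform is
  \<open>(exp (h * \<Psi> s) - 1) / \<Psi> s\<close>. The same measure shows that upward moves of \<open>V\<close> over a fixed
  distance in time \<open>h\<close> have probability \<open>o(h)\<close>; this replaces the continuous upward passage of
  \<open>V\<close> in the proof that \<open>W (x - y) / W x\<close> increases with \<open>x\<close>.
\<close>

section \<open>Right-continuous and cadlag functions\<close>

text \<open>Multiplication by \<open>exp (- y)\<close> shifts the argument of a Laplace transform by
  1, and convolution with \<open>W\<close> multiplies the transform by that of \<open>W\<close>,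
  which is 1 / \<open>\<Psi>\<close> at large arguments. Hence the transform of
  \<open>W * F k\<close> at s is a product over s, ..., s + k; this is the origin of
  \<open>c k\<close>. Formally, the generator of the conditioned process maps
  \<open>F (k + 1)\<close> to \<open>exp (- y) * F k\<close>, so it multiplies the power series in l
  with coefficients \<open>F k\<close> by \<open>l * exp (- y)\<close>. The obstacle is that no
  generator is at hand: the conditioned kernels are known only as h-transforms of a semigroup killed
  by an infimum over continuous time, and \<open>\<Psi>\<close> enters only through exponential
  moments of \<open>V\<close> and the transform of \<open>W\<close>. Infinitesimal statements have
  to be extracted from Laplace transforms and made uniform by the Feller property. The two claims
  use the Laplace formula asymmetrically. For (i) a single large term of the series is enough and
  convergence plays no part; the reverse inequality behind (ii) needs \<open>l ^ n * c n\<close> to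
  vanish, which the lower bound on \<open>\<Psi>\<close> provides.\<close>

lemma right_continuous_sequence:
  fixes f :: "real \<Rightarrow> real"
  assumes "continuous (at_right s) f" and "\<And>n. s \<le> u n" and "u \<longlonglongrightarrow> s"
  shows "(\<lambda>n. f (u n)) \<longlonglongrightarrow> f s"
proof (rule LIMSEQ_I)
  fix r :: real assume "r > 0"
  have "(f \<longlongrightarrow> f s) (at_right s)" using assms(1) by (simp add: continuous_within)
  then have "\<forall>\<^sub>F x in at_right s. dist (f x) (f s) < r" using \<open>r > 0\<close> by (rule tendstoD)
  then obtain b where b: "b > s" "\<And>y. y > s \<Longrightarrow> y < b \<Longrightarrow> dist (f y) (f s) < r"
    unfolding eventually_at_right_field by auto
  have "\<forall>\<^sub>F n in sequentially. u n < b" using assms(3) b(1) by (rule order_tendstoD)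
  then obtain N where N: "\<And>n. n \<ge> N \<Longrightarrow> u n < b" unfolding eventually_sequentially by auto
  have "norm (f (u n) - f s) < r" if "n \<ge> N" for n
  proof (cases "u n = s")
    case False
    then have "dist (f (u n)) (f s) < r" using N[OF that] assms(2)[of n] by (intro b(2)) auto
    then show ?thesis by (simp add: dist_norm)
  qed (simp add: \<open>r > 0\<close>)
  then show "\<exists>N. \<forall>n\<ge>N. norm (f (u n) - f s) < r" by blast
qed

text \<open>Rounds s up to the grid of mesh t / (n + 1). Rounding up approaches s from the right,
  the side on which cadlag functions are continuous.\<close>

definition upper_grid :: "real \<Rightarrow> nat \<Rightarrow> real \<Rightarrow> real" where
  "upper_grid t n s = t * \<lceil>real (Suc n) * s / t\<rceil> / real (Suc n)"

lemma upper_grid_tendsto: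
  fixes t v :: real
  assumes "t > 0"
  shows "(\<lambda>n. upper_grid t n v) \<longlonglongrightarrow> v"
    and "v \<le> upper_grid t n v"
proof -
  have lo: "v \<le> t * \<lceil>N * v / t\<rceil> / N" and hi: "t * \<lceil>N * v / t\<rceil> / N \<le> v + t * inverse N"
    if "N > 0" for N
  proof -
    have "t * (N * v / t) \<le> t * \<lceil>N * v / t\<rceil>"
      using assms by (intro mult_left_mono le_of_int_ceiling) auto
    then have "N * v \<le> t * \<lceil>N * v / t\<rceil>" using assms by simp
    then show "v \<le> t * \<lceil>N * v / t\<rceil> / N" using that by (simp add: pos_le_divide_eq mult.commute)
    have "\<lceil>N * v / t\<rceil> \<le> N * v / t + 1" by linarith
    then have "t * \<lceil>N * v / t\<rceil> \<le> t * (N * v / t + 1)"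
      using assms by (intro mult_left_mono) auto
    also have "\<dots> = (v + t * inverse N) * N" using assms that by (simp add: algebra_simps)
    finally show "t * \<lceil>N * v / t\<rceil> / N \<le> v + t * inverse N" using that by (simp add: pos_divide_le_eq)
  qed
  show "v \<le> upper_grid t n v" unfolding upper_grid_def by (rule lo) simp
  have "(\<lambda>n. v + t * inverse (real (Suc n))) \<longlonglongrightarrow> v + t * 0"
    by (intro tendsto_intros LIMSEQ_inverse_real_of_nat)
  then have lim: "(\<lambda>n. v + t * inverse (real (Suc n))) \<longlonglongrightarrow> v" by simp
  show "(\<lambda>n. upper_grid t n v) \<longlonglongrightarrow> v"
  proof (rule tendsto_sandwich[OF _ _ tendsto_const lim])
    show "\<forall>\<^sub>F n in sequentially. v \<le> upper_grid t n v"
      unfolding upper_grid_def by (intro always_eventually allI lo) simp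
    show "\<forall>\<^sub>F n in sequentially. upper_grid t n v \<le> v + t * inverse (real (Suc n))"
      unfolding upper_grid_def by (intro always_eventually allI hi) simp
  qed
qed

lemma upper_grid_le:
  assumes "t > 0" "s \<le> t"
  shows "upper_grid t n s \<le> t"
proof -
  have "real (Suc n) * s / t \<le> real (Suc n)"
    using assms by (simp add: pos_divide_le_eq mult_left_mono del: of_nat_Suc)
  then have "\<lceil>real (Suc n) * s / t\<rceil> \<le> int (Suc n)" by (intro ceiling_le) simp
  then have "real_of_int \<lceil>real (Suc n) * s / t\<rceil> \<le> real (Suc n)" by linarith
  then have "t * \<lceil>real (Suc n) * s / t\<rceil> \<le> t * real (Suc n)" using assms(1) by (intro mult_left_mono) auto
  then show ?thesis unfolding upper_grid_def by (simp add: pos_divide_le_eq del: of_nat_Suc)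
qed

lemma measurable_upper_grid:
  fixes f :: "real \<Rightarrow> real"
  shows "(\<lambda>s. f (upper_grid t n s)) \<in> borel_measurable borel"
proof -
  have "(\<lambda>s::real. \<lceil>real (Suc n) * s / t\<rceil>) \<in> measurable borel (count_space UNIV)"
    by measurable
  moreover have "(\<lambda>k::int. f (t * real_of_int k / real (Suc n))) \<in> measurable (count_space UNIV) borel"
    by simp
  ultimately show ?thesis unfolding upper_grid_def
    by (rule measurable_compose[where f="\<lambda>s. \<lceil>real (Suc n) * s / t\<rceil>"])
qed

text \<open>On each half-open cell the ceiling is constant, so integrating a function of the rounded
  argument gives exactly a right Riemann sum, one summand per cell.\<close>

lemma ceiling_step_integral:
  fixes f :: "real \<Rightarrow> real" and h :: real
  assumes h: "h > 0"
  shows "set_integrable lborel {0<..real n * h} (\<lambda>s. f (h * \<lceil>s / h\<rceil>)) \<and>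
    (LINT s:{0<..real n * h}|lborel. f (h * \<lceil>s / h\<rceil>)) = (\<Sum>j<n. h * f (h * (real j + 1)))"
proof (induction n)
  case 0 then show ?case by (simp add: set_integrable_def set_lebesgue_integral_def)
next
  case (Suc n)
  let ?A = "{real n * h<..real (Suc n) * h}"
  have eq: "f (h * \<lceil>s / h\<rceil>) = f (h * (real n + 1))" if "s \<in> ?A" for s
  proof -
    have "\<lceil>s / h\<rceil> = int n + 1"
      using that h by (intro ceiling_unique) (auto simp: field_simps)
    then show ?thesis by simp
  qed
  have m: "emeasure lborel ?A < \<infinity>" by (simp add: emeasure_lborel_Ioc mult_right_mono h less_imp_le)
  have c: "set_integrable lborel ?A (\<lambda>s. f (h * (real n + 1)))"
    unfolding set_integrable_def using m by (intro integrable_scaleR_left) auto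
  have i: "set_integrable lborel ?A (\<lambda>s. f (h * \<lceil>s / h\<rceil>))"
    using c by (subst set_integrable_cong[OF refl refl eq]) auto
  have v: "(LINT s:?A|lborel. f (h * \<lceil>s / h\<rceil>)) = h * f (h * (real n + 1))"
  proof -
    have "(LINT s:?A|lborel. f (h * \<lceil>s / h\<rceil>)) = (LINT s:?A|lborel. f (h * (real n + 1)))"
      by (rule set_lebesgue_integral_cong) (auto simp: eq)
    also have "\<dots> = measure lborel ?A * f (h * (real n + 1))"
      using m by (simp add: set_lebesgue_integral_def)
    also have "measure lborel ?A = h" using h by (simp add: mult_right_mono algebra_simps)
    finally show ?thesis .
  qed
  have "real n * h \<le> real (Suc n) * h" using h by (simp add: mult_right_mono)
  then have un: "{0<..real (Suc n) * h} = {0<..real n * h} \<union> ?A"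
    using h by (simp add: ivl_disj_un)
  have dj: "{0<..real n * h} \<inter> ?A = {}" by auto
  show ?case unfolding un
    using set_integrable_Un[OF conjunct1[OF Suc] i] set_integral_Un[OF dj conjunct1[OF Suc] i] Suc v
    by auto
qed

text \<open>Dominated convergence for f composed with \<open>upper_grid t n\<close>. Measurability
  of f is obtained along the way, as that of a limit of step functions.\<close>

lemma right_continuous_riemann_sum:
  fixes f :: "real \<Rightarrow> real"
  assumes t: "t > 0" and rc: "\<And>s. s \<ge> 0 \<Longrightarrow> continuous (at_right s) f"
    and bd: "\<And>s. 0 \<le> s \<Longrightarrow> s \<le> t \<Longrightarrow> \<bar>f s\<bar> \<le> B"
  shows "set_integrable lborel {0<..t} f"
    and "(\<lambda>n. \<Sum>j<Suc n. t / real (Suc n) * f (t * real (Suc j) / real (Suc n)))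
           \<longlonglongrightarrow> (LINT s:{0<..t}|lborel. f s)"
proof -
  let ?u = "upper_grid t"
  let ?F = "\<lambda>n s. indicator {0<..t} s *\<^sub>R f (?u n s)"
  let ?G = "\<lambda>s. indicator {0<..t} s *\<^sub>R f s"
  have F[measurable]: "?F n \<in> borel_measurable lborel" for n
    using measurable_upper_grid[of f t n] by (intro borel_measurable_scaleR borel_measurable_indicator) auto
  have lim: "(\<lambda>n. ?F n s) \<longlonglongrightarrow> ?G s" for s
  proof (cases "s \<in> {0<..t}")
    case True
    then have "(\<lambda>n. f (?u n s)) \<longlonglongrightarrow> f s"
      using upper_grid_tendsto[OF t, of s] by (intro right_continuous_sequence[OF rc]) auto
    then show ?thesis using True by simp
  qed simp
  have G[measurable]: "?G \<in> borel_measurable lborel"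
    using borel_measurable_LIMSEQ_real[of lborel ?F ?G] lim F by blast
  have le: "norm (?F n s) \<le> indicator {0<..t} s *\<^sub>R B" for n s
  proof (cases "s \<in> {0<..t}")
    case True
    then have "0 \<le> ?u n s" using upper_grid_tendsto(2)[OF t, of s n] by auto
    moreover have "?u n s \<le> t" using True t by (intro upper_grid_le) auto
    ultimately show ?thesis using True bd by auto
  qed simp
  have I: "integrable lborel (\<lambda>s. indicator {0<..t} s *\<^sub>R B)"
    using t by (intro integrable_scaleR_left) (simp add: emeasure_lborel_Ioc)
  have A: "integrable lborel ?G" "(\<lambda>n. integral\<^sup>L lborel (?F n)) \<longlonglongrightarrow> integral\<^sup>L lborel ?G"
  proof -
    show "integrable lborel ?G"
      by (rule integrable_dominated_convergence[OF G F I AE_I2[OF lim] AE_I2[OF le]])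
    show "(\<lambda>n. integral\<^sup>L lborel (?F n)) \<longlonglongrightarrow> integral\<^sup>L lborel ?G"
      by (rule integral_dominated_convergence[OF G F I AE_I2[OF lim] AE_I2[OF le]])
  qed
  show "set_integrable lborel {0<..t} f" using A(1) by (simp add: set_integrable_def)
  have "integral\<^sup>L lborel (?F n) = (\<Sum>j<Suc n. t / real (Suc n) * f (t * real (Suc j) / real (Suc n)))" for n
  proof -
    let ?h = "t / real (Suc n)"
    have eq: "f (?u n s) = f (?h * \<lceil>s / ?h\<rceil>)" for s
      by (simp add: upper_grid_def mult.commute del: of_nat_Suc)
    have "integral\<^sup>L lborel (?F n) = (LINT s:{0<..real (Suc n) * ?h}|lborel. f (?h * \<lceil>s / ?h\<rceil>))"
      unfolding set_lebesgue_integral_def eq by simp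
    also have "\<dots> = (\<Sum>j<Suc n. ?h * f (?h * (real j + 1)))"
      using ceiling_step_integral[of ?h "Suc n" f] t by simp
    finally show ?thesis by (simp add: add.commute)
  qed
  then show "(\<lambda>n. \<Sum>j<Suc n. t / real (Suc n) * f (t * real (Suc j) / real (Suc n)))
           \<longlonglongrightarrow> (LINT s:{0<..t}|lborel. f s)"
    using A(2) by (simp add: set_lebesgue_integral_def)
qed

text \<open>Right continuity and the left limit bound f near every point, and finitely many such
  neighbourhoods cover \<open>{0..t}\<close>. At 0 there is nothing to the left within the
  half-line, so the left bound is vacuous there.\<close>

lemma cadlag_bounded:
  assumes "cadlag f"
  shows "\<exists>B. \<forall>s\<in>{0..t}. \<bar>f s\<bar> \<le> B"
proof -
  have loc: "\<exists>d B. d > 0 \<and> (\<forall>u\<in>ball s d. 0 \<le> u \<longrightarrow> \<bar>f u\<bar> \<le> B)" if s: "s \<in> {0..t}" for s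
  proof -
    have "(f \<longlongrightarrow> f s) (at_right s)" using assms s by (simp add: cadlag_def continuous_within)
    then have "\<forall>\<^sub>F x in at_right s. dist (f x) (f s) < 1" by (rule tendstoD) simp
    then obtain b where b: "b > s" "\<And>y. y > s \<Longrightarrow> y < b \<Longrightarrow> dist (f y) (f s) < 1"
      unfolding eventually_at_right_field by auto
    have "\<exists>a<s. \<exists>B. \<forall>y. 0 \<le> y \<longrightarrow> y > a \<longrightarrow> y < s \<longrightarrow> \<bar>f y\<bar> \<le> B"
    proof (cases "s = 0")
      case True then show ?thesis by (intro exI[of _ "s - 1"]) auto
    next
      case False
      then have "s > 0" using s by simp
      then obtain l where "(f \<longlongrightarrow> l) (at_left s)" using assms unfolding cadlag_def by blast
      then have "\<forall>\<^sub>F x in at_left s. dist (f x) l < 1" by (rule tendstoD) simp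
      then obtain a where a: "a < s" "\<And>y. y > a \<Longrightarrow> y < s \<Longrightarrow> dist (f y) l < 1"
        unfolding eventually_at_left_field by auto
      show ?thesis
        using a by (intro exI[of _ a] conjI exI[of _ "\<bar>l\<bar> + 1"]) (force simp: dist_real_def)+
    qed
    then obtain a B where a: "a < s" "\<And>y. 0 \<le> y \<Longrightarrow> y > a \<Longrightarrow> y < s \<Longrightarrow> \<bar>f y\<bar> \<le> B" by blast
    have "\<forall>u\<in>ball s (min (b - s) (s - a)). 0 \<le> u \<longrightarrow> \<bar>f u\<bar> \<le> max B (\<bar>f s\<bar> + 1)"
    proof (intro ballI impI)
      fix u assume u: "u \<in> ball s (min (b - s) (s - a))" "0 \<le> u"
      consider "u < s" | "u = s" | "u > s" by linarith
      then show "\<bar>f u\<bar> \<le> max B (\<bar>f s\<bar> + 1)"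
      proof cases
        case 1 then show ?thesis using a(2)[of u] u by (auto simp: dist_real_def)
      next
        case 3 then show ?thesis using b(2)[of u] u by (auto simp: dist_real_def)
      qed auto
    qed
    moreover have "0 < min (b - s) (s - a)" using a b by simp
    ultimately show ?thesis by blast
  qed
  then obtain d B where dB: "\<And>s. s \<in> {0..t} \<Longrightarrow> d s > 0"
    "\<And>s u. s \<in> {0..t} \<Longrightarrow> u \<in> ball s (d s) \<Longrightarrow> 0 \<le> u \<Longrightarrow> \<bar>f u\<bar> \<le> B s" by metis
  obtain C where C: "C \<subseteq> {0..t}" "finite C" "{0..t} \<subseteq> (\<Union>s\<in>C. ball s (d s))"
    by (rule compactE_image[OF compact_Icc, of "{0..t}" "\<lambda>s. ball s (d s)"]) (use dB(1) in force)+
  show ?thesis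
  proof (intro exI[of _ "Max (insert 0 (B ` C))"] ballI)
    fix s assume s: "s \<in> {0..t}"
    then obtain c where c: "c \<in> C" "s \<in> ball c (d c)" using C(3) by blast
    then have "\<bar>f s\<bar> \<le> B c" using dB(2)[of c s] C(1) s by auto
    also have "\<dots> \<le> Max (insert 0 (B ` C))" using C(2) c(1) by (intro Max_ge) auto
    finally show "\<bar>f s\<bar> \<le> Max (insert 0 (B ` C))" .
  qed
qed

section \<open>Running infima and their description by dyadic times\<close>

definition running_inf :: "(real \<Rightarrow> real) \<Rightarrow> real \<Rightarrow> real" where
  "running_inf f t = (INF s\<in>{0..t}. f s)"

lemma cadlag_bdd_below: "cadlag f \<Longrightarrow> bdd_below (f ` {0..t})"
proof -
  assume "cadlag f"
  then obtain B where "\<And>s. s \<in> {0..t} \<Longrightarrow> \<bar>f s\<bar> \<le> B" using cadlag_bounded by blast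
  then show "bdd_below (f ` {0..t})" by (intro bdd_belowI[where m="- B"]) (force simp: abs_le_iff)
qed

lemma running_inf_le: "cadlag f \<Longrightarrow> 0 \<le> s \<Longrightarrow> s \<le> t \<Longrightarrow> running_inf f t \<le> f s"
  unfolding running_inf_def by (intro cINF_lower cadlag_bdd_below) auto

text \<open>Right continuity carries a strict inequality from an arbitrary time to a grid time
  slightly to its right. The dyadic times are countable, which makes the infimum measurable, and
  their grids are nested, which makes discretised survival events decrease.\<close>

lemma running_inf_less_iff:
  assumes "cadlag f" and t: "t \<ge> 0"
  shows "running_inf f t < c \<longleftrightarrow> (\<exists>n. \<exists>k\<le>2^n. f (t * real k / 2^n) < c)"
proof
  assume "running_inf f t < c"
  then obtain s where s: "0 \<le> s" "s \<le> t" "f s < c"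
    unfolding running_inf_def using cINF_less_iff[of "{0..t}" f c] cadlag_bdd_below[OF assms(1)] t by auto
  show "\<exists>n. \<exists>k\<le>2^n. f (t * real k / 2^n) < c"
  proof (cases "t = 0")
    case True
    then show ?thesis using s by (intro exI[of _ 0] exI[of _ 0]) auto
  next
    case False
    then have t: "t > 0" using t by simp
    let ?u = "\<lambda>n. upper_grid t n s"
    \<comment> \<open>\<open>upper_grid t n\<close> has mesh t / (n + 1), so the index 2 ^ n - 1
      selects the dyadic grid.\<close>
    let ?r = "\<lambda>n::nat. 2^n - 1 :: nat"
    have r: "real (Suc (?r n)) = 2^n" for n by (simp add: of_nat_diff)
    have "strict_mono ?r" unfolding strict_mono_Suc_iff by (auto intro!: diff_less_mono)
    then have "(\<lambda>n. ?u (?r n)) \<longlonglongrightarrow> s"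
      using LIMSEQ_subseq_LIMSEQ[OF upper_grid_tendsto(1)[OF t, of s], of ?r] unfolding o_def by blast
    then have "(\<lambda>n. f (?u (?r n))) \<longlonglongrightarrow> f s"
      using upper_grid_tendsto(2)[OF t, of s] assms(1) s
      by (intro right_continuous_sequence[of s f]) (auto simp: cadlag_def)
    then have "\<forall>\<^sub>F n in sequentially. f (?u (?r n)) < c" using s(3) by (rule order_tendstoD)
    then obtain n where n: "f (?u (?r n)) < c" by (auto simp: eventually_sequentially)
    have "0 \<le> 2^n * s / t" using s t by simp
    then have ge: "0 \<le> \<lceil>2^n * s / t\<rceil>" by linarith
    have "2^n * s / t \<le> 2^n" using s t by (simp add: divide_le_eq)
    then have le: "\<lceil>2^n * s / t\<rceil> \<le> 2^n" by (simp add: ceiling_le_iff)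
    have "nat \<lceil>2^n * s / t\<rceil> \<le> 2^n" using le ge by (simp add: nat_le_iff)
    moreover have "f (t * real (nat \<lceil>2^n * s / t\<rceil>) / 2^n) < c"
      using n ge unfolding r upper_grid_def by simp
    ultimately show ?thesis by blast
  qed
next
  assume "\<exists>n. \<exists>k\<le>2^n. f (t * real k / 2^n) < c"
  then obtain n k where k: "k \<le> 2^n" "f (t * real k / 2^n) < c" by blast
  have "real k \<le> 2^n" using k(1) by (metis of_nat_le_iff of_nat_numeral of_nat_power)
  then have "t * real k / 2^n \<le> t" using t by (simp add: divide_le_eq mult_left_mono)
  then have "running_inf f t \<le> f (t * real k / 2^n)" using assms by (intro running_inf_le) auto
  then show "running_inf f t < c" using k by linarith
qed

lemma running_inf_shift:
  assumes "cadlag f" and "t \<ge> 0"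
  shows "(INF s\<in>{0..t}. x + f s) = x + running_inf f t"
  unfolding running_inf_def
proof (rule cInf_eq_non_empty)
  show "(\<lambda>s. x + f s) ` {0..t} \<noteq> {}" using assms by simp
  show "x + (INF s\<in>{0..t}. f s) \<le> y" if "y \<in> (\<lambda>s. x + f s) ` {0..t}" for y
    using that running_inf_le[OF assms(1)] unfolding running_inf_def by auto
  show "y \<le> x + (INF s\<in>{0..t}. f s)" if "\<And>z. z \<in> (\<lambda>s. x + f s) ` {0..t} \<Longrightarrow> y \<le> z" for y
  proof -
    have "y - x \<le> (INF s\<in>{0..t}. f s)" using assms that by (intro cINF_greatest) (auto simp: algebra_simps)
    then show ?thesis by simp
  qed
qed

section \<open>The killed semigroup\<close>

text \<open>
  Only the values of the Laplace transform of \<open>W\<close> at large arguments matter, so the constant \<open>kappa\<close> is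
  replaced by an arbitrary bound \<open>k0\<close>. In particular, it does no harm that \<open>kappa\<close> would be the
  infimum of the empty set if \<open>\<Psi>\<close> had no positive zero.
\<close>

locale scale_setting = levy_process M V
  for M :: "'a measure" and V :: "real \<Rightarrow> 'a \<Rightarrow> real" +
  fixes \<Psi> W :: "real \<Rightarrow> real" and p :: "real \<Rightarrow> real \<Rightarrow> real measure" and k0 :: real
  assumes laplace_exponent: "is_laplace_exponent M V \<Psi>"
    and W_nonneg: "x \<ge> 0 \<Longrightarrow> W x \<ge> 0"
    and W_continuous: "continuous_on {0..} W"
    and W_mono: "mono_on {0..} W"
    and k0_nonneg: "k0 \<ge> 0"
    and W_laplace: "l > k0 \<Longrightarrow> set_integrable lborel {0..} (\<lambda>x. exp (- l * x) * W x) \<and>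
        (LINT x:{0..}|lborel. exp (- l * x) * W x) = 1 / \<Psi> l"
    and feller: "feller_semigroup p"
    and kernel: "t \<ge> 0 \<Longrightarrow> x > 0 \<Longrightarrow> p t x = conditioned_kernel M V W t x"
begin

text \<open>\<open>Wt\<close> extends \<open>W\<close> by zero; \<open>W\<close> itself is arbitrary at negative arguments.\<close>

definition Wt :: "real \<Rightarrow> real" where
  "Wt x = (if x > 0 then W x else 0)"

definition m :: "real \<Rightarrow> 'a \<Rightarrow> real" where
  "m t \<omega> = running_inf (\<lambda>s. V s \<omega>) t"

text \<open>\<open>P\<close> is the semigroup of \<open>V\<close> and \<open>K\<close> that of
  \<open>V\<close> killed on leaving the open positive half-line. Values in \<open>ennreal\<close>
  spare integrability conditions; signed quantities are moved to the other side of an inequality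
  instead.\<close>

definition P :: "real \<Rightarrow> (real \<Rightarrow> ennreal) \<Rightarrow> real \<Rightarrow> ennreal" where
  "P t u x = (\<integral>\<^sup>+\<omega>. u (x + V t \<omega>) \<partial>M)"

definition K :: "real \<Rightarrow> (real \<Rightarrow> ennreal) \<Rightarrow> real \<Rightarrow> ennreal" where
  "K t u x = (\<integral>\<^sup>+\<omega>. u (x + V t \<omega>) * indicator {0<..} (x + m t \<omega>) \<partial>M)"

section \<open>Basic rules for the free and the killed semigroup\<close>

lemma Wt_nonneg [simp]: "Wt x \<ge> 0"
  by (simp add: Wt_def W_nonneg)

lemma Wt_mono: "x \<le> y \<Longrightarrow> Wt x \<le> Wt y"
  using mono_onD[OF W_mono, of x y] by (auto simp: Wt_def W_nonneg)

lemma Wt_measurable [measurable]: "Wt \<in> borel_measurable borel"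
  by (intro borel_measurable_mono monoI Wt_mono)

lemma Wt_eq [simp]: "x > 0 \<Longrightarrow> Wt x = W x" "x \<le> 0 \<Longrightarrow> Wt x = 0"
  by (auto simp: Wt_def)

lemma m_measurable:
  assumes t: "t \<ge> 0"
  shows "m t \<in> borel_measurable M"
proof (subst borel_measurable_iff_less, rule allI)
  fix c
  have "{\<omega> \<in> space M. m t \<omega> < c} = (\<Union>n. \<Union>k\<in>{..2^n}. {\<omega> \<in> space M. V (t * real k / 2^n) \<omega> < c})"
    using running_inf_less_iff[OF V_cadlag t, of _ c] unfolding m_def by (auto simp: Bex_def)
  also have "\<dots> \<in> sets M"
  proof (intro sets.countable_UN'' sets.finite_UN)
    fix n k
    have [measurable]: "V (t * real k / 2 ^ n) \<in> borel_measurable M" using t by (intro measurable_V) simp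
    show "{\<omega> \<in> space M. V (t * real k / 2 ^ n) \<omega> < c} \<in> sets M" by measurable
  qed auto
  finally show "{\<omega> \<in> space M. m t \<omega> < c} \<in> sets M" .
qed

lemma m_le: "\<omega> \<in> space M \<Longrightarrow> 0 \<le> s \<Longrightarrow> s \<le> t \<Longrightarrow> m t \<omega> \<le> V s \<omega>"
  unfolding m_def by (intro running_inf_le V_cadlag)

lemma K_measurable [measurable]:
  assumes [measurable]: "u \<in> borel_measurable borel" and t: "t \<ge> 0"
  shows "K t u \<in> borel_measurable borel"
proof -
  note [measurable] = m_measurable[OF t] measurable_V[OF t]
  show ?thesis unfolding K_def by measurable
qed

lemma P_measurable [measurable]:
  assumes [measurable]: "u \<in> borel_measurable borel" and t: "t \<ge> 0"
  shows "P t u \<in> borel_measurable borel"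
proof -
  note [measurable] = measurable_V[OF t]
  show ?thesis unfolding P_def by measurable
qed

text \<open>The end point of a surviving path lies above its infimum, hence in the positive
  half-line, so a comparison there suffices.\<close>

lemma K_mono: "(\<And>y. y > 0 \<Longrightarrow> u y \<le> v y) \<Longrightarrow> t \<ge> 0 \<Longrightarrow> K t u x \<le> K t v x"
  unfolding K_def
proof (rule nn_integral_mono)
  fix \<omega> assume "\<omega> \<in> space M" "t \<ge> 0" and *: "\<And>y. y > 0 \<Longrightarrow> u y \<le> v y"
  then show "u (x + V t \<omega>) * indicator {0<..} (x + m t \<omega>) \<le> v (x + V t \<omega>) * indicator {0<..} (x + m t \<omega>)"
    using m_le[of \<omega> t t] *[of "x + V t \<omega>"] by (auto split: split_indicator)
qed

lemma K_cong: "(\<And>y. y > 0 \<Longrightarrow> u y = v y) \<Longrightarrow> t \<ge> 0 \<Longrightarrow> K t u x = K t v x"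
  by (intro antisym K_mono) auto

lemma K_le_P: "K t u x \<le> P t u x"
  unfolding K_def P_def by (intro nn_integral_mono) (auto split: split_indicator)

lemma K_cmult:
  assumes [measurable]: "u \<in> borel_measurable borel" and t: "t \<ge> 0"
  shows "K t (\<lambda>y. c * u y) x = c * K t u x"
proof -
  note [measurable] = m_measurable[OF t] measurable_V[OF t]
  show ?thesis unfolding K_def by (subst nn_integral_cmult[symmetric]) (auto simp: ac_simps)
qed

lemma K_add:
  assumes [measurable]: "u \<in> borel_measurable borel" "v \<in> borel_measurable borel" and t: "t \<ge> 0"
  shows "K t (\<lambda>y. u y + v y) x = K t u x + K t v x"
proof -
  note [measurable] = m_measurable[OF t] measurable_V[OF t]
  show ?thesis unfolding K_def by (subst nn_integral_add[symmetric]) (auto simp: distrib_right)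
qed

lemma K_SUP:
  assumes [measurable]: "\<And>i::nat. U i \<in> borel_measurable borel" and inc: "incseq U" and t: "t \<ge> 0"
  shows "K t (\<lambda>y. SUP i. U i y) x = (SUP i. K t (U i) x)"
proof -
  note [measurable] = m_measurable[OF t] measurable_V[OF t]
  have "K t (\<lambda>y. SUP i. U i y) x =
      (\<integral>\<^sup>+\<omega>. (SUP i. U i (x + V t \<omega>) * indicator {0<..} (x + m t \<omega>)) \<partial>M)"
    unfolding K_def by (intro nn_integral_cong) (simp add: SUP_mult_right_ennreal)
  also have "\<dots> = (SUP i. K t (U i) x)"
    unfolding K_def using inc
    by (intro nn_integral_monotone_convergence_SUP)
       (auto simp: incseq_def le_fun_def intro!: mult_right_mono)
  finally show ?thesis .
qed

section \<open>The conditioned kernels as h-transforms of the killed semigroup\<close>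

lemma p_props:
  assumes "t \<ge> 0" "x \<ge> 0"
  shows sets_p [simp]: "sets (p t x) = sets borel"
    and prob_p: "prob_space (p t x)"
    and p_nonneg: "emeasure (p t x) {0..} = 1"
  using conjunct1[OF feller[unfolded feller_semigroup_def]] assms by simp_all

lemma p_nn_integral_aux:
  assumes [measurable]: "u \<in> borel_measurable borel" and t: "t \<ge> 0" and x: "x > 0"
  shows "(\<integral>\<^sup>+y. u y \<partial>p t x) = K t (\<lambda>y. u y * (indicator {0<..} y * ennreal (W y / W x))) x"
proof -
  note [measurable] = m_measurable[OF t] measurable_V[OF t]
  let ?A = "{\<omega> \<in> space M. (INF s\<in>{0..t}. x + V s \<omega>) > 0}"
  have A: "?A = {\<omega> \<in> space M. x + m t \<omega> > 0}"
    using running_inf_shift[OF V_cadlag t] unfolding m_def by auto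
  then have [measurable]: "?A \<in> sets M" by simp
  have w: "(\<lambda>y. indicator {0<..} y * ennreal (W y / W x)) = (\<lambda>y. ennreal (Wt y / W x))"
    by (auto simp: Wt_def split: split_indicator)
  have wm[measurable]: "(\<lambda>y. indicator {0<..} y * ennreal (W y / W x)) \<in> borel_measurable borel"
    unfolding w by measurable
  have "(\<integral>\<^sup>+y. u y \<partial>p t x) = (\<integral>\<^sup>+y. (indicator {0<..} y * ennreal (W y / W x)) * u y \<partial>killed_kernel M V t x)"
    unfolding kernel[OF t x] conditioned_kernel_def
    by (rule nn_integral_density) (simp_all add: killed_kernel_def)
  also have "\<dots> = (\<integral>\<^sup>+\<omega>. indicator ?A \<omega> *
      ((indicator {0<..} (x + V t \<omega>) * ennreal (W (x + V t \<omega>) / W x)) * u (x + V t \<omega>)) \<partial>M)"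
    unfolding killed_kernel_def
    by (subst nn_integral_distr) (simp_all add: nn_integral_density)
  also have "\<dots> = K t (\<lambda>y. u y * (indicator {0<..} y * ennreal (W y / W x))) x"
    unfolding K_def A by (intro nn_integral_cong) (auto simp: mult.commute split: split_indicator)
  finally show ?thesis .
qed

text \<open>If \<open>W x\<close> were \<open>0\<close>, the density \<open>W y / W x\<close> of a probability measure would be the zero
  function.\<close>

lemma W_pos: "x > 0 \<Longrightarrow> W x > 0"
proof (rule ccontr)
  assume x: "x > 0" "\<not> W x > 0"
  then have "W x = 0" using W_nonneg[of x] by simp
  interpret P: prob_space "p 0 x" using prob_p[of 0 x] x by simp
  have "(\<integral>\<^sup>+y. 1 \<partial>p 0 x) = 0"
    using p_nn_integral_aux[of "\<lambda>_. 1" 0 x] x \<open>W x = 0\<close> by (simp add: K_def)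
  then show False using P.emeasure_space_1 by simp
qed

lemma Wt_pos: "x > 0 \<Longrightarrow> Wt x > 0"
  by (simp add: W_pos)

lemma divide_Wt_times: "y > 0 \<Longrightarrow> a / ennreal (Wt y) * ennreal (Wt y) = a"
  using W_pos[of y] by (simp add: ennreal_divide_times ennreal_divide_self)

lemma p_nn_integral:
  assumes [measurable]: "u \<in> borel_measurable borel" and t: "t \<ge> 0" and x: "x > 0"
  shows "(\<integral>\<^sup>+y. u y \<partial>p t x) = K t (\<lambda>y. u y * ennreal (Wt y)) x / ennreal (W x)"
proof -
  have "(\<integral>\<^sup>+y. u y \<partial>p t x) = K t (\<lambda>y. inverse (ennreal (W x)) * (u y * ennreal (Wt y))) x"
    unfolding p_nn_integral_aux[OF assms]
    by (intro K_cong t)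
       (simp add: divide_ennreal[symmetric] W_pos x W_nonneg divide_ennreal_def ac_simps)
  also have "\<dots> = inverse (ennreal (W x)) * K t (\<lambda>y. u y * ennreal (Wt y)) x"
    by (intro K_cmult t) measurable
  finally show ?thesis by (simp add: divide_ennreal_def mult.commute)
qed

lemma K_eq_p:
  assumes [measurable]: "u \<in> borel_measurable borel" and t: "t \<ge> 0" and x: "x > 0"
  shows "K t (\<lambda>y. u y * ennreal (Wt y)) x = ennreal (W x) * (\<integral>\<^sup>+y. u y \<partial>p t x)"
  unfolding p_nn_integral[OF assms] ennreal_times_divide mult.commute[of "ennreal (W x)"]
  using W_pos[OF x] by (intro ennreal_mult_divide_eq[symmetric]) auto

text \<open>The total mass 1 of \<open>p t x\<close>, read through the h-transform: \<open>W\<close>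
  is invariant for the killed semigroup.\<close>

lemma K_Wt: "t \<ge> 0 \<Longrightarrow> x > 0 \<Longrightarrow> K t (\<lambda>y. ennreal (Wt y)) x = ennreal (W x)"
  using K_eq_p[of "\<lambda>_. 1" t x] prob_space.emeasure_space_1[OF prob_p[of t x]] by simp

lemma AE_p_pos: "t \<ge> 0 \<Longrightarrow> x > 0 \<Longrightarrow> AE y in p t x. y > 0"
proof -
  assume t: "t \<ge> 0" and x: "x > 0"
  have "emeasure (p t x) {..0} = (\<integral>\<^sup>+y. indicator {..0} y \<partial>p t x)" using t x by simp
  also have "\<dots> = K t (\<lambda>y. indicator {..0} y * ennreal (Wt y)) x / ennreal (W x)"
    using t x by (intro p_nn_integral) auto
  also have "K t (\<lambda>y. indicator {..0} y * ennreal (Wt y)) x = K t (\<lambda>y. 0) x"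
    using t by (intro K_cong) auto
  finally have "emeasure (p t x) {..0} = 0" by (simp add: K_def)
  then show ?thesis using t x by (intro AE_I'[of "{..0}"]) (auto simp: null_sets_def)
qed

text \<open>The semigroup law of \<open>p\<close> is transported through the h-transform; this
  avoids proving a Markov property of \<open>V\<close> jointly with its running infimum. Indicators
  come from the Chapman-Kolmogorov equation of \<open>p\<close>, the rest from monotone class
  induction.\<close>

lemma K_semigroup_Wt:
  assumes v: "v \<in> borel_measurable borel" and s: "s \<ge> 0" and t: "t \<ge> 0" and x: "x > 0"
  shows "K (s + t) (\<lambda>y. v y * ennreal (Wt y)) x = K s (K t (\<lambda>y. v y * ennreal (Wt y))) x"
  using v
proof (induction rule: borel_measurable_induct)
  case (cong f g)
  have "(f :: real \<Rightarrow> ennreal) = g" using cong(3) by auto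
  then show ?case using cong by simp
next
  case (set A)
  then have A[measurable]: "A \<in> sets borel" by simp
  have "K (s + t) (\<lambda>y. indicator A y * ennreal (Wt y)) x = ennreal (W x) * emeasure (p (s + t) x) A"
    using K_eq_p[of "indicator A" "s + t" x] s t x by simp
  also have "emeasure (p (s + t) x) A = (\<integral>\<^sup>+y\<in>{0..}. emeasure (p t y) A \<partial>p s x)"
    using feller s t x A unfolding feller_semigroup_def by (meson less_imp_le)
  also have "\<dots> = (\<integral>\<^sup>+y. K t (\<lambda>y. indicator A y * ennreal (Wt y)) y / ennreal (Wt y) \<partial>p s x)"
  proof (rule nn_integral_cong_AE)
    show "AE y in p s x. emeasure (p t y) A * indicator {0..} y =
        K t (\<lambda>y. indicator A y * ennreal (Wt y)) y / ennreal (Wt y)"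
      using AE_p_pos[OF s x]
    proof eventually_elim
      case (elim y)
      then show ?case using p_nn_integral[of "indicator A" t y] t by simp
    qed
  qed
  also have "ennreal (W x) * \<dots> =
      K s (\<lambda>y. K t (\<lambda>y. indicator A y * ennreal (Wt y)) y / ennreal (Wt y) * ennreal (Wt y)) x"
    using s t x by (intro K_eq_p[symmetric]) auto
  also have "\<dots> = K s (K t (\<lambda>y. indicator A y * ennreal (Wt y))) x"
    using s by (intro K_cong divide_Wt_times)
  finally show ?case .
next
  case (mult u c)
  have [measurable]: "u \<in> borel_measurable borel" by (rule mult)
  have "K (s + t) (\<lambda>y. c * u y * ennreal (Wt y)) x = c * K (s + t) (\<lambda>y. u y * ennreal (Wt y)) x"
    using s t unfolding mult.assoc by (intro K_cmult) auto
  also have "\<dots> = c * K s (K t (\<lambda>y. u y * ennreal (Wt y))) x" by (simp only: mult.IH)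
  also have "\<dots> = K s (\<lambda>z. c * K t (\<lambda>y. u y * ennreal (Wt y)) z) x"
    using s t by (intro K_cmult[symmetric]) auto
  also have "\<dots> = K s (K t (\<lambda>y. c * u y * ennreal (Wt y))) x"
    using s t unfolding mult.assoc by (intro K_cong K_cmult[symmetric]) auto
  finally show ?case .
next
  case (add u w)
  have [measurable]: "u \<in> borel_measurable borel" "w \<in> borel_measurable borel" by (rule add)+
  have "K (s + t) (\<lambda>y. (w y + u y) * ennreal (Wt y)) x =
      K (s + t) (\<lambda>y. w y * ennreal (Wt y)) x + K (s + t) (\<lambda>y. u y * ennreal (Wt y)) x"
    using s t unfolding distrib_right by (intro K_add) auto
  also have "\<dots> = K s (K t (\<lambda>y. w y * ennreal (Wt y))) x + K s (K t (\<lambda>y. u y * ennreal (Wt y))) x"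
    by (simp only: add.IH)
  also have "\<dots> = K s (\<lambda>z. K t (\<lambda>y. w y * ennreal (Wt y)) z + K t (\<lambda>y. u y * ennreal (Wt y)) z) x"
    using s t by (intro K_add[symmetric]) auto
  also have "\<dots> = K s (K t (\<lambda>y. (w y + u y) * ennreal (Wt y))) x"
    using s t unfolding distrib_right by (intro K_cong K_add[symmetric]) auto
  finally show ?case .
next
  case (seq U)
  have inc: "incseq (\<lambda>i y. U i y * ennreal (Wt y))" and incK: "incseq (\<lambda>i. K t (\<lambda>y. U i y * ennreal (Wt y)))"
    using seq(3) t by (auto simp: incseq_def le_fun_def intro!: mult_right_mono K_mono)
  have U[measurable]: "U i \<in> borel_measurable borel" for i using seq by simp
  have e: "(SUP i. U i) y * ennreal (Wt y) = (SUP i. U i y * ennreal (Wt y))" for y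
    unfolding SUP_apply by (rule SUP_mult_right_ennreal)
  have "K (s + t) (\<lambda>y. (SUP i. U i) y * ennreal (Wt y)) x = (SUP i. K (s + t) (\<lambda>y. U i y * ennreal (Wt y)) x)"
    unfolding e using s t by (intro K_SUP inc) auto
  also have "\<dots> = (SUP i. K s (K t (\<lambda>y. U i y * ennreal (Wt y))) x)" by (simp only: seq.IH)
  also have "\<dots> = K s (\<lambda>z. SUP i. K t (\<lambda>y. U i y * ennreal (Wt y)) z) x"
    using s t by (intro K_SUP[symmetric] incK) auto
  also have "\<dots> = K s (K t (\<lambda>y. (SUP i. U i) y * ennreal (Wt y))) x"
    unfolding e using s t by (intro K_cong K_SUP[symmetric] inc) auto
  finally show ?case .
qed

text \<open>As \<open>W\<close> is positive on the positive half-line, every u has there the form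
  \<open>v * Wt\<close> required by \<open>K_semigroup_Wt\<close>.\<close>

lemma K_semigroup:
  assumes u[measurable]: "u \<in> borel_measurable borel" and s: "s \<ge> 0" and t: "t \<ge> 0" and x: "x > 0"
  shows "K (s + t) u x = K s (K t u) x"
proof -
  let ?v = "\<lambda>y. u y / ennreal (Wt y)"
  have e: "?v y * ennreal (Wt y) = u y" if "y > 0" for y
    using that by (rule divide_Wt_times)
  have "K (s + t) u x = K (s + t) (\<lambda>y. ?v y * ennreal (Wt y)) x"
    using s t by (intro K_cong e[symmetric]) auto
  also have "\<dots> = K s (K t (\<lambda>y. ?v y * ennreal (Wt y))) x"
    using s t x by (intro K_semigroup_Wt) auto
  also have "\<dots> = K s (K t u) x"
    using s t by (intro K_cong e) auto
  finally show ?thesis .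
qed

section \<open>Exponential moments of \<open>V\<close>\<close>

lemma V_exp_integral:
  assumes "t \<ge> 0" "s \<ge> 0"
  shows "(\<integral>\<^sup>+\<omega>. ennreal (exp (s * V t \<omega>)) \<partial>M) = ennreal (exp (t * \<Psi> s))"
proof -
  have e: "(\<integral>\<omega>. exp (s * V t \<omega>) \<partial>M) = exp (t * \<Psi> s)"
    using laplace_exponent assms by (auto simp: is_laplace_exponent_def)
  then have "integrable M (\<lambda>\<omega>. exp (s * V t \<omega>))"
    using not_integrable_integral_eq[of M "\<lambda>\<omega>. exp (s * V t \<omega>)"] by fastforce
  then show ?thesis using nn_integral_eq_integral[of M "\<lambda>\<omega>. exp (s * V t \<omega>)"] e by simp
qed

lemma P_exp:
  assumes "t \<ge> 0" "s \<ge> 0"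
  shows "P t (\<lambda>y. ennreal (exp (s * y))) x = ennreal (exp (s * x + t * \<Psi> s))"
proof -
  note [measurable] = measurable_V[OF assms(1)]
  have "P t (\<lambda>y. ennreal (exp (s * y))) x = (\<integral>\<^sup>+\<omega>. ennreal (exp (s * x)) * ennreal (exp (s * V t \<omega>)) \<partial>M)"
    unfolding P_def by (intro nn_integral_cong) (simp add: ennreal_mult[symmetric] exp_add algebra_simps)
  also have "\<dots> = ennreal (exp (s * x)) * ennreal (exp (t * \<Psi> s))"
    by (subst nn_integral_cmult) (use V_exp_integral[OF assms] in auto)
  finally show ?thesis by (simp add: ennreal_mult[symmetric] exp_add)
qed

end

section \<open>Short-time behaviour of the semigroup acting on the scale function\<close>

context scale_setting
begin

lemma Wt_laplace_nn:
  assumes s: "s > k0"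
  shows "(\<integral>\<^sup>+x. ennreal (exp (- s * x) * Wt x) \<partial>lborel) = ennreal (1 / \<Psi> s)" and "\<Psi> s > 0"
proof -
  have i: "integrable lborel (\<lambda>x. indicator {0..} x *\<^sub>R (exp (- s * x) * W x))"
    and e: "(\<integral>x. indicator {0..} x *\<^sub>R (exp (- s * x) * W x) \<partial>lborel) = 1 / \<Psi> s"
    using W_laplace[OF s] by (auto simp: set_integrable_def set_lebesgue_integral_def)
  have "(\<integral>\<^sup>+x. ennreal (exp (- s * x) * Wt x) \<partial>lborel) =
      (\<integral>\<^sup>+x. ennreal (indicator {0..} x *\<^sub>R (exp (- s * x) * W x)) \<partial>lborel)"
  proof (rule nn_integral_cong_AE)
    show "AE x in lborel. ennreal (exp (- s * x) * Wt x) =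
        ennreal (indicator {0..} x *\<^sub>R (exp (- s * x) * W x))"
      using AE_lborel_singleton[of "0::real"]
      by eventually_elim (auto simp: Wt_def split: split_indicator)
  qed
  also have "\<dots> = ennreal (1 / \<Psi> s)"
    unfolding e[symmetric] by (rule nn_integral_eq_integral[OF i]) (auto simp: W_nonneg split: split_indicator)
  finally show *: "(\<integral>\<^sup>+x. ennreal (exp (- s * x) * Wt x) \<partial>lborel) = ennreal (1 / \<Psi> s)" .
  \<comment> \<open>The sign of \<open>\<Psi> s\<close> is read off from its reciprocal:
    \<open>W\<close> is at least \<open>W 1\<close> on \<open>{1..2}\<close>, which bounds the
    Laplace transform below by a positive number.\<close>
  have "0 < ennreal (exp (- s * 2) * W 1)" using W_pos[of 1] by simp
  also have "\<dots> = (\<integral>\<^sup>+x. ennreal (exp (- s * 2) * W 1) * indicator {1..2::real} x \<partial>lborel)"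
    by (subst nn_integral_cmult_indicator) auto
  also have "\<dots> \<le> (\<integral>\<^sup>+x. ennreal (exp (- s * x) * Wt x) \<partial>lborel)"
    using Wt_mono[of 1] s k0_nonneg
    by (intro nn_integral_mono)
       (auto split: split_indicator intro!: ennreal_leI mult_mono mult_left_mono simp: W_nonneg)
  finally have "0 < 1 / \<Psi> s" unfolding * by simp
  then show "\<Psi> s > 0" by simp
qed

definition growth_const :: "real \<Rightarrow> real" where
  "growth_const s = exp s / \<Psi> s"

lemma growth_const_pos: "s > k0 \<Longrightarrow> growth_const s > 0"
  by (simp add: growth_const_def Wt_laplace_nn)

text \<open>As \<open>Wt\<close> increases, its value at x is controlled by its integral over
  \<open>{x..x+1}\<close>, hence by the Laplace transform at s. The unit length of this interval is
  the source of the factor \<open>exp s\<close> in \<open>growth_const\<close>.\<close>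

lemma Wt_growth:
  assumes s: "s > k0"
  shows "Wt x \<le> growth_const s * exp (s * x)"
proof -
  have "ennreal (exp (- s * (x + 1)) * Wt x) =
      (\<integral>\<^sup>+y. ennreal (exp (- s * (x + 1)) * Wt x) * indicator {x..x+1} y \<partial>lborel)"
    by (subst nn_integral_cmult_indicator) auto
  also have "\<dots> \<le> (\<integral>\<^sup>+y. ennreal (exp (- s * y) * Wt y) \<partial>lborel)"
    using Wt_mono[of x] s k0_nonneg
    by (intro nn_integral_mono)
       (auto split: split_indicator intro!: ennreal_leI mult_mono mult_left_mono)
  also have "\<dots> = ennreal (1 / \<Psi> s)" by (rule Wt_laplace_nn[OF s])
  finally have "exp (- s * (x + 1)) * Wt x \<le> 1 / \<Psi> s"
    using Wt_laplace_nn(2)[OF s] by (subst (asm) ennreal_le_iff) auto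
  then have "exp (s * (x + 1)) * (exp (- s * (x + 1)) * Wt x) \<le> exp (s * (x + 1)) * (1 / \<Psi> s)"
    by (intro mult_left_mono) auto
  moreover have "exp (s * (x + 1)) * (exp (- s * (x + 1)) * Wt x) = Wt x"
    by (simp add: mult.assoc[symmetric] exp_add[symmetric] del: mult_minus_left)
  ultimately have "Wt x \<le> exp (s * (x + 1)) * (1 / \<Psi> s)" by (simp only:)
  also have "\<dots> = growth_const s * exp (s * x)" by (simp add: growth_const_def distrib_left exp_add)
  finally show ?thesis .
qed

section \<open>The increment of \<open>W\<close> under the free semigroup\<close>

definition Wn :: "real \<Rightarrow> ennreal" where
  "Wn x = ennreal (Wt x)"

lemma Wn_measurable [measurable]: "Wn \<in> borel_measurable borel"
  unfolding Wn_def by measurable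

text \<open>\<open>q h\<close> is the density of the occupation measure, up to time \<open>h\<close>, of the dual process \<open>- V\<close>.
  The subtraction in \<open>ennreal\<close> is not truncated, by \<open>Wn_add_q\<close>.\<close>

definition q :: "real \<Rightarrow> real \<Rightarrow> ennreal" where
  "q h a = P h Wn a - Wn a"

lemma q_measurable [measurable]: "h \<ge> 0 \<Longrightarrow> q h \<in> borel_measurable borel"
  unfolding q_def by measurable

lemma Wn_add_q:
  assumes h: "h \<ge> 0"
  shows "Wn a + q h a = P h Wn a"
proof -
  have "Wn a \<le> P h Wn a"
  proof (cases "a > 0")
    case True
    have "Wn a = K h Wn a" using K_Wt[OF h True] True unfolding Wn_def by simp
    then show ?thesis using K_le_P[of h Wn a] by simp
  qed (simp add: Wn_def)
  then show ?thesis unfolding q_def by (rule add_diff_inverse_ennreal)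
qed

text \<open>By translation, shifting \<open>Wn\<close> by \<open>V h\<close> multiplies its Laplace
  transform by \<open>exp (s * V h)\<close>, whose mean is
  \<open>exp (h * \<Psi> s)\<close>.\<close>

lemma P_Wn_laplace:
  assumes s: "s > k0" and h: "h \<ge> 0"
  shows "(\<integral>\<^sup>+a. ennreal (exp (- s * a)) * P h Wn a \<partial>lborel) = ennreal (exp (h * \<Psi> s) / \<Psi> s)"
proof -
  interpret pair_sigma_finite lborel M by unfold_locales
  note [measurable] = measurable_V[OF h]
  have "(\<integral>\<^sup>+a. ennreal (exp (- s * a)) * P h Wn a \<partial>lborel) =
      (\<integral>\<^sup>+a. (\<integral>\<^sup>+\<omega>. ennreal (exp (- s * a)) * Wn (a + V h \<omega>) \<partial>M) \<partial>lborel)"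
    unfolding P_def by (intro nn_integral_cong nn_integral_cmult[symmetric]) measurable
  also have "\<dots> = (\<integral>\<^sup>+\<omega>. (\<integral>\<^sup>+a. ennreal (exp (- s * a)) * Wn (a + V h \<omega>) \<partial>lborel) \<partial>M)"
    by (rule Fubini'[symmetric]) measurable
  also have "\<dots> = (\<integral>\<^sup>+\<omega>. ennreal (exp (s * V h \<omega>)) * ennreal (1 / \<Psi> s) \<partial>M)"
  proof (rule nn_integral_cong)
    fix \<omega>
    have "(\<integral>\<^sup>+a. ennreal (exp (- s * a)) * Wn (a + V h \<omega>) \<partial>lborel) =
        (\<integral>\<^sup>+a. ennreal (exp (- s * (- V h \<omega> + 1 * a))) * Wn ((- V h \<omega> + 1 * a) + V h \<omega>) \<partial>lborel)"
      by (subst nn_integral_real_affine[where c=1 and t="- V h \<omega>"]) auto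
    also have "\<dots> = (\<integral>\<^sup>+a. ennreal (exp (s * V h \<omega>)) * ennreal (exp (- s * a) * Wt a) \<partial>lborel)"
    proof (rule nn_integral_cong)
      fix a
      have "exp (- s * (- V h \<omega> + 1 * a)) = exp (s * V h \<omega>) * exp (- s * a)"
        by (simp add: exp_add[symmetric] algebra_simps)
      moreover have "- V h \<omega> + 1 * a + V h \<omega> = a" by simp
      ultimately show "ennreal (exp (- s * (- V h \<omega> + 1 * a))) * Wn ((- V h \<omega> + 1 * a) + V h \<omega>) =
        ennreal (exp (s * V h \<omega>)) * ennreal (exp (- s * a) * Wt a)"
        by (simp only: Wn_def) (simp add: ennreal_mult mult.assoc)
    qed
    also have "\<dots> = ennreal (exp (s * V h \<omega>)) * ennreal (1 / \<Psi> s)"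
      unfolding Wt_laplace_nn(1)[OF s, symmetric] by (rule nn_integral_cmult) measurable
    finally show "(\<integral>\<^sup>+a. ennreal (exp (- s * a)) * Wn (a + V h \<omega>) \<partial>lborel) =
        ennreal (exp (s * V h \<omega>)) * ennreal (1 / \<Psi> s)" .
  qed
  also have "\<dots> = (\<integral>\<^sup>+\<omega>. ennreal (exp (s * V h \<omega>)) \<partial>M) * ennreal (1 / \<Psi> s)"
    by (rule nn_integral_multc) measurable
  also have "\<dots> = ennreal (exp (h * \<Psi> s) / \<Psi> s)"
    using s k0_nonneg h Wt_laplace_nn(2)[OF s]
    by (subst V_exp_integral) (auto simp: ennreal_mult[symmetric])
  finally show ?thesis .
qed

lemma q_laplace:
  assumes s: "s > k0" and h: "h \<ge> 0"
  shows "(\<integral>\<^sup>+a. ennreal (exp (- s * a)) * q h a \<partial>lborel) = ennreal ((exp (h * \<Psi> s) - 1) / \<Psi> s)"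
    (is "?I = _")
proof -
  have pos: "\<Psi> s > 0" by (rule Wt_laplace_nn(2)[OF s])
  have "ennreal (1 / \<Psi> s) + ?I = (\<integral>\<^sup>+a. ennreal (exp (- s * a)) * Wn a \<partial>lborel) + ?I"
    using Wt_laplace_nn(1)[OF s] by (simp add: Wn_def ennreal_mult)
  also have "\<dots> = (\<integral>\<^sup>+a. ennreal (exp (- s * a)) * P h Wn a \<partial>lborel)"
    unfolding Wn_add_q[OF h, symmetric] distrib_left
    using h by (intro nn_integral_add[symmetric]) auto
  also have "\<dots> = ennreal (exp (h * \<Psi> s) / \<Psi> s)" by (rule P_Wn_laplace[OF s h])
  also have "\<dots> = ennreal (1 / \<Psi> s) + ennreal ((exp (h * \<Psi> s) - 1) / \<Psi> s)"
    using pos h by (subst ennreal_plus[symmetric]) (auto simp: add_divide_distrib[symmetric])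
  finally show ?thesis by (simp add: ennreal_add_left_cancel)
qed

text \<open>By \<open>q_laplace\<close>, the total mass of the measure with density
  \<open>exp (- s * a) * q h a\<close>. To first order it equals h, whatever s is; this is why the
  limit has to be a Dirac mass at 0.\<close>

definition mass :: "real \<Rightarrow> real \<Rightarrow> real" where
  "mass s h = (exp (h * \<Psi> s) - 1) / \<Psi> s"

lemma mass_nonneg: "s > k0 \<Longrightarrow> h \<ge> 0 \<Longrightarrow> mass s h \<ge> 0"
  using Wt_laplace_nn(2)[of s] by (simp add: mass_def)

lemma mass_tendsto:
  assumes s: "s > k0"
  shows "((\<lambda>h. mass s h / h) \<longlongrightarrow> 1) (at_right 0)"
proof -
  have pos: "\<Psi> s > 0" by (rule Wt_laplace_nn(2)[OF s])
  have "((\<lambda>h. mass s h) has_real_derivative 1) (at 0)"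
    unfolding mass_def using pos by (auto intro!: derivative_eq_intros)
  then have "((\<lambda>h. mass s h / h) \<longlongrightarrow> 1) (at 0)"
    by (simp add: has_field_derivative_iff mass_def)
  then show ?thesis by (rule filterlim_mono[OF _ order_refl at_le]) simp
qed

text \<open>A Chebyshev argument: \<open>(exp (- a) - 1)\<^sup>2\<close> is bounded below for \<open>\<bar>a\<bar> \<ge> d\<close>, and its integral
  against \<open>exp (- s * a) * q h a / h\<close> tends to \<open>1 - 2 + 1\<close>.\<close>

lemma q_tail:
  assumes s: "s > k0" and d: "d > 0" and e: "e > 0"
  shows "\<forall>\<^sub>F h in at_right 0.
    (\<integral>\<^sup>+a. indicator {a. \<bar>a\<bar> \<ge> d} a * ennreal (exp (- s * a)) * q h a \<partial>lborel) \<le> ennreal (e * h)"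
proof -
  let ?c = "(1 - exp (- d))\<^sup>2"
  have c: "?c > 0" using d by simp
  let ?D = "\<lambda>h. (mass (s + 2) h / h - 2 * (mass (s + 1) h / h) + mass s h / h) / ?c"
  have "(?D \<longlongrightarrow> (1 - 2 * 1 + 1) / ?c) (at_right 0)"
    using s c by (intro tendsto_intros mass_tendsto) auto
  then have "\<forall>\<^sub>F h in at_right 0. ?D h < e" by (rule order_tendstoD) (use e in simp)
  moreover have "\<forall>\<^sub>F h in at_right 0. (0::real) < h" by (simp add: eventually_at_right_less)
  ultimately show ?thesis
  proof eventually_elim
    case (elim h)
    then have h: "h > 0" by simp
    let ?T = "\<integral>\<^sup>+a. indicator {a. \<bar>a\<bar> \<ge> d} a * ennreal (exp (- s * a)) * q h a \<partial>lborel"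
    let ?I = "\<lambda>r. \<integral>\<^sup>+a. ennreal (exp (- r * a)) * q h a \<partial>lborel"
    have I: "?I r = ennreal (mass r h)" if "r > k0" for r
      using q_laplace[OF that] h by (simp add: mass_def)
    \<comment> \<open>The expanded square contributes a negative middle term; it is kept on the left
      with a positive sign because subtraction in \<open>ennreal\<close> is truncated.\<close>
    have pt: "ennreal ?c * (indicator {a. \<bar>a\<bar> \<ge> d} a * ennreal (exp (- s * a)) * q h a)
        + 2 * (ennreal (exp (- (s + 1) * a)) * q h a)
        \<le> ennreal (exp (- (s + 2) * a)) * q h a + ennreal (exp (- s * a)) * q h a" for a
    proof -
      have "?c * indicator {a. \<bar>a\<bar> \<ge> d} a \<le> (exp (- a) - 1)\<^sup>2"
      proof (cases "\<bar>a\<bar> \<ge> d")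
        case True
        have "1 - exp (- d) \<le> \<bar>exp (- a) - 1\<bar>"
        proof (cases "a \<ge> 0")
          case True
          then have "exp (- a) \<le> exp (- d)" using \<open>\<bar>a\<bar> \<ge> d\<close> by simp
          then show ?thesis by linarith
        next
          case False
          then have "exp d \<le> exp (- a)" using \<open>\<bar>a\<bar> \<ge> d\<close> by simp
          moreover have "exp d + exp (- d) \<ge> 2"
            using exp_ge_add_one_self[of d] exp_ge_add_one_self[of "- d"] by linarith
          ultimately show ?thesis by linarith
        qed
        then have "?c \<le> \<bar>exp (- a) - 1\<bar>\<^sup>2" using d by (intro power_mono) auto
        then show ?thesis using True by simp
      qed simp
      then have "?c * indicator {a. \<bar>a\<bar> \<ge> d} a * exp (- s * a) \<le> (exp (- a) - 1)\<^sup>2 * exp (- s * a)"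
        by (intro mult_right_mono) auto
      also have "\<dots> = exp (- (s + 2) * a) - 2 * exp (- (s + 1) * a) + exp (- s * a)"
      proof -
        have "exp (- (s + 2) * a) = exp (- a) * exp (- a) * exp (- s * a)"
          "exp (- (s + 1) * a) = exp (- a) * exp (- s * a)"
          by (simp_all add: exp_add[symmetric] algebra_simps)
        then show ?thesis by (simp only: power2_eq_square) (simp add: algebra_simps)
      qed
      finally have "?c * indicator {a. \<bar>a\<bar> \<ge> d} a * exp (- s * a) + 2 * exp (- (s + 1) * a)
          \<le> exp (- (s + 2) * a) + exp (- s * a)" by simp
      then have "ennreal (?c * indicator {a. \<bar>a\<bar> \<ge> d} a * exp (- s * a) + 2 * exp (- (s + 1) * a))
          \<le> ennreal (exp (- (s + 2) * a) + exp (- s * a))" by (rule ennreal_leI)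
      then have "ennreal ?c * indicator {a. \<bar>a\<bar> \<ge> d} a * ennreal (exp (- s * a)) + 2 * ennreal (exp (- (s + 1) * a))
          \<le> ennreal (exp (- (s + 2) * a)) + ennreal (exp (- s * a))"
        by (simp add: ennreal_plus ennreal_mult ennreal_indicator)
      from mult_right_mono[OF this, of "q h a"] show ?thesis
        by (simp add: distrib_right mult.assoc)
    qed
    have "ennreal ?c * ?T + 2 * ?I (s + 1) =
      (\<integral>\<^sup>+a. ennreal ?c * (indicator {a. \<bar>a\<bar> \<ge> d} a * ennreal (exp (- s * a)) * q h a)
        + 2 * (ennreal (exp (- (s + 1) * a)) * q h a) \<partial>lborel)"
      using h by (subst nn_integral_add) (auto simp: nn_integral_cmult)
    also have "\<dots> \<le> (\<integral>\<^sup>+a. ennreal (exp (- (s + 2) * a)) * q h a + ennreal (exp (- s * a)) * q h a \<partial>lborel)"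
      by (intro nn_integral_mono pt)
    also have "\<dots> = ?I (s + 2) + ?I s"
      using h by (intro nn_integral_add) auto
    finally have le: "ennreal ?c * ?T + 2 * ennreal (mass (s + 1) h) \<le> ennreal (mass (s + 2) h + mass s h)"
      using s h I[of s] I[of "s + 1"] I[of "s + 2"] by (simp only:) (simp add: mass_nonneg)
    then have "ennreal ?c * ?T \<le> ennreal (mass (s + 2) h + mass s h)"
      by (rule order_trans[rotated]) simp
    then have "ennreal ?c * ?T < \<infinity>" by (rule le_less_trans) simp
    then have "?T < \<infinity>" using c by (auto simp: ennreal_mult_less_top)
    then obtain T where T: "T \<ge> 0" "?T = ennreal T" by (cases ?T) auto
    have "ennreal (?c * T + 2 * mass (s + 1) h) \<le> ennreal (mass (s + 2) h + mass s h)"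
      using le T s h by (simp add: ennreal_plus ennreal_mult mass_nonneg)
    then have "?c * T + 2 * mass (s + 1) h \<le> mass (s + 2) h + mass s h"
      using s h by (subst (asm) ennreal_le_iff) (auto simp: mass_nonneg)
    then have "T \<le> (mass (s + 2) h - 2 * mass (s + 1) h + mass s h) / ?c"
      unfolding pos_le_divide_eq[OF c] by (simp add: mult.commute)
    also have "\<dots> = ?D h * h" using h by (simp add: add_divide_distrib diff_divide_distrib distrib_right left_diff_distrib)
    finally have "T \<le> ?D h * h" .
    also have "\<dots> \<le> e * h" using elim by (intro mult_right_mono) auto
    finally show ?case unfolding T(2) by (rule ennreal_leI)
  qed
qed

text \<open>Absence of positive jumps enters only through \<open>W\<close>, which vanishes on the negative half-line: at
  points \<open>a \<le> - d\<close> the function \<open>q h\<close> equals \<open>P h Wn\<close>, which would be large if \<open>V h\<close> exceeded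
  \<open>3 * d\<close> with probability of order \<open>h\<close>.\<close>

lemma exp_jump_small:
  assumes s: "s > k0" and n: "n > 0" and e: "e > 0"
  shows "\<forall>\<^sub>F h in at_right 0.
    (\<integral>\<^sup>+\<omega>. ennreal (exp (s * V h \<omega>)) * indicator {n<..} (V h \<omega>) \<partial>M) \<le> ennreal (e * h)"
proof -
  define d where "d = n / 3"
  have d: "d > 0" "n = 3 * d" using n by (auto simp: d_def)
  \<comment> \<open>For v > 3 * d the window \<open>{- v + d..- v + 2 * d}\<close> has length d and
    lies to the left of - d. On it \<open>Wt (a + v)\<close> is at least \<open>W d\<close> and
    \<open>exp (- s * a)\<close> at least \<open>exp (s * (v - 2 * d))\<close>. This explains both
    \<open>c\<close> and n = 3 * d.\<close>
  define c where "c = exp (- 2 * s * d) * W d * d"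
  have c: "c > 0" using d W_pos[of d] by (simp add: c_def)
  have "\<forall>\<^sub>F h in at_right 0.
    (\<integral>\<^sup>+a. indicator {a. \<bar>a\<bar> \<ge> d} a * ennreal (exp (- s * a)) * q h a \<partial>lborel) \<le> ennreal (e * c * h)"
    using e c by (intro q_tail s d) simp
  moreover have "\<forall>\<^sub>F h in at_right 0. (0::real) < h" by (simp add: eventually_at_right_less)
  ultimately show ?thesis
  proof eventually_elim
    case (elim h)
    then have h: "h \<ge> 0" by simp
    interpret pair_sigma_finite lborel M by unfold_locales
    note [measurable] = measurable_V[OF h]
    let ?J = "\<integral>\<^sup>+\<omega>. ennreal (exp (s * V h \<omega>)) * indicator {n<..} (V h \<omega>) \<partial>M"
    have "ennreal c * ?J = (\<integral>\<^sup>+\<omega>. ennreal c * (ennreal (exp (s * V h \<omega>)) * indicator {n<..} (V h \<omega>)) \<partial>M)"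
      by (rule nn_integral_cmult[symmetric]) measurable
    also have "\<dots> \<le> (\<integral>\<^sup>+\<omega>. (\<integral>\<^sup>+a. indicator {..-d} a * ennreal (exp (- s * a)) * Wn (a + V h \<omega>) \<partial>lborel) \<partial>M)"
    proof (rule nn_integral_mono)
      fix \<omega>
      let ?v = "V h \<omega>"
      show "ennreal c * (ennreal (exp (s * ?v)) * indicator {n<..} ?v)
        \<le> (\<integral>\<^sup>+a. indicator {..-d} a * ennreal (exp (- s * a)) * Wn (a + ?v) \<partial>lborel)"
      proof (cases "?v > n")
        case True
        have "ennreal c * (ennreal (exp (s * ?v)) * indicator {n<..} ?v) =
          ennreal (exp (s * (?v - 2 * d)) * W d) * ennreal d"
          using True d W_pos[of d] unfolding c_def
          by (simp add: ennreal_mult[symmetric] exp_diff exp_minus field_simps)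
        also have "\<dots> = (\<integral>\<^sup>+a. ennreal (exp (s * (?v - 2 * d)) * W d) * indicator {- ?v + d..- ?v + 2 * d} a \<partial>lborel)"
          using d by (subst nn_integral_cmult_indicator) auto
        also have "\<dots> \<le> (\<integral>\<^sup>+a. indicator {..-d} a * ennreal (exp (- s * a)) * Wn (a + ?v) \<partial>lborel)"
        proof (rule nn_integral_mono)
          fix a
          show "ennreal (exp (s * (?v - 2 * d)) * W d) * indicator {- ?v + d..- ?v + 2 * d} a
            \<le> indicator {..-d} a * ennreal (exp (- s * a)) * Wn (a + ?v)"
          proof (cases "a \<in> {- ?v + d..- ?v + 2 * d}")
            case a: True
            then have "a \<le> - d" using True d by auto
            have "s * (?v - 2 * d) \<le> s * (- a)" using a s k0_nonneg by (intro mult_left_mono) auto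
            then have "exp (s * (?v - 2 * d)) \<le> exp (- s * a)" by simp
            moreover have "W d \<le> Wt (a + ?v)" using Wt_mono[of d "a + ?v"] a d by simp
            ultimately have "exp (s * (?v - 2 * d)) * W d \<le> exp (- s * a) * Wt (a + ?v)"
              using W_nonneg[of d] d by (intro mult_mono) auto
            then show ?thesis using a \<open>a \<le> - d\<close> by (simp add: Wn_def ennreal_mult[symmetric] ennreal_leI)
          qed simp
        qed
        finally show ?thesis .
      qed simp
    qed
    also have "\<dots> = (\<integral>\<^sup>+a. (\<integral>\<^sup>+\<omega>. indicator {..-d} a * ennreal (exp (- s * a)) * Wn (a + V h \<omega>) \<partial>M) \<partial>lborel)"
      by (rule Fubini') measurable
    also have "\<dots> = (\<integral>\<^sup>+a. indicator {..-d} a * ennreal (exp (- s * a)) * P h Wn a \<partial>lborel)"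
      unfolding P_def by (intro nn_integral_cong nn_integral_cmult) measurable
    also have "\<dots> \<le> (\<integral>\<^sup>+a. indicator {a. \<bar>a\<bar> \<ge> d} a * ennreal (exp (- s * a)) * q h a \<partial>lborel)"
    proof (rule nn_integral_mono)
      fix a
      have "P h Wn a = q h a" if "a \<le> -d"
        using Wn_add_q[OF h, of a] that d by (simp add: Wn_def)
      then show "indicator {..-d} a * ennreal (exp (- s * a)) * P h Wn a
        \<le> indicator {a. \<bar>a\<bar> \<ge> d} a * ennreal (exp (- s * a)) * q h a"
        using d by (auto split: split_indicator)
    qed
    also have "\<dots> \<le> ennreal c * ennreal (e * h)"
      using elim e c by (simp add: ennreal_mult[symmetric] ac_simps)
    finally show ?case using c by (subst (asm) ennreal_mult_le_mult_iff) auto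
  qed
qed

section \<open>Convolutions with \<open>W\<close> and with \<open>q h\<close>\<close>

definition Q :: "real \<Rightarrow> (real \<Rightarrow> real) \<Rightarrow> real \<Rightarrow> ennreal" where
  "Q h g x = (\<integral>\<^sup>+a. q h a * ennreal (g (x - a)) \<partial>lborel)"

definition Wconv :: "(real \<Rightarrow> real) \<Rightarrow> real \<Rightarrow> ennreal" where
  "Wconv g x = (\<integral>\<^sup>+a. Wn a * ennreal (g (x - a)) \<partial>lborel)"

lemma Wconv_measurable [measurable]:
  assumes [measurable]: "g \<in> borel_measurable borel"
  shows "Wconv g \<in> borel_measurable borel"
  unfolding Wconv_def by measurable

lemma Q_measurable [measurable]:
  assumes [measurable]: "g \<in> borel_measurable borel" and h: "h \<ge> 0"
  shows "Q h g \<in> borel_measurable borel"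
proof -
  note [measurable] = q_measurable[OF h]
  show ?thesis unfolding Q_def by measurable
qed

text \<open>A change of variables moves the translation by \<open>V h\<close> from g to
  \<open>Wn\<close>, where \<open>P h Wn\<close> splits as \<open>Wn\<close> plus
  \<open>q h\<close>. Thus \<open>Q h g\<close> is the exact increment of \<open>Wconv g\<close>, to
  be compared with h * g.\<close>

lemma P_Wconv:
  assumes [measurable]: "g \<in> borel_measurable borel" and h: "h \<ge> 0"
  shows "P h (Wconv g) x = Wconv g x + Q h g x"
proof -
  interpret pair_sigma_finite lborel M by unfold_locales
  note [measurable] = measurable_V[OF h] q_measurable[OF h]
  have "P h (Wconv g) x = (\<integral>\<^sup>+\<omega>. (\<integral>\<^sup>+a. Wn (a + V h \<omega>) * ennreal (g (x - a)) \<partial>lborel) \<partial>M)"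
    unfolding P_def Wconv_def
  proof (rule nn_integral_cong)
    fix \<omega>
    show "(\<integral>\<^sup>+a. Wn a * ennreal (g (x + V h \<omega> - a)) \<partial>lborel) =
      (\<integral>\<^sup>+a. Wn (a + V h \<omega>) * ennreal (g (x - a)) \<partial>lborel)"
      by (subst nn_integral_real_affine[where c=1 and t="V h \<omega>"]) (auto simp: algebra_simps)
  qed
  also have "\<dots> = (\<integral>\<^sup>+a. (\<integral>\<^sup>+\<omega>. Wn (a + V h \<omega>) * ennreal (g (x - a)) \<partial>M) \<partial>lborel)"
    by (rule Fubini') measurable
  also have "\<dots> = (\<integral>\<^sup>+a. P h Wn a * ennreal (g (x - a)) \<partial>lborel)"
    unfolding P_def by (intro nn_integral_cong nn_integral_multc) measurable
  also have "\<dots> = Wconv g x + Q h g x"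
    unfolding Wn_add_q[OF h, symmetric] distrib_right Wconv_def Q_def
    by (intro nn_integral_add) measurable
  finally show ?thesis .
qed

text \<open>The measure with density \<open>exp (- s * a) * q h a\<close> has mass close to h, and
  only o(h) of it lies away from 0, so on a bounded uniformly continuous G it acts like h times the
  Dirac mass at 0. The weight \<open>exp (s * x)\<close> is split off because the Laplace transform
  controls \<open>q h\<close> only under an exponential factor. Uniformity in x is essential: the
  estimate is applied at every position of the path.\<close>

lemma Q_approx:
  fixes G :: "real \<Rightarrow> real"
  assumes s: "s > k0" and e: "e > 0"
    and unif: "uniformly_continuous_on UNIV G" and B: "\<And>x. 0 \<le> G x" "\<And>x. G x \<le> B"
  shows "\<forall>\<^sub>F h in at_right 0. \<forall>x.
    Q h (\<lambda>y. exp (s * y) * G y) x \<le> ennreal (h * (exp (s * x) * G x)) + ennreal (e * h * exp (s * x)) \<and>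
    ennreal (h * (exp (s * x) * G x)) \<le> Q h (\<lambda>y. exp (s * y) * G y) x + ennreal (e * h * exp (s * x))"
proof -
  have B0: "B \<ge> 0" using B[of 0] by linarith
  have G[measurable]: "G \<in> borel_measurable borel"
    using uniformly_continuous_imp_continuous[OF unif] by (rule borel_measurable_continuous_onI)
  \<comment> \<open>Budget for the error e * h: one half for \<open>e / 4 * ?m\<close>, since
    \<open>e1 \<le> 1\<close> gives \<open>?m \<le> 2 * h\<close>, and one quarter each for
    \<open>B * (e1 * h)\<close> and \<open>G x * (e1 * h)\<close>.\<close>
  define e1 where "e1 = min 1 (e / (4 * (B + 1)))"
  have e1: "e1 > 0" "e1 \<le> 1" "e1 * B \<le> e / 4"
  proof -
    show "e1 > 0" "e1 \<le> 1" using e B0 by (auto simp: e1_def)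
    have "e1 * B \<le> e / (4 * (B + 1)) * (B + 1)"
      using B0 e by (intro mult_mono) (auto simp: e1_def)
    also have "\<dots> = e / 4" using B0 by (simp add: field_simps)
    finally show "e1 * B \<le> e / 4" .
  qed
  obtain d where d: "d > 0" "\<And>u v. \<bar>u - v\<bar> < d \<Longrightarrow> \<bar>G u - G v\<bar> < e / 4"
    using unif e unfolding uniformly_continuous_on_def dist_real_def
    by (metis UNIV_I divide_pos_pos zero_less_numeral)
  have "\<forall>\<^sub>F h in at_right 0. dist (mass s h / h) 1 < e1"
    using mass_tendsto[OF s] e1(1) by (rule tendstoD)
  moreover have "\<forall>\<^sub>F h in at_right 0.
    (\<integral>\<^sup>+a. indicator {a. \<bar>a\<bar> \<ge> d} a * ennreal (exp (- s * a)) * q h a \<partial>lborel) \<le> ennreal (e1 * h)"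
    by (intro q_tail s d e1)
  moreover have "\<forall>\<^sub>F h in at_right 0. (0::real) < h" by (simp add: eventually_at_right_less)
  ultimately show ?thesis
  proof eventually_elim
    case (elim h)
    then have h: "h > 0" by simp
    note [measurable] = q_measurable[OF less_imp_le[OF h]]
    let ?m = "mass s h"
    have m: "?m \<le> h + e1 * h" "h \<le> ?m + e1 * h" "?m \<ge> 0"
    proof -
      have "\<bar>?m / h - 1\<bar> < e1" using elim by (simp add: dist_real_def)
      then have "\<bar>?m / h - 1\<bar> * h < e1 * h" using h by (intro mult_strict_right_mono) auto
      moreover have "\<bar>?m / h - 1\<bar> * h = \<bar>?m - h\<bar>"
      proof -
        have "\<bar>?m / h - 1\<bar> * h = \<bar>(?m / h - 1) * h\<bar>" using h by (simp only: abs_mult abs_of_pos)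
        also have "(?m / h - 1) * h = ?m - h" using h by (simp add: left_diff_distrib)
        finally show ?thesis .
      qed
      ultimately show "?m \<le> h + e1 * h" "h \<le> ?m + e1 * h" by linarith+
      show "?m \<ge> 0" using s h by (simp add: mass_nonneg)
    qed
    have mI: "(\<integral>\<^sup>+a. ennreal (exp (- s * a)) * q h a \<partial>lborel) = ennreal ?m"
      using q_laplace[OF s] h by (simp add: mass_def)
    let ?T = "\<integral>\<^sup>+a. indicator {a. \<bar>a\<bar> \<ge> d} a * ennreal (exp (- s * a)) * q h a \<partial>lborel"
    have T: "?T \<le> ennreal (e1 * h)" using elim by simp
    show ?case
    proof
      fix x
      let ?S = "\<integral>\<^sup>+a. (ennreal (exp (- s * a)) * q h a) * ennreal (G (x - a)) \<partial>lborel"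
      have QS: "Q h (\<lambda>y. exp (s * y) * G y) x = ennreal (exp (s * x)) * ?S"
      proof -
        have "q h a * ennreal (exp (s * (x - a)) * G (x - a)) =
          ennreal (exp (s * x)) * ((ennreal (exp (- s * a)) * q h a) * ennreal (G (x - a)))" for a
        proof -
          have "exp (s * (x - a)) = exp (s * x) * exp (- s * a)"
            by (simp add: exp_add[symmetric] algebra_simps)
          then show ?thesis using B by (simp add: ennreal_mult ac_simps)
        qed
        then show ?thesis unfolding Q_def by (simp add: nn_integral_cmult)
      qed
      have G1: "\<bar>G (x - a) - G x\<bar> \<le> e / 4 + B * indicator {a. \<bar>a\<bar> \<ge> d} a" for a
      proof (cases "\<bar>a\<bar> \<ge> d")
        case True
        have "\<bar>G (x - a) - G x\<bar> \<le> B" using B[of x] B[of "x - a"] by linarith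
        then show ?thesis using True e by simp
      next
        case False
        then have "\<bar>G (x - a) - G x\<bar> < e / 4" by (intro d) simp
        then show ?thesis using False by simp
      qed
      have up: "?S \<le> ennreal ((G x + e / 4) * ?m + B * (e1 * h))"
      proof -
        have "?S \<le> (\<integral>\<^sup>+a. ennreal (G x + e / 4) * (ennreal (exp (- s * a)) * q h a)
            + ennreal B * (indicator {a. \<bar>a\<bar> \<ge> d} a * ennreal (exp (- s * a)) * q h a) \<partial>lborel)"
        proof (rule nn_integral_mono)
          fix a
          have "G (x - a) \<le> G x + e / 4 + B * indicator {a. \<bar>a\<bar> \<ge> d} a"
            using G1[of a] by linarith
          then have "ennreal (G (x - a)) \<le> ennreal (G x + e / 4 + B * indicator {a. \<bar>a\<bar> \<ge> d} a)"
            by (rule ennreal_leI)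
          also have "\<dots> = ennreal (G x + e / 4) + ennreal B * indicator {a. \<bar>a\<bar> \<ge> d} a"
            using B[of x] e B0 by (subst ennreal_plus) (auto simp: ennreal_mult ennreal_indicator)
          finally have "(ennreal (exp (- s * a)) * q h a) * ennreal (G (x - a)) \<le>
            (ennreal (exp (- s * a)) * q h a) * (ennreal (G x + e / 4) + ennreal B * indicator {a. \<bar>a\<bar> \<ge> d} a)"
            by (intro mult_left_mono) auto
          then show "(ennreal (exp (- s * a)) * q h a) * ennreal (G (x - a)) \<le>
            ennreal (G x + e / 4) * (ennreal (exp (- s * a)) * q h a)
            + ennreal B * (indicator {a. \<bar>a\<bar> \<ge> d} a * ennreal (exp (- s * a)) * q h a)"
            by (simp add: distrib_left ac_simps)
        qed
        also have "\<dots> = ennreal (G x + e / 4) * ennreal ?m + ennreal B * ?T"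
          by (subst nn_integral_add) (simp_all add: nn_integral_cmult mI mI[unfolded mult_minus_left])
        also have "\<dots> \<le> ennreal (G x + e / 4) * ennreal ?m + ennreal B * ennreal (e1 * h)"
          by (intro add_left_mono mult_left_mono T) simp
        also have "\<dots> = ennreal ((G x + e / 4) * ?m + B * (e1 * h))"
          using B[of x] e B0 m(3) e1 h by (subst ennreal_plus) (auto simp: ennreal_mult)
        finally show ?thesis .
      qed
      have lo: "ennreal (G x * ?m) \<le> ?S + ennreal (e / 4 * ?m + B * (e1 * h))"
      proof -
        have "ennreal (G x * ?m) = (\<integral>\<^sup>+a. (ennreal (exp (- s * a)) * q h a) * ennreal (G x) \<partial>lborel)"
          using B m(3) by (subst nn_integral_multc, measurable, subst mI, simp add: ennreal_mult mult.commute)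
        also have "\<dots> \<le> (\<integral>\<^sup>+a. (ennreal (exp (- s * a)) * q h a) * ennreal (G (x - a))
            + (ennreal (e / 4) * (ennreal (exp (- s * a)) * q h a)
            + ennreal B * (indicator {a. \<bar>a\<bar> \<ge> d} a * ennreal (exp (- s * a)) * q h a)) \<partial>lborel)"
        proof (rule nn_integral_mono)
          fix a
          have "G x \<le> G (x - a) + (e / 4 + B * indicator {a. \<bar>a\<bar> \<ge> d} a)"
            using G1[of a] by linarith
          then have "ennreal (G x) \<le> ennreal (G (x - a) + (e / 4 + B * indicator {a. \<bar>a\<bar> \<ge> d} a))"
            by (rule ennreal_leI)
          also have "\<dots> = ennreal (G (x - a)) + (ennreal (e / 4) + ennreal B * indicator {a. \<bar>a\<bar> \<ge> d} a)"
            using B[of "x - a"] e B0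
            by (subst ennreal_plus, simp, simp, subst ennreal_plus) (auto simp: ennreal_mult ennreal_indicator)
          finally have "(ennreal (exp (- s * a)) * q h a) * ennreal (G x) \<le>
            (ennreal (exp (- s * a)) * q h a) *
            (ennreal (G (x - a)) + (ennreal (e / 4) + ennreal B * indicator {a. \<bar>a\<bar> \<ge> d} a))"
            by (intro mult_left_mono) auto
          then show "(ennreal (exp (- s * a)) * q h a) * ennreal (G x) \<le>
            (ennreal (exp (- s * a)) * q h a) * ennreal (G (x - a))
            + (ennreal (e / 4) * (ennreal (exp (- s * a)) * q h a)
            + ennreal B * (indicator {a. \<bar>a\<bar> \<ge> d} a * ennreal (exp (- s * a)) * q h a))"
            by (simp add: distrib_left ac_simps)
        qed
        also have "\<dots> = ?S + (ennreal (e / 4) * ennreal ?m + ennreal B * ?T)"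
          by (subst nn_integral_add, simp, simp, subst nn_integral_add) (simp_all add: nn_integral_cmult mI mI[unfolded mult_minus_left])
        also have "\<dots> \<le> ?S + (ennreal (e / 4) * ennreal ?m + ennreal B * ennreal (e1 * h))"
          by (intro add_left_mono mult_left_mono T) simp
        also have "\<dots> = ?S + ennreal (e / 4 * ?m + B * (e1 * h))"
          using e B0 m(3) e1 h by (simp add: ennreal_mult[symmetric] ennreal_plus[symmetric] del: ennreal_plus)
        finally show ?thesis .
      qed
      have Be: "B * (e1 * h) \<le> e / 4 * h" using e1(3) h by (simp add: mult.commute mult.left_commute)
      have e2: "e1 * h \<le> h" using e1 h by simp
      have em: "e / 4 * ?m \<le> e / 4 * (2 * h)" using m(1) e2 e by (intro mult_left_mono) auto
      have Ge: "G x * (e1 * h) \<le> e / 4 * h"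
        by (rule order_trans[OF mult_right_mono[OF B(2)] Be]) (use e1 h in simp)
      have "(G x + e / 4) * ?m + B * (e1 * h) \<le> h * G x + e * h"
      proof -
        have "G x * ?m \<le> G x * (h + e1 * h)" using B m by (intro mult_left_mono) auto
        then show ?thesis using Be em Ge by (simp add: algebra_simps)
      qed
      then have up': "?S \<le> ennreal (h * G x) + ennreal (e * h)"
        using order_trans[OF up ennreal_leI] B[of x] h e by (simp add: ennreal_plus[symmetric] del: ennreal_plus)
      have lo': "ennreal (h * G x) \<le> ?S + ennreal (e * h)"
      proof -
        have "h * G x \<le> G x * ?m + G x * (e1 * h)"
          using mult_left_mono[OF m(2) B(1)[of x]] by (simp add: algebra_simps)
        then have "ennreal (h * G x) \<le> ennreal (G x * ?m + e / 4 * h)"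
          using Ge by (intro ennreal_leI) linarith
        also have "\<dots> = ennreal (G x * ?m) + ennreal (e / 4 * h)"
          using B[of x] m e h by (intro ennreal_plus) auto
        also have "\<dots> \<le> ?S + ennreal (e / 4 * ?m + B * (e1 * h)) + ennreal (e / 4 * h)"
          by (intro add_right_mono lo)
        also have "\<dots> = ?S + ennreal (e / 4 * ?m + B * (e1 * h) + e / 4 * h)"
          using e m B0 e1 h by (subst ennreal_plus[of _ "e / 4 * h"]) (auto simp: add.assoc)
        also have "\<dots> \<le> ?S + ennreal (e * h)"
          using em Be by (intro add_left_mono ennreal_leI) linarith
        finally show ?thesis .
      qed
      have "Q h (\<lambda>y. exp (s * y) * G y) x \<le> ennreal (exp (s * x)) * (ennreal (h * G x) + ennreal (e * h))"
        unfolding QS by (intro mult_left_mono up') simp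
      also have "\<dots> = ennreal (h * (exp (s * x) * G x)) + ennreal (e * h * exp (s * x))"
        using B[of x] h e by (simp add: distrib_left ennreal_mult[symmetric] ac_simps)
      finally have A: "Q h (\<lambda>y. exp (s * y) * G y) x \<le> \<dots>" .
      have "ennreal (h * (exp (s * x) * G x)) = ennreal (exp (s * x)) * ennreal (h * G x)"
        using B[of x] h by (simp add: ennreal_mult[symmetric] ac_simps)
      also have "\<dots> \<le> ennreal (exp (s * x)) * (?S + ennreal (e * h))"
        by (intro mult_left_mono lo') simp
      also have "\<dots> = Q h (\<lambda>y. exp (s * y) * G y) x + ennreal (e * h * exp (s * x))"
        unfolding QS using h e by (simp add: distrib_left ennreal_mult[symmetric] ac_simps)
      finally show "Q h (\<lambda>y. exp (s * y) * G y) x \<le> ennreal (h * (exp (s * x) * G x)) + ennreal (e * h * exp (s * x)) \<and>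
        ennreal (h * (exp (s * x) * G x)) \<le> Q h (\<lambda>y. exp (s * y) * G y) x + ennreal (e * h * exp (s * x))"
        using A by blast
    qed
  qed
qed

end

section \<open>Logarithmic concavity of the scale function\<close>

lemma filterlim_div_Suc_at_right:
  assumes "T > (0::real)"
  shows "filterlim (\<lambda>k. T / real (Suc k)) (at_right 0) sequentially"
proof (rule tendsto_imp_filterlim_at_right)
  have "(\<lambda>k. T * inverse (real (Suc k))) \<longlonglongrightarrow> T * 0"
    by (intro tendsto_intros LIMSEQ_inverse_real_of_nat)
  then show "(\<lambda>k. T / real (Suc k)) \<longlonglongrightarrow> 0" by (simp add: divide_inverse)
qed (use assms in auto)

context scale_setting
begin

lemma K_0: "x > 0 \<Longrightarrow> K 0 u x = u x"
proof -
  assume x: "x > 0"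
  have "K 0 u x = (\<integral>\<^sup>+\<omega>. u x \<partial>M)"
    unfolding K_def m_def running_inf_def
    by (intro nn_integral_cong) (use x V_start in auto)
  then show ?thesis by (simp add: emeasure_space_1)
qed

lemma K_exp_le:
  assumes "t \<ge> 0" "t \<le> T" "s > k0"
  shows "K t (\<lambda>y. ennreal (exp (s * y))) x \<le> ennreal (exp (s * x + T * \<Psi> s))"
proof -
  have "K t (\<lambda>y. ennreal (exp (s * y))) x \<le> ennreal (exp (s * x + t * \<Psi> s))"
    using K_le_P P_exp[of t s x] assms k0_nonneg by (metis less_imp_le order_trans)
  also have "\<dots> \<le> ennreal (exp (s * x + T * \<Psi> s))"
    using assms Wt_laplace_nn(2)[of s] by (intro ennreal_leI) (simp add: mult_right_mono)
  finally show ?thesis .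
qed

text \<open>Starting d lower kills more paths, so the invariance of \<open>W\<close> at z - d
  becomes an inequality for the translate of \<open>Wn\<close> at z.\<close>

lemma W_subharmonic_shift:
  assumes h: "h \<ge> 0" and d: "d \<ge> 0"
  shows "Wn (z - d) \<le> K h (\<lambda>y. Wn (y - d)) z"
proof (cases "z - d > 0")
  case True
  have "Wn (z - d) = K h Wn (z - d)" using K_Wt[OF h True] True unfolding Wn_def by simp
  also have "\<dots> \<le> K h (\<lambda>y. Wn (y - d)) z"
    unfolding K_def using d by (intro nn_integral_mono) (auto split: split_indicator simp: algebra_simps)
  finally show ?thesis .
qed (simp add: Wn_def)

text \<open>From z < b, landing beyond b + n requires an increment above n. The growth bound for
  \<open>Wt\<close> separates the starting point from the increment and leaves the integral of
  \<open>exp_jump_small\<close>.\<close>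

lemma K_Wn_overshoot:
  assumes s: "s > k0" and h: "h \<ge> 0" and n: "n > 0" and z: "z < b"
  shows "K h (\<lambda>y. indicator {b + n<..} y * Wn y) z \<le> ennreal (growth_const s * exp (s * z)) *
    (\<integral>\<^sup>+\<omega>. ennreal (exp (s * V h \<omega>)) * indicator {n<..} (V h \<omega>) \<partial>M)"
proof -
  note [measurable] = measurable_V[OF h]
  have "K h (\<lambda>y. indicator {b + n<..} y * Wn y) z \<le> P h (\<lambda>y. indicator {b + n<..} y * Wn y) z"
    by (rule K_le_P)
  also have "\<dots> \<le> (\<integral>\<^sup>+\<omega>. ennreal (growth_const s * exp (s * z)) *
      (ennreal (exp (s * V h \<omega>)) * indicator {n<..} (V h \<omega>)) \<partial>M)"
    unfolding P_def
  proof (rule nn_integral_mono)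
    fix \<omega>
    have "Wn (z + V h \<omega>) \<le> ennreal (growth_const s * exp (s * z)) * ennreal (exp (s * V h \<omega>))"
      using Wt_growth[OF s, of "z + V h \<omega>"] growth_const_pos[OF s]
      by (simp add: Wn_def ennreal_mult[symmetric] mult.assoc exp_add[symmetric] distrib_left ennreal_leI)
    then show "indicator {b + n<..} (z + V h \<omega>) * Wn (z + V h \<omega>) \<le> ennreal (growth_const s * exp (s * z)) *
      (ennreal (exp (s * V h \<omega>)) * indicator {n<..} (V h \<omega>))"
      using z by (auto split: split_indicator)
  qed
  also have "\<dots> = ennreal (growth_const s * exp (s * z)) *
    (\<integral>\<^sup>+\<omega>. ennreal (exp (s * V h \<omega>)) * indicator {n<..} (V h \<omega>) \<partial>M)"
    by (rule nn_integral_cmult) measurable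
  finally show ?thesis .
qed

text \<open>The one-step errors are propagated by the killed semigroup and bounded by exponential
  moments. Their sum depends on c and the total time, not on the number of steps, so a one-step
  error o(h) disappears in the limit.\<close>

lemma K_iterate_le:
  assumes w[measurable]: "w \<in> borel_measurable borel" and s: "s > k0" and h: "h \<ge> 0" and c: "c \<ge> 0"
    and step: "\<And>z. z > 0 \<Longrightarrow> w z \<le> K h w z + ennreal (c * h) * ennreal (exp (s * z))"
    and z: "z > 0"
  shows "w z \<le> K (real n * h) w z + ennreal (c * (real n * h) * exp (s * z + real n * h * \<Psi> s))"
proof -
  let ?E = "\<lambda>z. ennreal (exp (s * z))"
  have "w z \<le> K (real j * h) w z + ennreal (c * (real j * h) * exp (s * z + real n * h * \<Psi> s))" if "j \<le> n" for j
    using that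
  proof (induction j)
    case 0 then show ?case using z by (simp add: K_0)
  next
    case (Suc j)
    have jh: "real j * h \<ge> 0" "real j * h \<le> real n * h" using h Suc by (auto intro: mult_right_mono)
    have "K (real j * h) w z \<le> K (real j * h) (\<lambda>y. K h w y + ennreal (c * h) * ?E y) z"
      using step jh by (intro K_mono) auto
    also have "\<dots> = K (real j * h) (K h w) z + ennreal (c * h) * K (real j * h) ?E z"
      using h jh by (subst K_add) (auto simp: K_cmult)
    also have "K (real j * h) (K h w) z = K (real (Suc j) * h) w z"
      using K_semigroup[OF w jh(1) h z] by (simp add: distrib_right add.commute)
    also have "ennreal (c * h) * K (real j * h) ?E z \<le> ennreal (c * h) * ennreal (exp (s * z + real n * h * \<Psi> s))"
      by (intro mult_left_mono K_exp_le jh s) simp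
    finally have "K (real j * h) w z \<le> K (real (Suc j) * h) w z + ennreal (c * h) * ennreal (exp (s * z + real n * h * \<Psi> s))"
      by (simp add: add_left_mono)
    then have "w z \<le> K (real (Suc j) * h) w z + (ennreal (c * h) * ennreal (exp (s * z + real n * h * \<Psi> s)) +
        ennreal (c * (real j * h) * exp (s * z + real n * h * \<Psi> s)))"
      using Suc by (simp add: add.assoc[symmetric]) (meson add_right_mono order_trans)
    also have "ennreal (c * h) * ennreal (exp (s * z + real n * h * \<Psi> s)) +
        ennreal (c * (real j * h) * exp (s * z + real n * h * \<Psi> s)) =
        ennreal (c * (real (Suc j) * h) * exp (s * z + real n * h * \<Psi> s))"
      using c h by (simp add: ennreal_mult[symmetric] ennreal_plus[symmetric] algebra_simps del: ennreal_plus)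
    finally show ?case .
  qed
  then show ?thesis by blast
qed

text \<open>If \<open>V T\<close> stayed below b almost surely, its exponential moment would be at
  most \<open>exp (s * b)\<close>; T is chosen so that \<open>T * \<Psi> s = s * b + 1\<close>,
  which is larger.\<close>

lemma escape:
  assumes b: "b > 0"
  obtains T where "T > 0" "emeasure M {\<omega> \<in> space M. V T \<omega> < b} < 1"
proof -
  define s where "s = k0 + 1"
  have s: "s > k0" "s > 0" using k0_nonneg by (auto simp: s_def)
  have pos: "\<Psi> s > 0" by (rule Wt_laplace_nn(2)[OF s(1)])
  define T where "T = (s * b + 1) / \<Psi> s"
  have T: "T > 0" using s b pos by (simp add: T_def add_pos_pos)
  note [measurable] = measurable_V[OF less_imp_le[OF T]]
  have "emeasure M {\<omega> \<in> space M. V T \<omega> < b} \<noteq> 1"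
  proof
    assume "emeasure M {\<omega> \<in> space M. V T \<omega> < b} = 1"
    then have "AE \<omega> in M. V T \<omega> < b"
      by (intro AE_I_eq_1) auto
    then have "AE \<omega> in M. ennreal (exp (s * V T \<omega>)) \<le> ennreal (exp (s * b))"
      by eventually_elim (use s in simp)
    then have "(\<integral>\<^sup>+\<omega>. ennreal (exp (s * V T \<omega>)) \<partial>M) \<le> (\<integral>\<^sup>+\<omega>. ennreal (exp (s * b)) \<partial>M)"
      by (rule nn_integral_mono_AE)
    then have "exp (T * \<Psi> s) \<le> exp (s * b)"
      using V_exp_integral[of T s] T s by (simp add: emeasure_space_1)
    then show False using pos by (simp add: T_def)
  qed
  moreover have "emeasure M {\<omega> \<in> space M. V T \<omega> < b} \<le> 1" by (rule emeasure_le_1)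
  ultimately show ?thesis using T that by (meson le_neq_trans)
qed

text \<open>Stated for positive points because \<open>Wt\<close> may jump at 0: \<open>W 0\<close>
  can be positive.\<close>

lemma W_continuous_pos: "x > 0 \<Longrightarrow> isCont Wt x"
proof -
  assume x: "x > 0"
  have "isCont W x"
    using W_continuous x by (intro continuous_on_interior[of "{0..}"]) auto
  moreover have "\<forall>\<^sub>F y in nhds x. Wt y = W y"
    using eventually_gt_at_top by (intro eventually_nhds_in_open[of "{0<..}", THEN eventually_mono]) (use x in auto)
  ultimately show ?thesis using isCont_cong by blast
qed

text \<open>A maximum principle. The positive part \<open>w\<close> of \<open>Wt (\<cdot> - d) - r * Wt\<close> on \<open>]0,b[\<close> satisfies
  \<open>w \<le> K h w\<close> up to the contribution of paths that jump over \<open>[b,b+n]\<close>, which is \<open>o(h)\<close>;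
  hence \<open>w \<le> K t w\<close> for all \<open>t\<close>, while \<open>V\<close> leaves \<open>]0,b[\<close> before time \<open>t\<close> with probability
  bounded away from \<open>0\<close>.\<close>

lemma Wt_ratio_mono_aux:
  assumes d: "d > 0" "d < b" and e: "e > 0" and x: "0 < x" "x < b"
  shows "Wt (x - d) \<le> (Wt (b - d) / W b + e) * W x"
proof -
  define r where "r = Wt (b - d) / W b + e"
  define s where "s = k0 + 1"
  have s: "s > k0" "s > 0" using k0_nonneg by (auto simp: s_def)
  have b: "b > 0" using d by simp
  have r: "r > 0" using e b W_pos[of b] by (simp add: r_def add_nonneg_pos)
  \<comment> \<open>The slack e keeps the ratio below r up to some b + n with n > 0, so only upward
    moves longer than n escape the comparison.\<close>
  have "isCont (\<lambda>z. Wt (z - d) / Wt z) b"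
  proof (rule continuous_divide)
    show "isCont (\<lambda>z. Wt (z - d)) b"
      using d by (intro isCont_o2[OF _ W_continuous_pos] continuous_intros) simp
  qed (use b Wt_pos[of b] W_continuous_pos in auto)
  then have "\<forall>\<^sub>F z in at b. Wt (z - d) / Wt z < r"
    unfolding isCont_def by (rule order_tendstoD) (use e b in \<open>simp add: r_def\<close>)
  then obtain c where c: "c > 0" "\<And>z. z \<noteq> b \<Longrightarrow> \<bar>z - b\<bar> < c \<Longrightarrow> Wt (z - d) / Wt z < r"
    unfolding eventually_at dist_real_def by auto
  define n where "n = c / 2"
  have n: "n > 0" using c by (simp add: n_def)
  have near: "Wt (z - d) \<le> r * Wt z" if "b \<le> z" "z \<le> b + n" for z
  proof -
    have "Wt (z - d) / Wt z \<le> r"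
      using c(2)[of z] that c(1) e b by (cases "z = b") (auto simp: n_def r_def)
    then show ?thesis using that b Wt_pos[of z] by (simp add: pos_divide_le_eq)
  qed
  define w where "w z = indicator {0<..<b} z * ennreal (Wt (z - d) - r * Wt z)" for z
  have w[measurable]: "w \<in> borel_measurable borel" unfolding w_def by measurable
  have w_bd: "w z \<le> ennreal (W b) * indicator {0<..<b} z" for z
  proof (cases "z \<in> {0<..<b}")
    case True
    then have "r * W z \<ge> 0" using r W_nonneg[of z] by simp
    then have "Wt (z - d) - r * Wt z \<le> W b"
      using Wt_mono[of "z - d" b] d True by auto
    then show ?thesis using True by (simp add: w_def ennreal_leI)
  qed (simp add: w_def)
  have key: "w z \<le> K h w z + K h (\<lambda>y. indicator {b + n<..} y * Wn y) z" if h: "h \<ge> 0" and z: "0 < z" "z < b" for h z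
  proof -
    have "Wn (z - d) \<le> K h (\<lambda>y. Wn (y - d)) z" using h d by (intro W_subharmonic_shift) auto
    also have "\<dots> \<le> K h (\<lambda>y. ennreal r * Wn y + (w y + indicator {b + n<..} y * Wn y)) z"
    proof (rule K_mono[OF _ h])
      fix y :: real assume y: "y > 0"
      have Wy: "ennreal r * Wn y = ennreal (r * Wt y)" using r by (simp add: Wn_def ennreal_mult)
      consider "y < b" | "b \<le> y" "y \<le> b + n" | "y > b + n" by linarith
      then show "Wn (y - d) \<le> ennreal r * Wn y + (w y + indicator {b + n<..} y * Wn y)"
      proof cases
        case 1
        have "ennreal (Wt (y - d)) \<le> ennreal (r * Wt y) + ennreal (Wt (y - d) - r * Wt y)"
        proof (cases "Wt (y - d) \<ge> r * Wt y")
          case True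
          then show ?thesis using r by (subst ennreal_plus[symmetric]) auto
        next
          case False
          then have "ennreal (Wt (y - d)) \<le> ennreal (r * Wt y)" by (intro ennreal_leI) simp
          then show ?thesis by (simp add: add_increasing2)
        qed
        then show ?thesis unfolding Wy using 1 y n by (simp add: w_def Wn_def)
      next
        case 2
        then have "Wn (y - d) \<le> ennreal r * Wn y"
          unfolding Wy unfolding Wn_def by (intro ennreal_leI near)
        then show ?thesis by (rule order_trans) simp
      next
        case 3
        have "Wn (y - d) \<le> Wn y" using d unfolding Wn_def by (intro ennreal_leI Wt_mono) simp
        then show ?thesis using 3 by (simp add: add_increasing)
      qed
    qed
    also have "\<dots> = ennreal r * K h Wn z + (K h w z + K h (\<lambda>y. indicator {b + n<..} y * Wn y) z)"
      using h by (subst K_add, simp, simp, simp, subst K_add) (simp_all add: K_cmult)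
    also have "ennreal r * K h Wn z = ennreal (r * Wt z)"
      using K_Wt[OF h z(1)] r z W_nonneg[of z] unfolding Wn_def by (simp add: ennreal_mult)
    finally have "ennreal (Wt (z - d)) - ennreal (r * Wt z) \<le>
      K h w z + K h (\<lambda>y. indicator {b + n<..} y * Wn y) z"
      unfolding Wn_def[of "z - d"] by (subst ennreal_minus_le_iff) auto
    then show ?thesis using z r W_nonneg[of z] by (simp add: w_def ennreal_minus)
  qed
  have wK: "w z \<le> K T w z" if T: "T > 0" and z: "z > 0" for T z
  proof (rule ennreal_le_epsilon)
    fix e' :: real assume e': "e' > 0"
    let ?D = "T * exp (s * z + T * \<Psi> s)"
    have D: "?D > 0" using T by simp
    \<comment> \<open>With this value the errors of all T / h steps add up to exactly
      \<open>e'\<close>.\<close>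
    define c where "c = e' / ?D"
    have c: "c > 0" using e' D by (simp add: c_def)
    let ?g = "growth_const s"
    have g: "?g > 0" by (rule growth_const_pos[OF s(1)])
    have ev: "\<forall>\<^sub>F h in at_right 0. (\<integral>\<^sup>+\<omega>. ennreal (exp (s * V h \<omega>)) * indicator {n<..} (V h \<omega>) \<partial>M) \<le> ennreal (c / ?g * h)"
      using c g by (intro exp_jump_small s n) simp
    have "filterlim (\<lambda>k. T / real (Suc k)) (at_right 0) sequentially"
      using T by (intro filterlim_div_Suc_at_right)
    from eventually_compose_filterlim[OF ev this] obtain k where
      k: "(\<integral>\<^sup>+\<omega>. ennreal (exp (s * V (T / real (Suc k)) \<omega>)) * indicator {n<..} (V (T / real (Suc k)) \<omega>) \<partial>M) \<le> ennreal (c / ?g * (T / real (Suc k)))"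
      by (auto simp: eventually_sequentially)
    define h where "h = T / real (Suc k)"
    have h: "h \<ge> 0" "real (Suc k) * h = T" using T by (auto simp: h_def)
    have "w y \<le> K h w y + ennreal (c * h) * ennreal (exp (s * y))" if y: "y > 0" for y
    proof (cases "y < b")
      case True
      have "K h (\<lambda>y. indicator {b + n<..} y * Wn y) y \<le> ennreal (?g * exp (s * y)) * ennreal (c / ?g * h)"
        using K_Wn_overshoot[OF s(1) h(1) n True] k unfolding h_def[symmetric]
        by (meson mult_left_mono order_trans zero_le)
      also have "\<dots> = ennreal (c * h) * ennreal (exp (s * y))"
        using g c h by (simp add: ennreal_mult[symmetric])
      finally show ?thesis using key[OF h(1) y True] by (meson add_left_mono order_trans)
    qed (simp add: w_def)
    then have "w z \<le> K (real (Suc k) * h) w z + ennreal (c * (real (Suc k) * h) * exp (s * z + real (Suc k) * h * \<Psi> s))"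
      using c h by (intro K_iterate_le w s z) auto
    also have "c * (real (Suc k) * h) * exp (s * z + real (Suc k) * h * \<Psi> s) = e'"
      unfolding h(2) using T by (simp add: c_def)
    finally show "w z \<le> K T w z + ennreal e'" unfolding h(2) .
  qed
  define S where "S = (SUP z. w z)"
  have S_fin: "S \<le> ennreal (W b)"
    unfolding S_def
  proof (rule SUP_least)
    fix z show "w z \<le> ennreal (W b)" using w_bd[of z] by (cases "z \<in> {0<..<b}") auto
  qed
  obtain T where T: "T > 0" "emeasure M {\<omega> \<in> space M. V T \<omega> < b} < 1" using escape[OF b] .
  note [measurable] = measurable_V[OF less_imp_le[OF T(1)]]
  let ?r = "emeasure M {\<omega> \<in> space M. V T \<omega> < b}"
  have "w z \<le> S * ?r" for z
  proof (cases "z > 0")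
    case True
    have "w z \<le> K T w z" by (rule wK[OF T(1) True])
    also have "\<dots> \<le> (\<integral>\<^sup>+\<omega>. S * indicator {\<omega> \<in> space M. V T \<omega> < b} \<omega> \<partial>M)"
      unfolding K_def
    proof (rule nn_integral_mono)
      fix \<omega> assume "\<omega> \<in> space M"
      show "w (z + V T \<omega>) * indicator {0<..} (z + m T \<omega>) \<le> S * indicator {\<omega> \<in> space M. V T \<omega> < b} \<omega>"
      proof (cases "V T \<omega> < b")
        case True
        then show ?thesis using \<open>\<omega> \<in> space M\<close> unfolding S_def
          by (auto split: split_indicator intro: SUP_upper)
      next
        case False
        then have "w (z + V T \<omega>) = 0" using True by (simp add: w_def)
        then show ?thesis by simp
      qed
    qed
    also have "\<dots> = S * ?r" by (subst nn_integral_cmult_indicator) auto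
    finally show ?thesis .
  qed (simp add: w_def)
  then have "S \<le> S * ?r" unfolding S_def by (intro SUP_least)
  \<comment> \<open>The contraction \<open>S \<le> S * ?r\<close> with \<open>?r < 1\<close> forces
    \<open>S = 0\<close> only because S is finite.\<close>
  have "S = 0"
  proof (rule ccontr)
    assume "S \<noteq> 0"
    moreover have "S \<noteq> \<top>" using S_fin by (metis ennreal_neq_top neq_top_trans)
    ultimately have "S * ?r < S * 1" using T(2) by (intro ennreal_mult_strict_left_mono) (auto simp: zero_less_iff_neq_zero top.not_eq_extremum)
    then show False using \<open>S \<le> S * ?r\<close> by simp
  qed
  moreover have "w x \<le> S" unfolding S_def by (rule SUP_upper) simp
  ultimately have "w x = 0" by simp
  then show ?thesis using x by (simp add: w_def r_def ennreal_eq_0_iff)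
qed

text \<open>The limit e to 0 of \<open>Wt_ratio_mono_aux\<close>. The cross-multiplied form also
  covers b \<le> d, where both sides vanish.\<close>

lemma Wt_ratio_mono:
  assumes d: "d \<ge> 0" and x: "0 < x" "x \<le> b"
  shows "Wt (x - d) * W b \<le> Wt (b - d) * W x"
proof -
  consider "x = b" | "d = 0" | "b \<le> d" | "x < b" "d > 0" "d < b" using x d by linarith
  then show ?thesis
  proof cases
    case 4
    have Wb: "W b > 0" using x by (intro W_pos) simp
    have "Wt (x - d) \<le> Wt (b - d) / W b * W x"
    proof (rule field_le_epsilon)
      fix e :: real assume "e > 0"
      then have "Wt (x - d) \<le> (Wt (b - d) / W b + e / W x) * W x"
        using 4 x W_pos[of x] by (intro Wt_ratio_mono_aux) auto
      then show "Wt (x - d) \<le> Wt (b - d) / W b * W x + e"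
        using W_pos[of x] x by (simp add: distrib_right)
    qed
    then show ?thesis using Wb by (simp add: field_simps)
  qed (use x in auto)
qed

end

section \<open>Decay of the scale function and the functions \<open>F k\<close>\<close>

text \<open>Cauchy's functional equation: nonnegativity makes L increasing, and squeezing
  \<open>Suc n * y\<close> between consecutive integers leaves an error of at most
  \<open>L 1 / Suc n\<close>.\<close>

lemma additive_nonneg_imp_linear:
  fixes L :: "real \<Rightarrow> real"
  assumes add: "\<And>x y. x \<ge> 0 \<Longrightarrow> y \<ge> 0 \<Longrightarrow> L (x + y) = L x + L y"
    and nonneg: "\<And>x. x \<ge> 0 \<Longrightarrow> L x \<ge> 0" and y: "y \<ge> 0"
  shows "L y = L 1 * y"
proof -
  have mono: "L x \<le> L z" if "0 \<le> x" "x \<le> z" for x z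
    using add[of x "z - x"] nonneg[of "z - x"] that by simp
  have mult: "L (real n * x) = real n * L x" if "x \<ge> 0" for n x
  proof (induction n)
    case 0 then show ?case using add[of 0 0] by simp
  next
    case (Suc n)
    have "L (real (Suc n) * x) = L (real n * x + x)" by (simp add: distrib_right add.commute)
    also have "\<dots> = real n * L x + L x" using add[of "real n * x" x] that Suc by simp
    finally show ?case by (simp add: distrib_right add.commute)
  qed
  have bd: "\<bar>L y - L 1 * y\<bar> \<le> L 1 * inverse (real (Suc n))" for n
  proof -
    let ?N = "real (Suc n)"
    define j where "j = nat \<lfloor>?N * y\<rfloor>"
    have "0 \<le> ?N * y" using y by simp
    then have "real j = of_int \<lfloor>?N * y\<rfloor>" by (simp add: j_def)
    then have j: "real j \<le> ?N * y" "?N * y \<le> real j + 1" by linarith+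
    have N: "L (?N * y) = ?N * L y" by (rule mult[OF y])
    have 1: "real j * L 1 \<le> ?N * L y"
      using mono[OF _ j(1)] mult[of 1 j] N by simp
    have 2: "?N * L y \<le> (real j + 1) * L 1"
      using mono[OF _ j(2)] mult[of 1 "Suc j"] N \<open>0 \<le> ?N * y\<close> by (simp add: add.commute)
    have 3: "real j * L 1 \<le> ?N * y * L 1" "?N * y * L 1 \<le> (real j + 1) * L 1"
      using j nonneg[of 1] by (auto intro!: mult_right_mono)
    have e: "?N * (L y - L 1 * y) = ?N * L y - ?N * y * L 1"
      by (simp only: right_diff_distrib mult.assoc mult.commute[of "L 1" y])
    have "\<bar>?N * (L y - L 1 * y)\<bar> \<le> L 1"
      unfolding e using 1 2 3 unfolding distrib_right by (intro abs_leI; linarith)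
    then have "?N * \<bar>L y - L 1 * y\<bar> \<le> L 1" unfolding abs_mult by simp
    then show ?thesis by (simp add: pos_le_divide_eq divide_inverse[symmetric] mult.commute del: of_nat_Suc)
  qed
  have "(\<lambda>n. L 1 * inverse (real (Suc n))) \<longlonglongrightarrow> L 1 * 0"
    by (intro tendsto_intros LIMSEQ_inverse_real_of_nat)
  then have "\<bar>L y - L 1 * y\<bar> \<le> L 1 * 0"
    by (rule LIMSEQ_le_const) (use bd in auto)
  then show ?thesis by simp
qed

lemma nn_integral_exp_Ici:
  assumes "a > 0"
  shows "(\<integral>\<^sup>+x. ennreal (exp (- a * x)) * indicator {0..} x \<partial>lborel) = ennreal (1 / a)"
proof -
  have "(\<integral>\<^sup>+x. ennreal (exp (- a * x)) * indicator {0..} x \<partial>lborel) = ennreal (0 - (- exp (- a * 0) / a))"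
  proof (rule nn_integral_FTC_atLeast)
    show "((\<lambda>x. - exp (- a * x) / a) \<longlongrightarrow> 0) at_top"
    proof -
      have "filterlim (\<lambda>x. a * x) at_top at_top"
        using assms by (intro filterlim_tendsto_pos_mult_at_top[OF tendsto_const] filterlim_ident) auto
      then have "((\<lambda>x. exp (- (a * x))) \<longlongrightarrow> 0) at_top"
        by (intro filterlim_compose[OF exp_at_bot]) (simp add: filterlim_uminus_at_bot)
      then have "((\<lambda>x. - exp (- (a * x)) / a) \<longlongrightarrow> - 0 / a) at_top"
        using assms by (intro tendsto_intros) auto
      then show ?thesis by simp
    qed
  qed (use assms in \<open>auto intro!: derivative_eq_intros\<close>)
  then show ?thesis by simp
qed

context scale_setting
begin

section \<open>The limits of the ratios of \<open>W\<close> at infinity\<close>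

definition R :: "real \<Rightarrow> real \<Rightarrow> real" where
  "R y x = Wt (x - y) / Wt x"

lemma R_measurable [measurable (raw)]:
  assumes [measurable]: "f \<in> borel_measurable A" "g \<in> borel_measurable A"
  shows "(\<lambda>z. R (f z) (g z)) \<in> borel_measurable A"
  unfolding R_def by measurable

lemma R_nonneg [simp]: "R y x \<ge> 0"
  by (simp add: R_def)

lemma R_le_1: "y \<ge> 0 \<Longrightarrow> R y x \<le> 1"
  using Wt_mono[of "x - y" x] Wt_nonneg[of x] unfolding R_def
  by (intro divide_le_eq_1[THEN iffD2]) (auto simp: less_le)

lemma R_mono: "y \<ge> 0 \<Longrightarrow> x \<le> z \<Longrightarrow> R y x \<le> R y z"
proof (cases "x > 0")
  case True
  assume "y \<ge> 0" "x \<le> z"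
  then show ?thesis
    using Wt_ratio_mono[of y x z] True W_pos[of x] W_pos[of z] unfolding R_def
    by (simp add: divide_le_eq le_divide_eq)
next
  case False
  then have "R y x = 0" by (simp add: R_def)
  then show ?thesis by simp
qed

definition ell :: "real \<Rightarrow> real" where
  "ell y = (SUP x. R y x)"

lemma R_bdd: "y \<ge> 0 \<Longrightarrow> bdd_above (range (R y))"
  using R_le_1 by (intro bdd_aboveI[where M=1]) auto

lemma R_le_ell: "y \<ge> 0 \<Longrightarrow> R y x \<le> ell y"
  unfolding ell_def by (intro cSUP_upper R_bdd) auto

lemma R_tendsto_ell: "y \<ge> 0 \<Longrightarrow> (R y \<longlongrightarrow> ell y) at_top"
proof (rule order_tendstoI)
  fix a assume y: "y \<ge> 0" and "a < ell y"
  then obtain x where x: "a < R y x" unfolding ell_def using less_cSUP_iff[OF _ R_bdd[OF y]] by auto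
  show "\<forall>\<^sub>F z in at_top. a < R y z"
    using eventually_ge_at_top[of x]
    by eventually_elim (use x R_mono[OF y, of x] in force)
next
  fix a assume y: "y \<ge> 0" and "ell y < a"
  then show "\<forall>\<^sub>F z in at_top. R y z < a"
    using R_le_ell[OF y] by (intro always_eventually) (meson le_less_trans)
qed

lemma ell_pos: "y \<ge> 0 \<Longrightarrow> ell y > 0"
  using R_le_ell[of y "y + 1"] W_pos[of 1] W_pos[of "y + 1"] unfolding R_def
  by (auto intro: less_le_trans[rotated])

lemma ell_le_1: "y \<ge> 0 \<Longrightarrow> ell y \<le> 1"
  unfolding ell_def by (intro cSUP_least R_le_1) auto

text \<open>For x > y the ratio \<open>R (y + z) x\<close> factorises as
  \<open>R y x * R z (x - y)\<close>, and both factors converge.\<close>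

lemma ell_add:
  assumes "y \<ge> 0" "z \<ge> 0"
  shows "ell (y + z) = ell y * ell z"
proof (rule tendsto_unique)
  show "(R (y + z) \<longlongrightarrow> ell (y + z)) at_top" using assms by (intro R_tendsto_ell) auto
  have "filterlim (\<lambda>x. x - y) at_top at_top"
    using filterlim_tendsto_add_at_top[OF tendsto_const[of "- y"] filterlim_ident] by (simp add: add.commute)
  then have "((\<lambda>x. R y x * R z (x - y)) \<longlongrightarrow> ell y * ell z) at_top"
    using assms by (intro tendsto_mult R_tendsto_ell filterlim_compose[OF R_tendsto_ell, of z]) auto
  moreover have "\<forall>\<^sub>F x in at_top. R y x * R z (x - y) = R (y + z) x"
    using eventually_gt_at_top[of y]
  proof eventually_elim
    case (elim x)
    then have "Wt (x - y) > 0" by (intro Wt_pos) simp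
    then show ?case by (simp add: R_def diff_diff_eq)
  qed
  ultimately show "(R (y + z) \<longlongrightarrow> ell y * ell z) at_top" by (rule Lim_transform_eventually)
qed simp

text \<open>The exponential growth rate of \<open>W\<close> at infinity. Multiplicativity of
  \<open>ell\<close> forces an exponential, so the rate can be read off at 1, without locating a
  zero of \<open>\<Psi>\<close>.\<close>

definition theta :: real where
  "theta = - ln (ell 1)"

lemma theta_nonneg: "theta \<ge> 0"
  using ell_pos[of 1] ell_le_1[of 1] by (simp add: theta_def)

lemma ell_eq: "y \<ge> 0 \<Longrightarrow> ell y = exp (- theta * y)"
proof -
  assume y: "y \<ge> 0"
  have "- ln (ell y) = - ln (ell 1) * y"
  proof (rule additive_nonneg_imp_linear[of "\<lambda>y. - ln (ell y)", OF _ _ y])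
    fix x z :: real assume "x \<ge> 0" "z \<ge> 0"
    then show "- ln (ell (x + z)) = - ln (ell x) + - ln (ell z)"
      using ell_pos[of x] ell_pos[of z] by (simp add: ell_add ln_mult)
  next
    fix x :: real assume "x \<ge> 0"
    then show "0 \<le> - ln (ell x)" using ell_pos[of x] ell_le_1[of x] by simp
  qed
  then have "ln (ell y) = - theta * y" by (simp add: theta_def)
  then show ?thesis using ell_pos[OF y] by (metis exp_ln)
qed

lemma R_le_exp: "y \<ge> 0 \<Longrightarrow> R y x \<le> exp (- theta * y)"
  using R_le_ell[of y x] ell_eq[of y] by simp

lemma R_tendsto: "y \<ge> 0 \<Longrightarrow> (R y \<longlongrightarrow> exp (- theta * y)) at_top"
  using R_tendsto_ell[of y] ell_eq[of y] by simp

text \<open>Beyond some point, moving one unit to the left costs at most a factor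
  \<open>exp s\<close>; unit steps lead back to a bounded region. In contrast to
  \<open>Wt_growth\<close>, every exponent above \<open>theta\<close> is reached, even if it is
  below \<open>k0\<close>.\<close>

lemma Wt_growth_theta:
  assumes s: "s > theta"
  shows "\<exists>C\<ge>0. \<forall>x. Wt x \<le> C * exp (s * x)"
proof -
  have s0: "s > 0" using s theta_nonneg by simp
  have "\<forall>\<^sub>F x in at_top. R 1 x > exp (- s)"
    using R_tendsto[of 1] s by (intro order_tendstoD[where y="exp (- theta)"]) auto
  then obtain x0 where x0: "\<And>x. x \<ge> x0 \<Longrightarrow> R 1 x > exp (- s)" by (auto simp: eventually_at_top_linorder)
  define a where "a = max x0 1"
  have step: "Wt x \<le> exp s * Wt (x - 1)" if "x \<ge> a" for x
  proof -
    have "Wt x > 0" using that by (intro Wt_pos) (simp add: a_def)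
    moreover have "exp (- s) < Wt (x - 1) / Wt x" using x0[of x] that by (simp add: R_def a_def)
    ultimately have "exp (- s) * Wt x < Wt (x - 1)" by (simp only: pos_less_divide_eq)
    then have "exp s * (exp (- s) * Wt x) \<le> exp s * Wt (x - 1)" by (intro mult_left_mono) auto
    then show ?thesis by (simp add: mult.assoc[symmetric] exp_add[symmetric])
  qed
  have "Wt x \<le> Wt (a + 1) * exp (s * x)" if "x \<le> a + 1 + real n" for n x
    using that
  proof (induction n arbitrary: x)
    case 0
    show ?case
    proof (cases "x > 0")
      case True
      then have "1 \<le> exp (s * x)" using s0 by simp
      then have "Wt (a + 1) * 1 \<le> Wt (a + 1) * exp (s * x)" by (intro mult_left_mono) auto
      moreover have "Wt x \<le> Wt (a + 1)" using 0 by (intro Wt_mono) simp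
      ultimately show ?thesis by linarith
    qed simp
  next
    case (Suc n)
    show ?case
    proof (cases "x \<ge> a")
      case True
      have "Wt x \<le> exp s * Wt (x - 1)" by (rule step[OF True])
      also have "\<dots> \<le> exp s * (Wt (a + 1) * exp (s * (x - 1)))"
        using Suc.prems by (intro mult_left_mono Suc.IH) auto
      also have "\<dots> = Wt (a + 1) * exp (s * x)" by (simp add: right_diff_distrib exp_diff)
      finally show ?thesis .
    next
      case False
      then show ?thesis by (intro Suc.IH) simp
    qed
  qed
  moreover have "x \<le> a + 1 + real (nat \<lceil>x - a\<rceil>)" for x by linarith
  ultimately show ?thesis by (intro exI[of _ "Wt (a + 1)"]) auto
qed

section \<open>The Laplace transform of \<open>W\<close> above its growth rate\<close>

definition LapW :: "real \<Rightarrow> ennreal" where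
  "LapW s = (\<integral>\<^sup>+x. ennreal (exp (- s * x)) * Wn x \<partial>lborel)"

lemma LapW_finite:
  assumes s: "s > theta"
  shows "LapW s < \<top>"
proof -
  obtain s' where s': "theta < s'" "s' < s" using dense[OF s] by blast
  obtain C where C: "C \<ge> 0" "\<And>x. Wt x \<le> C * exp (s' * x)" using Wt_growth_theta[OF s'(1)] by blast
  have "LapW s \<le> (\<integral>\<^sup>+x. ennreal C * (ennreal (exp (- (s - s') * x)) * indicator {0..} x) \<partial>lborel)"
    unfolding LapW_def
  proof (rule nn_integral_mono)
    fix x
    show "ennreal (exp (- s * x)) * Wn x \<le> ennreal C * (ennreal (exp (- (s - s') * x)) * indicator {0..} x)"
    proof (cases "x > 0")
      case True
      have "exp (- s * x) * Wt x \<le> exp (- s * x) * (C * exp (s' * x))"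
        by (intro mult_left_mono C) simp
      also have "\<dots> = C * exp (- (s - s') * x)"
        by (simp add: exp_add[symmetric] algebra_simps)
      finally have "ennreal (exp (- s * x) * Wt x) \<le> ennreal (C * exp (- (s - s') * x))"
        by (rule ennreal_leI)
      then have "ennreal (exp (- s * x)) * Wn x \<le> ennreal C * ennreal (exp (- (s - s') * x))"
        unfolding Wn_def by (simp only: ennreal_mult exp_ge_zero Wt_nonneg C(1))
      then show ?thesis using True by simp
    qed (simp add: Wn_def)
  qed
  also have "\<dots> = ennreal C * ennreal (1 / (s - s'))"
    using s' by (subst nn_integral_cmult) (simp_all only: nn_integral_exp_Ici diff_gt_0_iff_gt, auto)
  also have "\<dots> < \<top>" by (simp add: ennreal_mult_less_top)
  finally show ?thesis .
qed

lemma LapW_eq: "s > k0 \<Longrightarrow> LapW s = ennreal (1 / \<Psi> s)"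
  using Wt_laplace_nn(1)[of s] unfolding LapW_def Wn_def by (simp add: ennreal_mult)

lemma LapW_pos: "LapW s \<noteq> 0"
proof
  assume "LapW s = 0"
  then have "AE x in lborel. ennreal (exp (- s * x)) * Wn x = 0"
    unfolding LapW_def by (subst (asm) nn_integral_0_iff_AE) auto
  then have "AE x in lborel. x \<notin> {0<..(1::real)}"
  proof eventually_elim
    case (elim x)
    then have "Wt x = 0" using Wt_nonneg[of x] by (simp add: Wn_def)
    then show ?case using Wt_pos[of x] by auto
  qed
  then have "emeasure lborel {0<..(1::real)} = 0"
    by (subst (asm) AE_iff_measurable[of "{0<..1}"]) auto
  then show False by simp
qed

definition lapW :: "real \<Rightarrow> real" where
  "lapW s = enn2real (LapW s)"

lemma LapW_lapW: "s > theta \<Longrightarrow> LapW s = ennreal (lapW s)"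
  using LapW_finite[of s] by (simp add: lapW_def)

lemma lapW_pos: "s > theta \<Longrightarrow> lapW s > 0"
  using LapW_pos[of s] LapW_finite[of s] unfolding lapW_def by (simp add: enn2real_positive_iff zero_less_iff_neq_zero)

lemma lapW_eq: "s > k0 \<Longrightarrow> lapW s = 1 / \<Psi> s"
  using LapW_eq[of s] Wt_laplace_nn(2)[of s] by (simp add: lapW_def)

text \<open>The convolution of \<open>W\<close> with g, divided by \<open>W\<close>; see
  \<open>T_Wconv\<close>. Written with the ratio R, the integrand is dominated by
  \<open>exp (- theta * y) * g y\<close> uniformly in x, which is what
  \<open>theta_integrable\<close> asks for.\<close>

definition T :: "(real \<Rightarrow> real) \<Rightarrow> real \<Rightarrow> real" where
  "T g x = (\<integral>y. R y x * g y \<partial>lborel)"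

definition theta_integrable :: "(real \<Rightarrow> real) \<Rightarrow> bool" where
  "theta_integrable g \<longleftrightarrow> g \<in> borel_measurable borel \<and> (\<forall>y. g y \<ge> 0) \<and> (\<forall>y\<le>0. g y = 0) \<and>
     integrable lborel (\<lambda>y. exp (- theta * y) * g y)"

context
  fixes g :: "real \<Rightarrow> real"
  assumes g: "theta_integrable g"
begin

lemma theta_integrableD:
  shows g_meas [measurable]: "g \<in> borel_measurable borel" and g_nonneg [simp]: "g y \<ge> 0"
    and g_zero: "y \<le> 0 \<Longrightarrow> g y = 0" and g_int: "integrable lborel (\<lambda>y. exp (- theta * y) * g y)"
  using g unfolding theta_integrable_def by auto

lemma R_g_le: "norm (R y x * g y) \<le> exp (- theta * y) * g y"
  using R_le_exp[of y x] g_zero[of y] by (cases "y \<le> 0") (auto intro: mult_right_mono)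

lemma R_g_integrable: "integrable lborel (\<lambda>y. R y x * g y)"
  by (rule Bochner_Integration.integrable_bound[OF g_int]) (use R_g_le in \<open>auto simp: abs_of_nonneg\<close>)

lemma T_nonneg: "T g x \<ge> 0"
  unfolding T_def by (intro integral_nonneg_AE) simp

lemma T_le: "T g x \<le> (\<integral>y. exp (- theta * y) * g y \<partial>lborel)"
  unfolding T_def using R_g_le by (intro integral_mono R_g_integrable g_int) (simp add: abs_of_nonneg)

lemma T_zero: "x \<le> 0 \<Longrightarrow> T g x = 0"
  unfolding T_def R_def by simp

lemma T_continuous: "isCont (T g) x"
  unfolding continuous_at_sequentially o_def
proof (intro allI impI)
  fix u :: "nat \<Rightarrow> real" assume u: "u \<longlonglongrightarrow> x"
  show "(\<lambda>n. T g (u n)) \<longlonglongrightarrow> T g x"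
    unfolding T_def
  proof (rule integral_dominated_convergence[where w="\<lambda>y. exp (- theta * y) * g y"])
    show "AE y in lborel. (\<lambda>n. R y (u n) * g y) \<longlonglongrightarrow> R y x * g y"
      \<comment> \<open>As a function of its second argument, \<open>R y\<close> may be
        discontinuous at y itself, where \<open>Wt (x - y)\<close> can jump; this excludes only the
        null set y = x.\<close>
      using AE_lborel_singleton[of x]
    proof eventually_elim
      case (elim y)
      have "(\<lambda>n. R y (u n)) \<longlonglongrightarrow> R y x" if y: "y > 0"
      proof (cases "x > y")
        case True
        have "(\<lambda>n. Wt (u n - y)) \<longlonglongrightarrow> Wt (x - y)"
          using True u by (intro isCont_tendsto_compose[OF W_continuous_pos] tendsto_intros) auto
        moreover have "(\<lambda>n. Wt (u n)) \<longlonglongrightarrow> Wt x"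
          using True y u by (intro isCont_tendsto_compose[OF W_continuous_pos]) auto
        ultimately show ?thesis
          unfolding R_def using True y Wt_pos[of x] by (intro tendsto_divide) auto
      next
        case False
        then have "x < y" using elim by simp
        then have "\<forall>\<^sub>F n in sequentially. u n < y" using u by (rule order_tendstoD(2)[rotated])
        then have "\<forall>\<^sub>F n in sequentially. R y (u n) = R y x"
          by eventually_elim (use \<open>x < y\<close> in \<open>auto simp: R_def\<close>)
        then show ?thesis by (rule tendsto_eventually)
      qed
      then show ?case using g_zero[of y] by (cases "y > 0") (auto intro: tendsto_intros)
    qed
  qed (use R_g_le g_int in auto)
qed

lemma T_tendsto: "(T g \<longlongrightarrow> (\<integral>y. exp (- theta * y) * g y \<partial>lborel)) at_top"
proof (rule tendsto_at_topI_sequentially)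
  fix u :: "nat \<Rightarrow> real" assume u: "filterlim u at_top sequentially"
  show "(\<lambda>n. T g (u n)) \<longlonglongrightarrow> (\<integral>y. exp (- theta * y) * g y \<partial>lborel)"
    unfolding T_def
  proof (rule integral_dominated_convergence[where w="\<lambda>y. exp (- theta * y) * g y"])
    have "(\<lambda>n. R y (u n) * g y) \<longlonglongrightarrow> exp (- theta * y) * g y" for y
    proof (cases "y \<ge> 0")
      case True
      then show ?thesis
        by (intro tendsto_mult tendsto_const filterlim_compose[OF R_tendsto u])
    qed (simp add: g_zero)
    then show "AE y in lborel. (\<lambda>n. R y (u n) * g y) \<longlonglongrightarrow> exp (- theta * y) * g y" by simp
  qed (use R_g_le g_int in auto)
qed

lemma T_Wconv: "ennreal (Wt x * T g x) = Wconv g x"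
proof -
  have "ennreal (Wt x * T g x) = ennreal (\<integral>y. Wt x * (R y x * g y) \<partial>lborel)"
    unfolding T_def by simp
  also have "\<dots> = (\<integral>\<^sup>+y. ennreal (Wt x * (R y x * g y)) \<partial>lborel)"
    by (intro nn_integral_eq_integral[symmetric] integrable_mult_right R_g_integrable) auto
  also have "\<dots> = (\<integral>\<^sup>+y. Wn (x - y) * ennreal (g y) \<partial>lborel)"
  proof (rule nn_integral_cong)
    fix y
    have "Wt x * (R y x * g y) = Wt (x - y) * g y"
    proof (cases "x > 0")
      case True then show ?thesis using Wt_pos[OF True] by (simp add: R_def)
    next
      case False
      then show ?thesis using g_zero[of y] by (cases "y \<le> 0") auto
    qed
    then show "ennreal (Wt x * (R y x * g y)) = Wn (x - y) * ennreal (g y)"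
      by (simp only: Wn_def ennreal_mult Wt_nonneg g_nonneg)
  qed
  also have "\<dots> = (\<integral>\<^sup>+a. Wn (x - (x + - 1 * a)) * ennreal (g (x + - 1 * a)) \<partial>lborel)"
    by (subst nn_integral_real_affine[where c="-1" and t=x]) auto
  finally show ?thesis by (simp add: Wconv_def)
qed

lemma Wconv_laplace:
  "(\<integral>\<^sup>+x. ennreal (exp (- s * x)) * Wconv g x \<partial>lborel) =
    LapW s * (\<integral>\<^sup>+y. ennreal (exp (- s * y)) * ennreal (g y) \<partial>lborel)"
proof -
  have "(\<integral>\<^sup>+x. ennreal (exp (- s * x)) * Wconv g x \<partial>lborel) =
      (\<integral>\<^sup>+x. (\<integral>\<^sup>+a. ennreal (exp (- s * x)) * (Wn a * ennreal (g (x - a))) \<partial>lborel) \<partial>lborel)"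
    unfolding Wconv_def by (intro nn_integral_cong nn_integral_cmult[symmetric]) measurable
  also have "\<dots> = (\<integral>\<^sup>+a. (\<integral>\<^sup>+x. ennreal (exp (- s * x)) * (Wn a * ennreal (g (x - a))) \<partial>lborel) \<partial>lborel)"
    by (rule lborel_pair.Fubini'[symmetric]) measurable
  also have "\<dots> = (\<integral>\<^sup>+a. ennreal (exp (- s * a)) * Wn a *
      (\<integral>\<^sup>+y. ennreal (exp (- s * y)) * ennreal (g y) \<partial>lborel) \<partial>lborel)"
  proof (rule nn_integral_cong)
    fix a
    have "(\<integral>\<^sup>+x. ennreal (exp (- s * x)) * (Wn a * ennreal (g (x - a))) \<partial>lborel) =
      (\<integral>\<^sup>+y. ennreal (exp (- s * (a + 1 * y))) * (Wn a * ennreal (g (a + 1 * y - a))) \<partial>lborel)"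
      by (subst nn_integral_real_affine[where c="1" and t=a]) auto
    also have "\<dots> = (\<integral>\<^sup>+y. ennreal (exp (- s * a)) * Wn a * (ennreal (exp (- s * y)) * ennreal (g y)) \<partial>lborel)"
    proof (rule nn_integral_cong)
      fix y
      have "exp (- s * (a + 1 * y)) = exp (- s * a) * exp (- s * y)"
        by (simp add: exp_add[symmetric] algebra_simps)
      then show "ennreal (exp (- s * (a + 1 * y))) * (Wn a * ennreal (g (a + 1 * y - a))) =
        ennreal (exp (- s * a)) * Wn a * (ennreal (exp (- s * y)) * ennreal (g y))"
        by (simp only: ennreal_mult exp_ge_zero) (simp add: ac_simps)
    qed
    also have "\<dots> = ennreal (exp (- s * a)) * Wn a * (\<integral>\<^sup>+y. ennreal (exp (- s * y)) * ennreal (g y) \<partial>lborel)"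
      by (rule nn_integral_cmult) measurable
    finally show "(\<integral>\<^sup>+x. ennreal (exp (- s * x)) * (Wn a * ennreal (g (x - a))) \<partial>lborel) = \<dots>" .
  qed
  also have "\<dots> = LapW s * (\<integral>\<^sup>+y. ennreal (exp (- s * y)) * ennreal (g y) \<partial>lborel)"
    unfolding LapW_def by (rule nn_integral_multc) measurable
  finally show ?thesis .
qed

end

declare g_meas [measurable del]

section \<open>The functions \<open>F k\<close> and their limits \<open>c k\<close>\<close>

primrec F :: "nat \<Rightarrow> real \<Rightarrow> real" where
  "F 0 = (\<lambda>x. 1)"
| "F (Suc k) = T (\<lambda>y. exp (- y) * Wt y * F k y)"

definition gF :: "nat \<Rightarrow> real \<Rightarrow> real" where
  "gF k y = exp (- y) * Wt y * F k y"

text \<open>\<open>c k\<close> is the limit of \<open>F k\<close> at infinity. As \<open>lapW s = 1 / \<Psi> s\<close> is only known for \<open>s > k0\<close>,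
  finitely many factors are not expressed by \<open>\<Psi>\<close>; they do not influence the asymptotics.\<close>

definition c :: "nat \<Rightarrow> real" where
  "c k = (\<Prod>j<k. lapW (theta + 1 + real j))"

lemma F_Suc: "F (Suc k) = T (gF k)"
  by (simp add: gF_def[abs_def])

lemma c_pos: "c k > 0"
  using theta_nonneg unfolding c_def by (intro prod_pos lapW_pos) auto

text \<open>The factor \<open>exp (- y)\<close> in \<open>gF\<close> moves the argument from
  \<open>theta\<close> to \<open>theta + 1\<close>, into the range where \<open>LapW\<close> is
  finite.\<close>

lemma gF_aux:
  assumes [measurable]: "F k \<in> borel_measurable borel" and nn: "\<And>x. 0 \<le> F k x"
    and lap: "\<And>s. (\<integral>\<^sup>+x. ennreal (exp (- s * x)) * (Wn x * ennreal (F k x)) \<partial>lborel) = (\<Prod>j\<le>k. LapW (s + real j))"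
  shows "theta_integrable (gF k)" and "(\<integral>y. exp (- theta * y) * gF k y \<partial>lborel) = c (Suc k)"
proof -
  have [measurable]: "gF k \<in> borel_measurable borel" unfolding gF_def[abs_def] by measurable
  have nng: "gF k y \<ge> 0" for y using nn by (simp add: gF_def)
  have "(\<integral>\<^sup>+y. ennreal (exp (- theta * y) * gF k y) \<partial>lborel) =
      (\<integral>\<^sup>+x. ennreal (exp (- (theta + 1) * x)) * (Wn x * ennreal (F k x)) \<partial>lborel)"
  proof (rule nn_integral_cong)
    fix y
    have "exp (- (theta + 1) * y) = exp (- theta * y) * exp (- y)"
      by (simp add: exp_add[symmetric] algebra_simps)
    then have "exp (- theta * y) * gF k y = exp (- (theta + 1) * y) * (Wt y * F k y)"
      by (simp only: gF_def mult.assoc)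
    then show "ennreal (exp (- theta * y) * gF k y) = ennreal (exp (- (theta + 1) * y)) * (Wn y * ennreal (F k y))"
      using nn[of y] by (simp only: Wn_def) (simp add: ennreal_mult)
  qed
  also have "\<dots> = (\<Prod>j<Suc k. LapW (theta + 1 + real j))"
    unfolding lap by (simp add: lessThan_Suc_atMost)
  also have "\<dots> = (\<Prod>j<Suc k. ennreal (lapW (theta + 1 + real j)))"
    by (intro prod.cong LapW_lapW) auto
  also have "\<dots> = ennreal (c (Suc k))"
    unfolding c_def by (intro prod_ennreal less_imp_le lapW_pos) auto
  finally have e: "(\<integral>\<^sup>+y. ennreal (exp (- theta * y) * gF k y) \<partial>lborel) = ennreal (c (Suc k))" .
  have i: "integrable lborel (\<lambda>y. exp (- theta * y) * gF k y)"
    by (rule integrableI_nn_integral_finite[OF _ _ e]) (use nng in auto)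
  then show "theta_integrable (gF k)"
    unfolding theta_integrable_def using nng by (auto simp: gF_def)
  show "(\<integral>y. exp (- theta * y) * gF k y \<partial>lborel) = c (Suc k)"
    using e nn_integral_eq_integral[OF i] nng c_pos[of "Suc k"]
    by (simp add: integral_nonneg_AE)
qed

text \<open>A joint induction: the transform of \<open>W * F k\<close> makes \<open>gF k\<close>
  admissible for \<open>T\<close>, and this in turn gives measurability, sign and transform of
  \<open>F (Suc k)\<close>. In \<open>ennreal\<close> the product formula holds for all s, including
  those with infinite transform.\<close>

lemma F_aux:
  "F k \<in> borel_measurable borel \<and> (\<forall>x. 0 \<le> F k x) \<and>
   (\<forall>s. (\<integral>\<^sup>+x. ennreal (exp (- s * x)) * (Wn x * ennreal (F k x)) \<partial>lborel) = (\<Prod>j\<le>k. LapW (s + real j)))"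
proof (induction k)
  case 0
  show ?case by (simp add: LapW_def)
next
  case (Suc k)
  have IH: "F k \<in> borel_measurable borel" "\<And>x. 0 \<le> F k x"
    "\<And>s. (\<integral>\<^sup>+x. ennreal (exp (- s * x)) * (Wn x * ennreal (F k x)) \<partial>lborel) = (\<Prod>j\<le>k. LapW (s + real j))"
    using Suc by auto
  note g = gF_aux(1)[OF IH]
  have "F (Suc k) \<in> borel_measurable borel"
    unfolding F_Suc by (intro borel_measurable_continuous_onI continuous_at_imp_continuous_on ballI T_continuous[OF g])
  moreover have "0 \<le> F (Suc k) x" for x unfolding F_Suc by (rule T_nonneg[OF g])
  moreover have "(\<integral>\<^sup>+x. ennreal (exp (- s * x)) * (Wn x * ennreal (F (Suc k) x)) \<partial>lborel) =
    (\<Prod>j\<le>Suc k. LapW (s + real j))" for s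
  proof -
    have "(\<integral>\<^sup>+x. ennreal (exp (- s * x)) * (Wn x * ennreal (F (Suc k) x)) \<partial>lborel) =
        (\<integral>\<^sup>+x. ennreal (exp (- s * x)) * Wconv (gF k) x \<partial>lborel)"
      unfolding T_Wconv[OF g, symmetric] F_Suc Wn_def
      by (intro nn_integral_cong) (simp add: ennreal_mult T_nonneg[OF g])
    also have "\<dots> = LapW s * (\<integral>\<^sup>+y. ennreal (exp (- s * y)) * ennreal (gF k y) \<partial>lborel)"
      by (rule Wconv_laplace[OF g])
    also have "(\<integral>\<^sup>+y. ennreal (exp (- s * y)) * ennreal (gF k y) \<partial>lborel) =
        (\<integral>\<^sup>+x. ennreal (exp (- (s + 1) * x)) * (Wn x * ennreal (F k x)) \<partial>lborel)"
    proof (rule nn_integral_cong)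
      fix y
      have "exp (- (s + 1) * y) = exp (- s * y) * exp (- y)"
        by (simp add: exp_add[symmetric] algebra_simps)
      then show "ennreal (exp (- s * y)) * ennreal (gF k y) = ennreal (exp (- (s + 1) * y)) * (Wn y * ennreal (F k y))"
        using IH(2)[of y] by (simp only: Wn_def gF_def) (simp add: ennreal_mult mult.assoc)
    qed
    also have "\<dots> = (\<Prod>j\<le>k. LapW (s + 1 + real j))" by (rule IH(3))
    also have "LapW s * \<dots> = (\<Prod>j\<le>Suc k. LapW (s + real j))"
      by (subst prod.atMost_Suc_shift) (simp add: ac_simps)
    finally show ?thesis .
  qed
  ultimately show ?case by blast
qed

lemma F_measurable [measurable]: "F k \<in> borel_measurable borel"
  and F_nonneg: "0 \<le> F k x"
  using F_aux[of k] by auto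

lemma gF_theta_integrable: "theta_integrable (gF k)"
  and gF_integral: "(\<integral>y. exp (- theta * y) * gF k y \<partial>lborel) = c (Suc k)"
  using gF_aux[of k] F_aux[of k] by auto

lemma c_0 [simp]: "c 0 = 1"
  by (simp add: c_def)

lemma F_le: "F k x \<le> c k"
proof (cases k)
  case (Suc j)
  then show ?thesis using T_le[OF gF_theta_integrable[of j], of x] by (simp only: F_Suc gF_integral)
qed simp

lemma F_tendsto: "(F k \<longlongrightarrow> c k) at_top"
proof (cases k)
  case (Suc j)
  then show ?thesis using T_tendsto[OF gF_theta_integrable[of j]] by (simp only: F_Suc gF_integral)
qed (simp add: tendsto_const)

lemma F_continuous: "isCont (F k) x"
proof (cases k)
  case (Suc j)
  then show ?thesis using T_continuous[OF gF_theta_integrable[of j], of x] by (simp only: F_Suc)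
qed simp

lemma F_at_0: "F (Suc k) 0 = 0"
  unfolding F_Suc by (rule T_zero[OF gF_theta_integrable]) simp

end

section \<open>Discretised killing and the conditioned semigroup\<close>

context scale_setting
begin

text \<open>Survival tested at the grid times only. This kills fewer paths than \<open>K\<close>
  does, and each step is governed by independent increments alone.\<close>

definition grid_pos :: "real \<Rightarrow> real \<Rightarrow> nat \<Rightarrow> 'a set" where
  "grid_pos z h k = {\<omega> \<in> space M. \<forall>j\<in>{1..k}. z + V (real j * h) \<omega> > 0}"

lemma grid_pos_sets [measurable]: "h \<ge> 0 \<Longrightarrow> grid_pos z h k \<in> sets M"
proof -
  assume h: "h \<ge> 0"
  have [measurable]: "V (real j * h) \<in> borel_measurable M" for j using h by (intro measurable_V) simp
  show ?thesis unfolding grid_pos_def by measurable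
qed

text \<open>Survival and position at step k are functions of the first k increments; the next
  increment is independent of them and has the law of \<open>V h\<close>.\<close>

lemma grid_markov:
  assumes u[measurable]: "u \<in> borel_measurable borel" and h: "h \<ge> 0"
  shows "(\<integral>\<^sup>+\<omega>. u (z + V (real (Suc k) * h) \<omega>) * indicator (grid_pos z h k) \<omega> \<partial>M) =
    (\<integral>\<^sup>+\<omega>. P h u (z + V (real k * h) \<omega>) * indicator (grid_pos z h k) \<omega> \<partial>M)"
proof -
  define ts where "ts i = real i * h" for i :: nat
  define X where "X i \<omega> = V (ts (Suc i)) \<omega> - V (ts i) \<omega>" for i :: nat and \<omega>
  have [measurable]: "V (ts j) \<in> borel_measurable M" for j
    unfolding ts_def using h by (intro measurable_V) simp
  have [measurable]: "V h \<in> borel_measurable M" using h by (rule measurable_V)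
  have ind: "indep_vars (\<lambda>_. borel) X {..<Suc k}"
    unfolding X_def[abs_def]
    by (rule independent_increments) (auto simp: ts_def incseq_def h intro: mult_right_mono)
  have VX: "V (ts j) \<omega> = (\<Sum>i<j. X i \<omega>)" if "\<omega> \<in> space M" for j \<omega>
    unfolding X_def sum_lessThan_telescope[of "\<lambda>i. V (ts i) \<omega>"] using V_start[OF that] by (simp add: ts_def)
  \<comment> \<open>\<open>indep_var\<close> relates two variables of the same type: survival and
    position are packed into a pair, and the next increment will carry the dummy first component
    0.\<close>
  define ch :: "(nat \<Rightarrow> real) \<Rightarrow> ennreal \<times> real" where "ch y = (indicator {y :: nat \<Rightarrow> real. \<forall>j\<in>{1..k}. z + (\<Sum>i<j. y i) > 0} y, z + (\<Sum>i<k. y i))" for y :: "nat \<Rightarrow> real"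
  let ?S = "PiM {..<k} (\<lambda>_. borel :: real measure)" and ?S' = "PiM {k} (\<lambda>_. borel :: real measure)"
  let ?B = "borel \<Otimes>\<^sub>M borel :: (ennreal \<times> real) measure"
  have comp: "(\<lambda>y. y i) \<in> borel_measurable ?S" if "i < k" for i
    using that by (intro measurable_component_singleton) auto
  have sm: "(\<lambda>y. \<Sum>i<j. y i) \<in> borel_measurable ?S" if "j \<le> k" for j
    using that comp by (intro borel_measurable_sum) auto
  have "{y \<in> space ?S. \<forall>j\<in>{1..k}. z + (\<Sum>i<j. y i) > 0} \<in> sets ?S"
    using sm by (intro sets.sets_Collect_finite_All borel_measurable_less borel_measurable_add) auto
  then have "indicator {y :: nat \<Rightarrow> real. \<forall>j\<in>{1..k}. z + (\<Sum>i<j. y i) > 0} \<in> (borel_measurable ?S :: ((nat \<Rightarrow> real) \<Rightarrow> ennreal) set)"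
    by (intro borel_measurable_indicator') (simp add: Int_def conj_commute)
  then have chm: "ch \<in> measurable ?S ?B"
    unfolding ch_def[abs_def] using sm[of k] by (intro measurable_Pair borel_measurable_add) auto
  have "indep_var ?S (\<lambda>\<omega>. restrict (\<lambda>i. X i \<omega>) {..<k}) ?S' (\<lambda>\<omega>. restrict (\<lambda>i. X i \<omega>) {k})"
    by (rule indep_var_restrict[OF ind]) auto
  then have "indep_var ?B (ch \<circ> (\<lambda>\<omega>. restrict (\<lambda>i. X i \<omega>) {..<k})) ?B
      ((\<lambda>y. (0::ennreal, y k)) \<circ> (\<lambda>\<omega>. restrict (\<lambda>i. X i \<omega>) {k}))"
    by (rule indep_var_compose[OF _ chm]) (auto intro!: measurable_Pair measurable_component_singleton)
  moreover have "(\<lambda>y. (0::ennreal, y k)) \<circ> (\<lambda>\<omega>. restrict (\<lambda>i. X i \<omega>) {k}) = (\<lambda>\<omega>. (0::ennreal, X k \<omega>))"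
    by (auto simp: fun_eq_iff)
  ultimately have ind2: "indep_var ?B (ch \<circ> (\<lambda>\<omega>. restrict (\<lambda>i. X i \<omega>) {..<k})) ?B (\<lambda>\<omega>. (0::ennreal, X k \<omega>))" by (simp only:)
  define U where "U = ch \<circ> (\<lambda>\<omega>. restrict (\<lambda>i. X i \<omega>) {..<k})"
  have U: "U \<omega> = (indicator (grid_pos z h k) \<omega>, z + V (real k * h) \<omega>)" if "\<omega> \<in> space M" for \<omega>
  proof -
    have s: "(\<Sum>i<j. restrict (\<lambda>i. X i \<omega>) {..<k} i) = V (real j * h) \<omega>" if "j \<le> k" for j
    proof -
      have "(\<Sum>i<j. restrict (\<lambda>i. X i \<omega>) {..<k} i) = (\<Sum>i<j. X i \<omega>)"
        using that by (intro sum.cong) auto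
      then show ?thesis using VX[OF \<open>\<omega> \<in> space M\<close>, of j] by (simp add: ts_def)
    qed
    show ?thesis
      unfolding U_def o_def ch_def grid_pos_def using s that by (auto split: split_indicator)
  qed
  define Y where "Y \<omega> = (0 :: ennreal, X k \<omega>)" for \<omega>
  have dist: "distr M ?B U \<Otimes>\<^sub>M distr M ?B Y = distr M (?B \<Otimes>\<^sub>M ?B) (\<lambda>\<omega>. (U \<omega>, Y \<omega>))"
    and Um[measurable]: "U \<in> measurable M ?B" and Ym[measurable]: "Y \<in> measurable M ?B"
    using ind2 unfolding indep_var_distribution_eq U_def Y_def[abs_def] by auto
  have Xm[measurable]: "X k \<in> borel_measurable M" unfolding X_def[abs_def] by measurable
  have dX: "distr M borel (X k) = distr M borel (V h)"
    using stationary_increments[of "ts k" h] h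
    unfolding X_def ts_def by (simp add: distrib_right add.commute)
  interpret YM: prob_space "distr M ?B Y" by (rule prob_space_distr) measurable
  interpret UM: prob_space "distr M ?B U" by (rule prob_space_distr) measurable
  let ?f = "\<lambda>w. u (snd (fst w) + snd (snd w)) * fst (fst w)"
  have fm: "?f \<in> borel_measurable (?B \<Otimes>\<^sub>M ?B)" by measurable
  have "(\<integral>\<^sup>+\<omega>. u (z + V (real (Suc k) * h) \<omega>) * indicator (grid_pos z h k) \<omega> \<partial>M) =
      (\<integral>\<^sup>+\<omega>. ?f (U \<omega>, Y \<omega>) \<partial>M)"
  proof (rule nn_integral_cong)
    fix \<omega> assume "\<omega> \<in> space M"
    have "z + V (real k * h) \<omega> + X k \<omega> = z + V (real (Suc k) * h) \<omega>" by (simp add: X_def ts_def)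
    then show "u (z + V (real (Suc k) * h) \<omega>) * indicator (grid_pos z h k) \<omega> = ?f (U \<omega>, Y \<omega>)"
      using U[OF \<open>\<omega> \<in> space M\<close>] by (simp only: Y_def fst_conv snd_conv)
  qed
  also have "\<dots> = (\<integral>\<^sup>+w. ?f w \<partial>distr M (?B \<Otimes>\<^sub>M ?B) (\<lambda>\<omega>. (U \<omega>, Y \<omega>)))"
    by (rule nn_integral_distr[symmetric]) (use fm in \<open>auto intro!: measurable_Pair\<close>)
  also have "\<dots> = (\<integral>\<^sup>+w. ?f w \<partial>(distr M ?B U \<Otimes>\<^sub>M distr M ?B Y))" unfolding dist ..
  also have "\<dots> = (\<integral>\<^sup>+a. (\<integral>\<^sup>+b. ?f (a, b) \<partial>distr M ?B Y) \<partial>distr M ?B U)"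
    using fm by (intro YM.nn_integral_fst[symmetric]) simp
  also have "\<dots> = (\<integral>\<^sup>+a. (\<integral>\<^sup>+b. u (snd a + b) * fst a \<partial>distr M borel (X k)) \<partial>distr M ?B U)"
    by (intro nn_integral_cong) (simp add: nn_integral_distr Y_def)
  also have "\<dots> = (\<integral>\<^sup>+a. (\<integral>\<^sup>+b. u (snd a + b) * fst a \<partial>distr M borel (V h)) \<partial>distr M ?B U)"
    unfolding dX ..
  also have "\<dots> = (\<integral>\<^sup>+a. P h u (snd a) * fst a \<partial>distr M ?B U)"
    unfolding P_def by (intro nn_integral_cong) (simp add: nn_integral_distr nn_integral_multc)
  also have "\<dots> = (\<integral>\<^sup>+\<omega>. P h u (snd (U \<omega>)) * fst (U \<omega>) \<partial>M)"
    using h by (intro nn_integral_distr Um borel_measurable_times_ennreal measurable_compose[OF measurable_snd P_measurable]) auto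
  also have "\<dots> = (\<integral>\<^sup>+\<omega>. P h u (z + V (real k * h) \<omega>) * indicator (grid_pos z h k) \<omega> \<partial>M)"
    by (intro nn_integral_cong) (simp add: U)
  finally show ?thesis .
qed

text \<open>Each step adds v, and v is collected on grid survival, which is implied by true
  survival. Testing positivity at the new grid time costs nothing because u vanishes on nonpositive
  points.\<close>

lemma grid_lower:
  assumes u[measurable]: "u \<in> borel_measurable borel" and v[measurable]: "v \<in> borel_measurable borel"
    and h: "h \<ge> 0" and z: "z > 0"
    and u0: "\<And>y. y \<le> 0 \<Longrightarrow> u y = 0" and uv: "\<And>y. P h u y = u y + v y"
  shows "u z + (\<Sum>k<n. K (real k * h) v z) \<le>
    (\<integral>\<^sup>+\<omega>. u (z + V (real n * h) \<omega>) * indicator (grid_pos z h n) \<omega> \<partial>M)"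
proof (induction n)
  case 0
  have "(\<integral>\<^sup>+\<omega>. u (z + V (real 0 * h) \<omega>) * indicator (grid_pos z h 0) \<omega> \<partial>M) = (\<integral>\<^sup>+\<omega>. u z \<partial>M)"
    by (intro nn_integral_cong) (simp add: grid_pos_def V_start)
  then show ?case by (simp add: emeasure_space_1)
next
  case (Suc n)
  have nh: "real n * h \<ge> 0" using h by simp
  have [measurable]: "V (real n * h) \<in> borel_measurable M" using nh by (rule measurable_V)
  note [measurable] = grid_pos_sets[OF h]
  have "u z + (\<Sum>k<Suc n. K (real k * h) v z) =
      (u z + (\<Sum>k<n. K (real k * h) v z)) + K (real n * h) v z" by (simp add: add.assoc)
  also have "\<dots> \<le> (\<integral>\<^sup>+\<omega>. u (z + V (real n * h) \<omega>) * indicator (grid_pos z h n) \<omega> \<partial>M) +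
      (\<integral>\<^sup>+\<omega>. v (z + V (real n * h) \<omega>) * indicator (grid_pos z h n) \<omega> \<partial>M)"
  proof (rule add_mono[OF Suc])
    show "K (real n * h) v z \<le> (\<integral>\<^sup>+\<omega>. v (z + V (real n * h) \<omega>) * indicator (grid_pos z h n) \<omega> \<partial>M)"
      unfolding K_def
    proof (rule nn_integral_mono)
      fix \<omega> assume \<omega>: "\<omega> \<in> space M"
      have "\<omega> \<in> grid_pos z h n" if "z + m (real n * h) \<omega> > 0"
      proof -
        have "z + V (real j * h) \<omega> > 0" if "j \<le> n" for j
          using m_le[OF \<omega>, of "real j * h" "real n * h"] that h \<open>z + m (real n * h) \<omega> > 0\<close>
          by (simp add: mult_right_mono)
        then show ?thesis using \<omega> by (simp add: grid_pos_def)
      qed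
      then show "v (z + V (real n * h) \<omega>) * indicator {0<..} (z + m (real n * h) \<omega>) \<le>
          v (z + V (real n * h) \<omega>) * indicator (grid_pos z h n) \<omega>"
        by (auto split: split_indicator)
    qed
  qed
  also have "\<dots> = (\<integral>\<^sup>+\<omega>. P h u (z + V (real n * h) \<omega>) * indicator (grid_pos z h n) \<omega> \<partial>M)"
    unfolding uv distrib_right by (rule nn_integral_add[symmetric]) measurable
  also have "\<dots> = (\<integral>\<^sup>+\<omega>. u (z + V (real (Suc n) * h) \<omega>) * indicator (grid_pos z h n) \<omega> \<partial>M)"
    by (rule grid_markov[OF u h, symmetric])
  also have "\<dots> = (\<integral>\<^sup>+\<omega>. u (z + V (real (Suc n) * h) \<omega>) * indicator (grid_pos z h (Suc n)) \<omega> \<partial>M)"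
  proof (rule nn_integral_cong)
    fix \<omega> assume \<omega>: "\<omega> \<in> space M"
    have "\<omega> \<in> grid_pos z h (Suc n) \<longleftrightarrow> \<omega> \<in> grid_pos z h n \<and> z + V (real (Suc n) * h) \<omega> > 0"
      using \<omega> unfolding grid_pos_def by (auto simp: atLeastAtMostSuc_conv)
    then show "u (z + V (real (Suc n) * h) \<omega>) * indicator (grid_pos z h n) \<omega> =
        u (z + V (real (Suc n) * h) \<omega>) * indicator (grid_pos z h (Suc n)) \<omega>"
      using u0[of "z + V (real (Suc n) * h) \<omega>"] by (cases "z + V (real (Suc n) * h) \<omega> > 0") (auto split: split_indicator)
  qed
  finally show ?case .
qed

lemma K_iterate_upper:
  assumes u[measurable]: "u \<in> borel_measurable borel" and v[measurable]: "v \<in> borel_measurable borel"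
    and h: "h \<ge> 0" and z: "z > 0" and uv: "\<And>y. P h u y = u y + v y"
  shows "K (real n * h) u z \<le> u z + (\<Sum>k<n. K (real k * h) v z)"
proof (induction n)
  case 0 then show ?case using z by (simp add: K_0)
next
  case (Suc n)
  have nh: "real n * h \<ge> 0" using h by simp
  have "K (real (Suc n) * h) u z = K (real n * h) (K h u) z"
    using K_semigroup[OF u nh h z] by (simp add: distrib_right add.commute)
  also have "\<dots> \<le> K (real n * h) (\<lambda>y. u y + v y) z"
    using nh K_le_P[of h u] by (intro K_mono) (auto simp: uv[symmetric])
  also have "\<dots> = K (real n * h) u z + K (real n * h) v z" using nh by (intro K_add) auto
  also have "\<dots> \<le> u z + (\<Sum>k<n. K (real k * h) v z) + K (real n * h) v z"
    by (intro add_right_mono Suc)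
  finally show ?case by (simp add: add.assoc)
qed

section \<open>The conditioned semigroup acting on bounded functions\<close>

definition pp :: "real \<Rightarrow> (real \<Rightarrow> real) \<Rightarrow> real \<Rightarrow> real" where
  "pp t f x = (LINT y:{0..}|p t x. f y)"

lemma AE_p_nonneg: "t \<ge> 0 \<Longrightarrow> x \<ge> 0 \<Longrightarrow> AE y in p t x. y \<ge> 0"
proof -
  assume t: "t \<ge> 0" and x: "x \<ge> 0"
  interpret p: prob_space "p t x" using t x by (rule prob_p)
  have "AE y in p t x. y \<in> {0..}"
    using p_nonneg[OF t x] t x sets_eq_imp_space_eq[OF sets_p[OF t x]]
    by (intro p.AE_I_eq_1) (auto simp: atLeast_def)
  then show ?thesis by simp
qed

lemma pp_eq: "t \<ge> 0 \<Longrightarrow> x \<ge> 0 \<Longrightarrow> f \<in> borel_measurable borel \<Longrightarrow> pp t f x = (\<integral>y. f y \<partial>p t x)"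
proof -
  assume t: "t \<ge> 0" and x: "x \<ge> 0" and [measurable]: "f \<in> borel_measurable borel"
  have [simp]: "measurable (p t x) borel = borel_measurable borel"
    using sets_p[OF t x] by (rule measurable_cong_sets) simp
  show ?thesis unfolding pp_def set_lebesgue_integral_def
    by (rule integral_cong_AE) (use AE_p_nonneg[OF t x] in auto)
qed

lemma integrable_p:
  fixes f :: "real \<Rightarrow> real"
  assumes t: "t \<ge> 0" and x: "x \<ge> 0" and [measurable]: "f \<in> borel_measurable borel" and B: "\<And>y. \<bar>f y\<bar> \<le> B"
  shows "integrable (p t x) f"
proof -
  interpret p: prob_space "p t x" using t x by (rule prob_p)
  have "f \<in> borel_measurable (p t x)"
    using assms(3) sets_p[OF t x] by (simp cong: measurable_cong_sets)
  then show ?thesis by (rule p.integrable_const_bound[where B=B, rotated]) (use B in auto)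
qed

lemma pp_nn:
  assumes t: "t \<ge> 0" and x: "x \<ge> 0" and [measurable]: "f \<in> borel_measurable borel"
    and B: "\<And>y. 0 \<le> f y" "\<And>y. f y \<le> B"
  shows "ennreal (pp t f x) = (\<integral>\<^sup>+y. ennreal (f y) \<partial>p t x)"
  unfolding pp_eq[OF t x assms(3)]
  by (rule nn_integral_eq_integral[symmetric, OF integrable_p[OF t x, where B=B]])
     (use B in \<open>auto simp: abs_le_iff intro: order_trans[OF _ B(1)]\<close>)

lemma pp_bounds:
  assumes t: "t \<ge> 0" and x: "x \<ge> 0" and f[measurable]: "f \<in> borel_measurable borel"
    and B: "\<And>y. y \<ge> 0 \<Longrightarrow> b1 \<le> f y" "\<And>y. y \<ge> 0 \<Longrightarrow> f y \<le> b2" and bd: "\<And>y. \<bar>f y\<bar> \<le> B"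
  shows "b1 \<le> pp t f x" "pp t f x \<le> b2"
proof -
  interpret p: prob_space "p t x" using t x by (rule prob_p)
  have i: "integrable (p t x) f" by (rule integrable_p[OF t x f bd])
  show "b1 \<le> pp t f x" unfolding pp_eq[OF t x f]
    by (rule p.integral_ge_const[OF i]) (use AE_p_nonneg[OF t x] B in auto)
  show "pp t f x \<le> b2" unfolding pp_eq[OF t x f]
    by (rule p.integral_le_const[OF i]) (use AE_p_nonneg[OF t x] B in auto)
qed

lemma K_pp:
  assumes t: "t \<ge> 0" and x: "x > 0" and f[measurable]: "f \<in> borel_measurable borel"
    and B: "\<And>y. 0 \<le> f y" "\<And>y. f y \<le> B"
  shows "K t (\<lambda>y. ennreal (Wt y * f y)) x = ennreal (Wt x * pp t f x)"
proof -
  have "K t (\<lambda>y. ennreal (Wt y * f y)) x = K t (\<lambda>y. ennreal (f y) * ennreal (Wt y)) x"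
    using B by (simp add: ennreal_mult mult.commute)
  also have "\<dots> = ennreal (W x) * ennreal (pp t f x)"
    using x t pp_nn[OF t less_imp_le[OF x] f B] by (subst K_eq_p) auto
  also have "\<dots> = ennreal (Wt x * pp t f x)"
    using x W_nonneg[of x] pp_bounds(1)[OF t less_imp_le[OF x] f, of 0 B B] B
    by (subst ennreal_mult) auto
  finally show ?thesis .
qed

lemma pp_nonneg:
  assumes "t \<ge> 0" "x \<ge> 0" "f \<in> borel_measurable borel" "\<And>y. 0 \<le> f y" "\<And>y. f y \<le> B"
  shows "0 \<le> pp t f x"
  using pp_bounds(1)[OF assms(1-3), of 0 B B] assms(4,5) by simp

lemma pp_measurable_pos:
  assumes t: "t \<ge> 0" and f[measurable]: "f \<in> borel_measurable borel"
    and B: "\<And>y. 0 \<le> f y" "\<And>y. f y \<le> B"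
  shows "(\<lambda>x. enn2real (K t (\<lambda>y. ennreal (Wt y * f y)) x) / Wt x) \<in> borel_measurable borel"
    and "x > 0 \<Longrightarrow> pp t f x = enn2real (K t (\<lambda>y. ennreal (Wt y * f y)) x) / Wt x"
proof -
  show "(\<lambda>x. enn2real (K t (\<lambda>y. ennreal (Wt y * f y)) x) / Wt x) \<in> borel_measurable borel"
    using t by (intro borel_measurable_divide borel_measurable_enn2real K_measurable) auto
  assume x: "x > 0"
  then show "pp t f x = enn2real (K t (\<lambda>y. ennreal (Wt y * f y)) x) / Wt x"
    unfolding K_pp[OF t x f B] using pp_nonneg[OF t less_imp_le[OF x] f B] Wt_pos[OF x] by simp
qed

text \<open>\<open>pp h f\<close> is controlled only at nonnegative points. Setting it to 0
  elsewhere and at 0 yields a bounded Borel function on the whole line, and changes nothing almost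
  everywhere for \<open>p s x\<close> with x > 0.\<close>

definition ppm :: "real \<Rightarrow> (real \<Rightarrow> real) \<Rightarrow> real \<Rightarrow> real" where
  "ppm h f y = (if y > 0 then pp h f y else 0)"

lemma ppm_props:
  assumes h: "h \<ge> 0" and f[measurable]: "f \<in> borel_measurable borel"
    and B: "\<And>y. 0 \<le> f y" "\<And>y. f y \<le> B"
  shows "ppm h f \<in> borel_measurable borel" and "0 \<le> ppm h f y" and "ppm h f y \<le> B"
proof -
  have e: "ppm h f y = (if y > 0 then enn2real (K h (\<lambda>y. ennreal (Wt y * f y)) y) / Wt y else 0)" for y
    unfolding ppm_def using pp_measurable_pos(2)[OF h f B] by auto
  show "ppm h f \<in> borel_measurable borel"
    unfolding e[abs_def] using pp_measurable_pos(1)[OF h f B] by measurable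
  have "0 \<le> B" using B[of 0] by linarith
  then show "0 \<le> ppm h f y" "ppm h f y \<le> B"
    using pp_bounds[OF h _ f, of y 0 B B] B by (auto simp: ppm_def)
qed

lemma pp_semigroup:
  assumes s: "s \<ge> 0" and h: "h \<ge> 0" and x: "x > 0" and f[measurable]: "f \<in> borel_measurable borel"
    and B: "\<And>y. 0 \<le> f y" "\<And>y. f y \<le> B"
  shows "pp (s + h) f x = pp s (ppm h f) x"
proof -
  note f' = ppm_props[OF h f B]
  have "ennreal (Wt x * pp (s + h) f x) = K s (K h (\<lambda>y. ennreal (Wt y * f y))) x"
    using K_pp[OF _ x f B, of "s + h"] K_semigroup[OF _ s h x, of "\<lambda>y. ennreal (Wt y * f y)"] s h by simp
  also have "\<dots> = K s (\<lambda>y. ennreal (Wt y * ppm h f y)) x"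
    using K_pp[OF h _ f B] s by (intro K_cong) (auto simp: ppm_def)
  also have "\<dots> = ennreal (Wt x * pp s (ppm h f) x)" by (rule K_pp[OF s x f'])
  finally have "Wt x * pp (s + h) f x = Wt x * pp s (ppm h f) x"
    using s h x pp_nonneg[OF _ _ f B, of "s + h" x] pp_nonneg[OF _ _ f', of s x]
    by (subst (asm) ennreal_inj) (auto simp: W_nonneg)
  then show ?thesis using Wt_pos[OF x] by simp
qed

lemma pp_vanishing: "vanishing_continuous f \<Longrightarrow> t \<ge> 0 \<Longrightarrow> vanishing_continuous (pp t f)"
  using feller unfolding feller_semigroup_def pp_def[abs_def] by blast

lemma pp_uniform: "vanishing_continuous f \<Longrightarrow> uniform_limit {0..} (\<lambda>t. pp t f) f (at_right 0)"
  using feller unfolding feller_semigroup_def pp_def[abs_def] by blast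

text \<open>The semigroup property reduces the increment of time to a short time started from a
  random point, where the Feller limit is uniform.\<close>

lemma pp_right_continuous:
  assumes f[measurable]: "f \<in> borel_measurable borel"
    and B: "\<And>y. 0 \<le> f y" "\<And>y. f y \<le> B" and van: "vanishing_continuous f"
    and s: "s \<ge> 0" and x: "x > 0"
  shows "continuous (at_right s) (\<lambda>s. pp s f x)"
  unfolding continuous_within
proof (rule tendstoI)
  fix e :: real assume e: "e > 0"
  have "\<forall>\<^sub>F h in at_right 0. \<forall>y\<in>{0..}. dist (pp h f y) (f y) < e / 2"
    using pp_uniform[OF van] e by (intro uniform_limitD) auto
  then obtain d where d: "d > 0" "\<And>h y. 0 < h \<Longrightarrow> h < d \<Longrightarrow> y \<ge> 0 \<Longrightarrow> dist (pp h f y) (f y) < e / 2"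
    unfolding eventually_at_right_field by auto
  have "dist (pp s' f x) (pp s f x) < e" if s': "s < s'" "s' < s + d" for s'
  proof -
    define h where "h = s' - s"
    have h: "0 < h" "h < d" "s' = s + h" using s' by (auto simp: h_def)
    note f' = ppm_props[OF less_imp_le[OF h(1)] f B]
    have b0: "0 \<le> B" using B[of 0] by linarith
    have i1: "integrable (p s x) (ppm h f)"
      by (rule integrable_p[where B=B]) (use f' s x in auto)
    have i2: "integrable (p s x) f"
      by (rule integrable_p[where B=B]) (use B s x in auto)
    interpret p: prob_space "p s x" using s x by (intro prob_p) auto
    have AE: "AE y in p s x. \<bar>ppm h f y - f y\<bar> \<le> e / 2"
      using AE_p_pos[OF s x]
      by eventually_elim (use d(2)[OF h(1,2)] in \<open>auto simp: ppm_def dist_real_def intro: less_imp_le\<close>)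
    have "pp s' f x - pp s f x = (\<integral>y. ppm h f y - f y \<partial>p s x)"
      unfolding h(3) pp_semigroup[OF s less_imp_le[OF h(1)] x f B]
      using s x f' by (subst pp_eq, simp, simp, simp, subst pp_eq) (auto simp: i1 i2)
    also have "\<bar>\<dots>\<bar> \<le> (\<integral>y. \<bar>ppm h f y - f y\<bar> \<partial>p s x)" by (rule integral_abs_bound)
    also have "\<dots> \<le> e / 2" using i1 i2 AE by (intro p.integral_le_const) auto
    finally show ?thesis using e by (simp add: dist_real_def)
  qed
  then show "\<forall>\<^sub>F s' in at_right s. dist (pp s' f x) (pp s f x) < e"
    unfolding eventually_at_right_field using d(1) by (intro exI[of _ "s + d"]) auto
qed

end

section \<open>Potentials of compactly supported functions\<close>

text \<open>Left and right sums differ by the end terms only, that is by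
  \<open>t / Suc n * (f 0 - f t)\<close>.\<close>

lemma right_continuous_left_riemann_sum:
  fixes f :: "real \<Rightarrow> real"
  assumes t: "t > 0" and rc: "\<And>s. s \<ge> 0 \<Longrightarrow> continuous (at_right s) f"
    and bd: "\<And>s. 0 \<le> s \<Longrightarrow> s \<le> t \<Longrightarrow> \<bar>f s\<bar> \<le> B"
  shows "(\<lambda>n. \<Sum>j<Suc n. t / real (Suc n) * f (real j * (t / real (Suc n))))
           \<longlonglongrightarrow> (LINT s:{0<..t}|lborel. f s)"
proof -
  let ?R = "\<lambda>n. \<Sum>j<Suc n. t / real (Suc n) * f (t * real (Suc j) / real (Suc n))"
  have e: "(\<Sum>j<Suc n. t / real (Suc n) * f (real j * (t / real (Suc n)))) =
      ?R n + (t * inverse (real (Suc n))) * (f 0 - f t)" for n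
  proof -
    let ?g = "\<lambda>j. t / real (Suc n) * f (real j * (t / real (Suc n)))"
    have "(\<Sum>j<Suc n. ?g (Suc j)) - (\<Sum>j<Suc n. ?g j) = ?g (Suc n) - ?g 0"
      by (subst sum_subtractf[symmetric]) (rule sum_lessThan_telescope)
    moreover have "real (Suc n) * (t / real (Suc n)) = t" by simp
    then have "?g (Suc n) = t * inverse (real (Suc n)) * f t"
      by (simp only: divide_inverse)
    moreover have "?g 0 = t * inverse (real (Suc n)) * f 0"
      by (simp add: divide_inverse del: of_nat_Suc)
    moreover have "?g (Suc j) = t / real (Suc n) * f (t * real (Suc j) / real (Suc n))" for j
      by (simp add: mult.commute del: of_nat_Suc)
    ultimately show ?thesis by (simp only: right_diff_distrib)
  qed
  have "(\<lambda>n. ?R n + (t * inverse (real (Suc n))) * (f 0 - f t))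
      \<longlonglongrightarrow> (LINT s:{0<..t}|lborel. f s) + (t * 0) * (f 0 - f t)"
    by (intro tendsto_intros LIMSEQ_inverse_real_of_nat right_continuous_riemann_sum[OF t rc bd])
  then show ?thesis unfolding e by simp
qed

lemma compact_support_uniformly_continuous:
  fixes g :: "real \<Rightarrow> real"
  assumes c: "continuous_on UNIV g" and z: "\<And>y. y \<notin> {a..b} \<Longrightarrow> g y = 0"
  shows "uniformly_continuous_on UNIV g"
  unfolding uniformly_continuous_on_def
proof (intro allI impI)
  fix e :: real assume e: "e > 0"
  have "uniformly_continuous_on {a - 1..b + 1} g"
    by (intro compact_uniformly_continuous continuous_on_subset[OF c]) auto
  then obtain d where d: "d > 0" "\<And>u v. u \<in> {a - 1..b + 1} \<Longrightarrow> v \<in> {a - 1..b + 1} \<Longrightarrow> dist v u < d \<Longrightarrow> dist (g v) (g u) < e"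
    using e unfolding uniformly_continuous_on_def by metis
  have "dist (g v) (g u) < e" if "dist v u < min d 1" for u v
  proof (cases "u \<in> {a - 1..b + 1} \<and> v \<in> {a - 1..b + 1}")
    case True then show ?thesis using d that by simp
  next
    case False
    then have "u \<notin> {a..b}" "v \<notin> {a..b}" using that by (auto simp: dist_real_def)
    then show ?thesis using e z by simp
  qed
  then show "\<exists>d>0. \<forall>x\<in>UNIV. \<forall>x'\<in>UNIV. dist x' x < d \<longrightarrow> dist (g x') (g x) < e"
    using d(1) by (intro exI[of _ "min d 1"]) auto
qed

context scale_setting
begin

lemma Wconv_alt:
  assumes [measurable]: "g \<in> borel_measurable borel"
  shows "Wconv g x = (\<integral>\<^sup>+y. Wn (x - y) * ennreal (g y) \<partial>lborel)"
  unfolding Wconv_def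
  by (subst (2) nn_integral_real_affine[where c="-1" and t=x]) auto

lemma Wconv_mono: "g \<in> borel_measurable borel \<Longrightarrow> x \<le> x' \<Longrightarrow> Wconv g x \<le> Wconv g x'"
  unfolding Wconv_alt Wn_def by (intro nn_integral_mono mult_right_mono ennreal_leI Wt_mono) auto

text \<open>\<open>T g\<close> tends to a limit that is in general not 0, so the Feller property is
  applied to the limit minus \<open>T g\<close>; constants are preserved by the semigroup.\<close>

lemma pp_T_continuous:
  assumes g: "theta_integrable g" and t: "t \<ge> 0"
  shows "continuous_on {0..} (pp t (T g))"
proof -
  let ?I = "\<integral>y. exp (- theta * y) * g y \<partial>lborel"
  have Tm[measurable]: "T g \<in> borel_measurable borel"
    by (intro borel_measurable_continuous_onI continuous_at_imp_continuous_on ballI T_continuous[OF g])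
  have B: "0 \<le> T g y" "T g y \<le> ?I" for y using T_nonneg[OF g] T_le[OF g] by auto
  have "((\<lambda>y. ?I - T g y) \<longlongrightarrow> ?I - ?I) at_top" by (intro tendsto_intros T_tendsto[OF g])
  then have "vanishing_continuous (\<lambda>y. ?I - T g y)"
    unfolding vanishing_continuous_def
    by (auto intro!: continuous_intros continuous_at_imp_continuous_on T_continuous[OF g])
  from pp_vanishing[OF this t] have c: "continuous_on {0..} (pp t (\<lambda>y. ?I - T g y))"
    by (simp add: vanishing_continuous_def)
  have "pp t (\<lambda>y. ?I - T g y) x = ?I - pp t (T g) x" if x: "x \<ge> 0" for x
  proof -
    interpret p: prob_space "p t x" using t x by (rule prob_p)
    have "integrable (p t x) (T g)"
      by (rule integrable_p[where B="?I"]) (use t x B in auto)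
    then show ?thesis using t x by (simp add: pp_eq p.prob_space)
  qed
  then have e: "pp t (T g) x = ?I - pp t (\<lambda>y. ?I - T g y) x" if "x \<ge> 0" for x using that by simp
  show ?thesis
    by (subst continuous_on_cong[OF refl e]) (simp, intro continuous_intros c)
qed

text \<open>Accumulates the errors of \<open>Q_approx\<close> along the grid: each of the Suc n
  steps contributes e times its length, weighted by exponential moments that are bounded up to time
  t. The total is of order e, uniformly in n.\<close>

lemma K_exp_sum_le:
  assumes s: "s > k0" and t: "t \<ge> 0" and e: "e \<ge> 0"
  shows "(\<Sum>k<Suc n. K (real k * (t / real (Suc n))) (\<lambda>y. ennreal (e * (t / real (Suc n)) * exp (s * y))) x)
    \<le> ennreal (e * (t * exp (s * x + t * \<Psi> s)))"
proof -
  let ?h = "t / real (Suc n)"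
  have h: "?h \<ge> 0" using t by simp
  have "(\<Sum>k<Suc n. K (real k * ?h) (\<lambda>y. ennreal (e * ?h * exp (s * y))) x)
      \<le> (\<Sum>k<Suc n. ennreal (e * ?h) * ennreal (exp (s * x + t * \<Psi> s)))"
  proof (rule sum_mono)
    fix k assume k: "k \<in> {..<Suc n}"
    have "real k * ?h \<le> real (Suc n) * ?h" using k h by (intro mult_right_mono) auto
    moreover have "real (Suc n) * ?h = t" by simp
    ultimately have kh: "0 \<le> real k * ?h" "real k * ?h \<le> t" using mult_nonneg_nonneg[OF of_nat_0_le_iff h] by auto
    have "K (real k * ?h) (\<lambda>y. ennreal (e * ?h * exp (s * y))) x = ennreal (e * ?h) * K (real k * ?h) (\<lambda>y. ennreal (exp (s * y))) x"
    proof -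
      have "(\<lambda>y. ennreal (e * ?h * exp (s * y))) = (\<lambda>y. ennreal (e * ?h) * ennreal (exp (s * y)))"
        using e h by (simp only: ennreal_mult mult_nonneg_nonneg exp_ge_zero)
      then show ?thesis by (simp only:) (intro K_cmult kh(1), measurable)
    qed
    also have "\<dots> \<le> ennreal (e * ?h) * ennreal (exp (s * x + t * \<Psi> s))"
      by (intro mult_left_mono K_exp_le kh s) simp
    finally show "K (real k * ?h) (\<lambda>y. ennreal (e * ?h * exp (s * y))) x \<le> \<dots>" .
  qed
  also have "\<dots> = of_nat (Suc n) * (ennreal (e * ?h) * ennreal (exp (s * x + t * \<Psi> s)))" by simp
  also have "\<dots> = ennreal (real (Suc n) * (e * ?h * exp (s * x + t * \<Psi> s)))"
    using e h by (simp only: ennreal_of_nat_eq_real_of_nat ennreal_mult[symmetric] of_nat_0_le_iff mult_nonneg_nonneg exp_ge_zero)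
  also have "real (Suc n) * (e * ?h * exp (s * x + t * \<Psi> s)) = e * (t * exp (s * x + t * \<Psi> s))"
    by (simp del: of_nat_Suc)
  finally show ?thesis .
qed

section \<open>Test functions with compact support in the open half-line\<close>

context
  fixes g :: "real \<Rightarrow> real" and a b :: real
  assumes gc: "continuous_on UNIV g" and gn: "\<And>y. g y \<ge> 0" and a0: "0 < a" and g0: "\<And>y. y \<notin> {a..b} \<Longrightarrow> g y = 0"
begin

lemma g_bounded: "\<exists>B\<ge>0. \<forall>y. g y \<le> B"
proof -
  have "compact (g ` {a..b})" by (intro compact_continuous_image continuous_on_subset[OF gc]) auto
  then have "bounded (g ` {a..b})" by (rule compact_imp_bounded)
  then obtain B where B: "\<forall>v\<in>g ` {a..b}. norm v \<le> B" unfolding bounded_iff by auto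
  have "g y \<le> max B 0" for y
  proof (cases "y \<in> {a..b}")
    case True
    then have "norm (g y) \<le> B" using B by blast
    then show ?thesis by simp
  qed (simp add: g0)
  then show ?thesis by (intro exI[of _ "max B 0"]) auto
qed

lemma g_borel: "g \<in> borel_measurable borel"
  using gc by (rule borel_measurable_continuous_onI)

lemma g_theta_integrable: "theta_integrable g"
  unfolding theta_integrable_def
proof (intro conjI allI impI gn g_borel)
  show "g y = 0" if "y \<le> 0" for y using that a0 g0[of y] by simp
  have "set_integrable lborel {a..b} (\<lambda>y. exp (- theta * y) * g y)"
    by (intro borel_integrable_atLeastAtMost' continuous_intros continuous_on_subset[OF gc]) auto
  moreover have "indicator {a..b} y *\<^sub>R (exp (- theta * y) * g y) = exp (- theta * y) * g y" for y
    using g0[of y] by (auto split: split_indicator)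
  ultimately show "integrable lborel (\<lambda>y. exp (- theta * y) * g y)"
    by (simp only: set_integrable_def)
qed

text \<open>The function whose accumulated values raise \<open>T g\<close> under the conditioned
  semigroup. The support of g keeps away from 0, where \<open>W\<close> might vanish, so gam is
  again continuous with compact support.\<close>

definition gam :: "real \<Rightarrow> real" where
  "gam y = g y / Wt y"

lemma g_gam: "g y = Wt y * gam y"
  using g0[of y] a0 Wt_pos[of y] by (cases "y > 0") (auto simp: gam_def)

lemma gam_isCont: "isCont gam y"
proof (cases "y > 0")
  case True
  then show ?thesis unfolding gam_def[abs_def]
    using W_continuous_pos[OF True] Wt_pos[OF True] gc
    by (intro continuous_divide) (auto simp: continuous_on_eq_continuous_at)
next
  case False
  then have "\<forall>\<^sub>F z in nhds y. z \<in> {..<a}" using a0 by (intro eventually_nhds_in_open) auto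
  then have "\<forall>\<^sub>F z in nhds y. gam z = 0" by eventually_elim (simp add: gam_def g0)
  then show ?thesis using isCont_cong[of gam "\<lambda>_. 0" y] by simp
qed

lemma gam_props:
  shows gam_meas: "gam \<in> borel_measurable borel" and gam_nonneg: "0 \<le> gam y"
    and gam_bound: "\<exists>B. \<forall>y. gam y \<le> B" and gam_vanishing: "vanishing_continuous gam"
proof -
  have cont: "continuous_on A gam" for A by (intro continuous_at_imp_continuous_on ballI gam_isCont)
  show "gam \<in> borel_measurable borel" using cont by (rule borel_measurable_continuous_onI)
  show "0 \<le> gam y" by (simp add: gam_def gn)
  obtain B where B: "B \<ge> 0" "\<And>y. g y \<le> B" using g_bounded by blast
  have "gam y \<le> B / W a" for y
  proof (cases "y \<in> {a..b}")
    case True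
    then have "W a \<le> Wt y" using Wt_mono[of a y] a0 by simp
    then show ?thesis unfolding gam_def using B gn W_pos[OF a0] by (intro frac_le) auto
  next
    case False
    then have "gam y = 0" using g0 by (simp add: gam_def)
    then show ?thesis using B W_pos[OF a0] by simp
  qed
  then show "\<exists>B. \<forall>y. gam y \<le> B" by blast
  have "\<forall>\<^sub>F y in at_top. gam y = 0"
    using eventually_gt_at_top[of b] by eventually_elim (simp add: gam_def g0)
  then show "vanishing_continuous gam" unfolding vanishing_continuous_def
    using cont tendsto_eventually by blast
qed

text \<open>The upper bound iterates \<open>K h f \<le> P h f = f + Q h g\<close>. For the lower bound the process is killed
  only on a grid, which kills less; in the limit the path may touch \<open>0\<close>, and this is absorbed by
  starting from \<open>z > x\<close> and letting \<open>z\<close> decrease to \<open>x\<close>, using the Feller property.\<close>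

lemma potential_identity_Cc:
  assumes t: "t > 0" and x: "x > 0"
  shows "set_integrable lborel {0<..t} (\<lambda>s. pp s gam x)"
    and "pp t (T g) x = T g x + (LINT s:{0<..t}|lborel. pp s gam x)"
proof -
  obtain B where B: "\<And>y. gam y \<le> B" using gam_bound by blast
  note gam = gam_meas gam_nonneg B
  have ppB: "0 \<le> pp s gam x" "pp s gam x \<le> B" if "s \<ge> 0" for s
    using pp_bounds[OF that less_imp_le[OF x] gam_meas, of 0 B B] gam that by auto
  have rc: "continuous (at_right s) (\<lambda>s. pp s gam x)" if "s \<ge> 0" for s
    by (rule pp_right_continuous[OF gam gam_vanishing that x])
  have bd: "\<bar>pp s gam x\<bar> \<le> B" if "0 \<le> s" "s \<le> t" for s using ppB[OF that(1)] by simp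
  show "set_integrable lborel {0<..t} (\<lambda>s. pp s gam x)"
    by (rule right_continuous_riemann_sum(1)[OF t rc bd])
  define L where "L = (LINT s:{0<..t}|lborel. pp s gam x)"
  define S where "S n = (\<Sum>j<Suc n. t / real (Suc n) * pp (real j * (t / real (Suc n))) gam x)" for n
  have Slim: "S \<longlonglongrightarrow> L" unfolding S_def L_def by (rule right_continuous_left_riemann_sum[OF t rc bd])
  define s where "s = k0 + 1"
  have s: "s > k0" by (simp add: s_def)
  define D where "D = t * exp (s * x + t * \<Psi> s)"
  note th = g_theta_integrable
  note [measurable] = g_borel Wconv_measurable[OF g_borel]
  have SK: "(\<Sum>k<Suc n. K (real k * (t / real (Suc n))) (\<lambda>y. ennreal (t / real (Suc n) * g y)) x) = ennreal (Wt x * S n)" for n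
  proof -
    let ?h = "t / real (Suc n)"
    have h: "?h \<ge> 0" using t by simp
    have "(\<Sum>k<Suc n. K (real k * ?h) (\<lambda>y. ennreal (?h * g y)) x) = (\<Sum>k<Suc n. ennreal (Wt x * (?h * pp (real k * ?h) gam x)))"
    proof (rule sum.cong[OF refl])
      fix k
      have kh: "real k * ?h \<ge> 0" by (intro mult_nonneg_nonneg h) simp
      have "K (real k * ?h) (\<lambda>y. ennreal (?h * g y)) x = K (real k * ?h) (\<lambda>y. ennreal ?h * ennreal (Wt y * gam y)) x"
        unfolding g_gam[symmetric] by (rule arg_cong[where f="\<lambda>u. K (real k * ?h) u x"]) (use h gn in \<open>simp only: ennreal_mult\<close>)
      also have "\<dots> = ennreal ?h * ennreal (Wt x * pp (real k * ?h) gam x)"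
        unfolding K_pp[OF kh x gam, symmetric] using gam_meas kh by (intro K_cmult) auto
      also have "\<dots> = ennreal (Wt x * (?h * pp (real k * ?h) gam x))"
        using h ppB[OF kh] by (simp add: ennreal_mult[symmetric] mult.left_commute del: of_nat_Suc)
      finally show "K (real k * ?h) (\<lambda>y. ennreal (?h * g y)) x = \<dots>" .
    qed
    also have "\<dots> = ennreal (Wt x * S n)"
      unfolding S_def sum_distrib_left
      by (intro sum_ennreal mult_nonneg_nonneg Wt_nonneg h ppB(1) of_nat_0_le_iff)
    finally show ?thesis .
  qed
  \<comment> \<open>\<open>Q_approx\<close> wants the exponential weight split off; compact support
    keeps the remaining factor bounded and uniformly continuous.\<close>
  define G where "G y = exp (- s * y) * g y" for y
  have gG: "(\<lambda>y. exp (s * y) * G y) = g" by (simp add: G_def exp_minus field_simps)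
  have Gu: "uniformly_continuous_on UNIV G"
    unfolding G_def by (rule compact_support_uniformly_continuous[where a=a and b=b]) (auto intro!: continuous_intros gc simp: g0)
  obtain BG where BG: "\<And>y. 0 \<le> G y" "\<And>y. G y \<le> BG"
  proof -
    obtain B where B: "B \<ge> 0" "\<And>y. g y \<le> B" using g_bounded by blast
    have "G y \<le> exp 0 * B" for y
    proof (cases "y \<in> {a..b}")
      case True
      then show ?thesis unfolding G_def using B gn a0 s k0_nonneg by (intro mult_mono) auto
    qed (use B g0 in \<open>simp add: G_def\<close>)
    then show ?thesis using that[of "exp 0 * B"] gn by (simp add: G_def)
  qed
  have approx: "\<forall>\<^sub>F n in sequentially.
      (\<Sum>k<Suc n. K (real k * (t / real (Suc n))) (Q (t / real (Suc n)) g) x) \<le> ennreal (Wt x * S n) + ennreal (e * D) \<and>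
      ennreal (Wt x * S n) \<le> (\<Sum>k<Suc n. K (real k * (t / real (Suc n))) (Q (t / real (Suc n)) g) x) + ennreal (e * D)"
    if e: "e > 0" for e
  proof -
    have "\<forall>\<^sub>F n in sequentially. \<forall>z.
      Q (t / real (Suc n)) (\<lambda>y. exp (s * y) * G y) z \<le> ennreal (t / real (Suc n) * (exp (s * z) * G z)) + ennreal (e * (t / real (Suc n)) * exp (s * z)) \<and>
      ennreal (t / real (Suc n) * (exp (s * z) * G z)) \<le> Q (t / real (Suc n)) (\<lambda>y. exp (s * y) * G y) z + ennreal (e * (t / real (Suc n)) * exp (s * z))"
      by (rule eventually_compose_filterlim[OF Q_approx[OF s e Gu BG] filterlim_div_Suc_at_right[OF t]])
    then show ?thesis
    proof eventually_elim
      case (elim n)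
      let ?h = "t / real (Suc n)"
      have h: "?h \<ge> 0" using t by simp
      have kh: "real k * ?h \<ge> 0" for k :: nat by (intro mult_nonneg_nonneg h) simp
      have Qb: "Q ?h g z \<le> ennreal (?h * g z) + ennreal (e * ?h * exp (s * z))"
        "ennreal (?h * g z) \<le> Q ?h g z + ennreal (e * ?h * exp (s * z))" for z
        using elim[rule_format, of z] unfolding gG fun_cong[OF gG] by blast+
      note [measurable] = Q_measurable[OF g_borel h]
      have E: "(\<Sum>k<Suc n. K (real k * ?h) (\<lambda>y. ennreal (e * ?h * exp (s * y))) x) \<le> ennreal (e * D)"
        unfolding D_def using s t e by (intro K_exp_sum_le) auto
      have "(\<Sum>k<Suc n. K (real k * ?h) (Q ?h g) x) \<le>
        (\<Sum>k<Suc n. K (real k * ?h) (\<lambda>y. ennreal (?h * g y)) x + K (real k * ?h) (\<lambda>y. ennreal (e * ?h * exp (s * y))) x)"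
      proof (rule sum_mono)
        fix k
        have "K (real k * ?h) (Q ?h g) x \<le> K (real k * ?h) (\<lambda>y. ennreal (?h * g y) + ennreal (e * ?h * exp (s * y))) x"
          by (intro K_mono Qb kh)
        also have "\<dots> = K (real k * ?h) (\<lambda>y. ennreal (?h * g y)) x + K (real k * ?h) (\<lambda>y. ennreal (e * ?h * exp (s * y))) x"
          by (intro K_add kh) measurable
        finally show "K (real k * ?h) (Q ?h g) x \<le> \<dots>" .
      qed
      also have "\<dots> \<le> ennreal (Wt x * S n) + ennreal (e * D)"
        unfolding sum.distrib SK by (intro add_left_mono E)
      finally have 1: "(\<Sum>k<Suc n. K (real k * ?h) (Q ?h g) x) \<le> ennreal (Wt x * S n) + ennreal (e * D)" .
      have "ennreal (Wt x * S n) \<le> (\<Sum>k<Suc n. K (real k * ?h) (Q ?h g) x + K (real k * ?h) (\<lambda>y. ennreal (e * ?h * exp (s * y))) x)"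
        unfolding SK[symmetric]
      proof (rule sum_mono)
        fix k
        have "K (real k * ?h) (\<lambda>y. ennreal (?h * g y)) x \<le> K (real k * ?h) (\<lambda>y. Q ?h g y + ennreal (e * ?h * exp (s * y))) x"
          by (intro K_mono Qb kh)
        also have "\<dots> = K (real k * ?h) (Q ?h g) x + K (real k * ?h) (\<lambda>y. ennreal (e * ?h * exp (s * y))) x"
          by (intro K_add kh) measurable
        finally show "K (real k * ?h) (\<lambda>y. ennreal (?h * g y)) x \<le> \<dots>" .
      qed
      also have "\<dots> \<le> (\<Sum>k<Suc n. K (real k * ?h) (Q ?h g) x) + ennreal (e * D)"
        unfolding sum.distrib by (intro add_left_mono E)
      finally show ?case using 1 by blast
    qed
  qed
  have D: "D > 0" using t by (simp add: D_def)
  let ?I = "\<integral>y. exp (- theta * y) * g y \<partial>lborel"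
  have Tm[measurable]: "T g \<in> borel_measurable borel"
    by (intro borel_measurable_continuous_onI continuous_at_imp_continuous_on ballI T_continuous[OF th])
  have TB: "0 \<le> T g y" "T g y \<le> ?I" for y using T_nonneg[OF th] T_le[OF th] by auto
  have KT: "K t (Wconv g) z = ennreal (Wt z * pp t (T g) z)" if "z > 0" for z
    unfolding T_Wconv[OF th, symmetric, abs_def] using t by (intro K_pp[OF _ that Tm TB]) simp
  have ppT: "0 \<le> pp t (T g) z" if "z > 0" for z
    using t that by (intro pp_nonneg[OF _ _ Tm TB]) auto
  have S0: "S n \<ge> 0" for n unfolding S_def
    using t by (intro sum_nonneg mult_nonneg_nonneg ppB(1) of_nat_0_le_iff divide_nonneg_nonneg) simp_all
  have Plim: "(\<lambda>n. Wt x * S n) \<longlonglongrightarrow> Wt x * L" by (intro tendsto_intros Slim)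
  have upper: "Wt x * pp t (T g) x \<le> Wt x * T g x + Wt x * L"
  proof (rule field_le_epsilon)
    fix e :: real assume e: "e > 0"
    then have "e / D > 0" using D by simp
    from approx[OF this] have "\<forall>\<^sub>F n in sequentially. Wt x * pp t (T g) x \<le> Wt x * T g x + Wt x * S n + e"
    proof eventually_elim
      case (elim n)
      let ?h = "t / real (Suc n)"
      have h: "?h \<ge> 0" using t by simp
      have "K t (Wconv g) x = K (real (Suc n) * ?h) (Wconv g) x" by (simp del: of_nat_Suc)
      also have "\<dots> \<le> Wconv g x + (\<Sum>k<Suc n. K (real k * ?h) (Q ?h g) x)"
        by (rule K_iterate_upper[OF _ _ h x P_Wconv[OF g_borel h]]) (use Q_measurable[OF g_borel h] in measurable)
      also have "\<dots> \<le> Wconv g x + (ennreal (Wt x * S n) + ennreal (e / D * D))"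
        using elim by (intro add_left_mono) auto
      finally have "ennreal (Wt x * pp t (T g) x) \<le> ennreal (Wt x * T g x + (Wt x * S n + e))"
        unfolding KT[OF x] T_Wconv[OF th, symmetric] using D e S0[of n] TB(1)[of x]
        by (simp add: ennreal_plus)
      then show ?case using S0[of n] TB(1)[of x] e by (subst (asm) ennreal_le_iff) (auto simp: add.assoc)
    qed
    moreover have "(\<lambda>n. Wt x * T g x + Wt x * S n + e) \<longlonglongrightarrow> Wt x * T g x + Wt x * L + e"
      by (intro tendsto_intros Plim)
    ultimately show "Wt x * pp t (T g) x \<le> Wt x * T g x + Wt x * L + e"
      by (intro tendsto_lowerbound[where F=sequentially]) auto
  qed
  have lower': "Wt x * T g x + Wt x * L \<le> Wt z * pp t (T g) z" if z: "x < z" for z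
  proof (rule field_le_epsilon)
    fix e :: real assume e: "e > 0"
    then have eD: "e / D > 0" using D by simp
    \<comment> \<open>Along these indices the grids are dyadic, hence nested, and the survival
      events \<open>A j\<close> decrease to survival at all dyadic times.\<close>
    let ?r = "\<lambda>j::nat. 2^j - 1 :: nat"
    have r: "Suc (?r j) = 2^j" for j by simp
    have rmono: "strict_mono ?r" unfolding strict_mono_Suc_iff by (auto intro!: diff_less_mono)
    define h where "h j = t / 2^j" for j :: nat
    have h: "h j \<ge> 0" "real (2^j) * h j = t" for j using t by (auto simp: h_def)
    define A where "A j = grid_pos x (h j) (2^j)" for j
    have Asets[measurable]: "A j \<in> sets M" for j unfolding A_def by (intro grid_pos_sets h)
    note [measurable] = measurable_V[OF less_imp_le[OF t]]
    define E where "E j = (\<integral>\<^sup>+\<omega>. Wconv g (x + V t \<omega>) * indicator (A j) \<omega> \<partial>M)" for j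
    have "\<forall>\<^sub>F j in sequentially. ennreal (Wt x * T g x + Wt x * S (?r j)) \<le> E j + ennreal e"
      using eventually_subseq[OF rmono approx[OF eD]]
    proof eventually_elim
      case (elim j)
      have hj: "t / real (2^j) = h j" unfolding h_def by simp
      have le: "ennreal (Wt x * S (?r j)) \<le> (\<Sum>k<2^j. K (real k * h j) (Q (h j) g) x) + ennreal (e / D * D)"
        using elim unfolding r hj by blast
      have "Wconv g x + (\<Sum>k<2^j. K (real k * h j) (Q (h j) g) x) \<le> E j"
      proof -
        have "Wconv g y = 0" if "y \<le> 0" for y
          using that T_Wconv[OF th, of y] by simp
        then have "Wconv g x + (\<Sum>k<2^j. K (real k * h j) (Q (h j) g) x) \<le>
          (\<integral>\<^sup>+\<omega>. Wconv g (x + V (real (2^j) * h j) \<omega>) * indicator (grid_pos x (h j) (2^j)) \<omega> \<partial>M)"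
          by (intro grid_lower[OF Wconv_measurable[OF g_borel] Q_measurable[OF g_borel h(1)] h(1) x _ P_Wconv[OF g_borel h(1)]])
        then show ?thesis unfolding E_def A_def h(2) .
      qed
      then have "Wconv g x + ((\<Sum>k<2^j. K (real k * h j) (Q (h j) g) x) + ennreal (e / D * D)) \<le> E j + ennreal (e / D * D)"
        by (simp only: add.assoc[symmetric]) (rule add_right_mono)
      with add_left_mono[OF le, of "Wconv g x"] have "Wconv g x + ennreal (Wt x * S (?r j)) \<le> E j + ennreal (e / D * D)"
        by (rule order_trans)
      then show ?case unfolding T_Wconv[OF th, symmetric] using D S0[of "?r j"] TB(1)[of x]
        by (simp add: ennreal_plus)
    qed
    moreover have Elim: "E \<longlonglongrightarrow> (\<integral>\<^sup>+\<omega>. Wconv g (x + V t \<omega>) * indicator (\<Inter>j. A j) \<omega> \<partial>M)"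
      unfolding E_def
    proof (rule nn_integral_dominated_convergence[where w="\<lambda>\<omega>. Wconv g (x + V t \<omega>)"])
      have "decseq A"
      proof (rule decseq_SucI)
        fix j
        show "A (Suc j) \<subseteq> A j"
        proof
          fix \<omega> assume \<omega>: "\<omega> \<in> A (Suc j)"
          have "x + V (real i * h j) \<omega> > 0" if "i \<in> {1..2^j}" for i
          proof -
            have "real (2 * i) * h (Suc j) = real i * h j" by (simp add: h_def)
            moreover have "2 * i \<in> {1..2 ^ Suc j}" using that by auto
            then have "x + V (real (2 * i) * h (Suc j)) \<omega> > 0" using \<omega> unfolding A_def grid_pos_def by blast
            ultimately show ?thesis by (simp only:)
          qed
          then show "\<omega> \<in> A j" using \<omega> unfolding A_def grid_pos_def by auto
        qed
      qed
      have "(\<lambda>j. u \<omega> * indicator (A j) \<omega>) \<longlonglongrightarrow> u \<omega> * indicator (\<Inter>j. A j) \<omega>" for \<omega> and u :: "'a \<Rightarrow> ennreal"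
      proof (cases "\<omega> \<in> (\<Inter>j. A j)")
        case True then show ?thesis by (auto simp: tendsto_const)
      next
        case False
        then obtain i where i: "\<omega> \<notin> A i" by blast
        have "\<forall>\<^sub>F j in sequentially. u \<omega> * indicator (A j) \<omega> = u \<omega> * indicator (\<Inter>j. A j) \<omega>"
          using eventually_ge_at_top[of i]
        proof eventually_elim
          case (elim j)
          then have "\<omega> \<notin> A j" using i decseqD[OF \<open>decseq A\<close>] by blast
          then show ?case using False by simp
        qed
        then show ?thesis by (rule tendsto_eventually)
      qed
      then show "AE \<omega> in M. (\<lambda>j. Wconv g (x + V t \<omega>) * indicator (A j) \<omega>) \<longlonglongrightarrow> Wconv g (x + V t \<omega>) * indicator (\<Inter>j. A j) \<omega>"
        by (intro AE_I2)
      have "(\<integral>\<^sup>+\<omega>. Wconv g (x + V t \<omega>) \<partial>M) \<le> (\<integral>\<^sup>+\<omega>. ennreal (growth_const s * exp (s * x) * ?I) * ennreal (exp (s * V t \<omega>)) \<partial>M)"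
      proof (rule nn_integral_mono)
        fix \<omega>
        have "Wt (x + V t \<omega>) * T g (x + V t \<omega>) \<le> (growth_const s * exp (s * (x + V t \<omega>))) * ?I"
          using TB[of "x + V t \<omega>"] growth_const_pos[OF s] by (intro mult_mono Wt_growth[OF s]) auto
        then have "ennreal (Wt (x + V t \<omega>) * T g (x + V t \<omega>)) \<le> ennreal (growth_const s * exp (s * x) * ?I * exp (s * V t \<omega>))"
          by (intro ennreal_leI) (simp add: distrib_left exp_add ac_simps)
        then show "Wconv g (x + V t \<omega>) \<le> ennreal (growth_const s * exp (s * x) * ?I) * ennreal (exp (s * V t \<omega>))"
          unfolding T_Wconv[OF th, symmetric] by (simp add: ennreal_mult'')
      qed
      also have "\<dots> < \<infinity>"
        using V_exp_integral[of t s] t s k0_nonneg by (subst nn_integral_cmult) (auto simp: ennreal_mult_less_top)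
      finally show "(\<integral>\<^sup>+\<omega>. Wconv g (x + V t \<omega>) \<partial>M) < \<infinity>" .
    qed (auto split: split_indicator)
    have Ez: "(\<integral>\<^sup>+\<omega>. Wconv g (x + V t \<omega>) * indicator (\<Inter>j. A j) \<omega> \<partial>M) \<le> K t (Wconv g) z"
      unfolding K_def
    proof (rule nn_integral_mono)
      fix \<omega> assume \<omega>: "\<omega> \<in> space M"
      have "z + m t \<omega> > 0" if "\<omega> \<in> (\<Inter>j. A j)"
      proof -
        have "V (t * real k / 2^n) \<omega> \<ge> - x" if "k \<le> 2^n" for n k
        proof (cases "k = 0")
          case True then show ?thesis using x V_start[OF \<omega>] by simp
        next
          case False
          then have "x + V (real k * h n) \<omega> > 0"
            using \<open>\<omega> \<in> (\<Inter>j. A j)\<close> that unfolding A_def grid_pos_def by force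
          then show ?thesis by (simp add: h_def mult.commute)
        qed
        then have "\<not> m t \<omega> < - x"
          unfolding m_def using running_inf_less_iff[OF V_cadlag[OF \<omega>], of t "- x"] t by (auto simp: not_less)
        then show ?thesis using z by simp
      qed
      moreover have "Wconv g (x + V t \<omega>) \<le> Wconv g (z + V t \<omega>)" using z by (intro Wconv_mono g_borel) simp
      ultimately show "Wconv g (x + V t \<omega>) * indicator (\<Inter>j. A j) \<omega> \<le> Wconv g (z + V t \<omega>) * indicator {0<..} (z + m t \<omega>)"
        by (auto split: split_indicator)
    qed
    have "(\<lambda>j. ennreal (Wt x * T g x + Wt x * S (?r j))) \<longlonglongrightarrow> ennreal (Wt x * T g x + Wt x * L)"
      using LIMSEQ_subseq_LIMSEQ[OF Slim rmono] by (intro tendsto_ennrealI tendsto_intros) (simp add: o_def)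
    moreover have "(\<lambda>j. E j + ennreal e) \<longlonglongrightarrow> (\<integral>\<^sup>+\<omega>. Wconv g (x + V t \<omega>) * indicator (\<Inter>j. A j) \<omega> \<partial>M) + ennreal e"
      by (intro tendsto_add Elim tendsto_const) 
    ultimately have "ennreal (Wt x * T g x + Wt x * L) \<le> (\<integral>\<^sup>+\<omega>. Wconv g (x + V t \<omega>) * indicator (\<Inter>j. A j) \<omega> \<partial>M) + ennreal e"
      by (intro tendsto_le[OF sequentially_bot]) auto
    also have "\<dots> \<le> K t (Wconv g) z + ennreal e" by (intro add_right_mono Ez)
    also have "\<dots> = ennreal (Wt z * pp t (T g) z + e)"
      using x z e ppT[of z] KT[of z] by (simp add: W_nonneg)
    finally show "Wt x * T g x + Wt x * L \<le> Wt z * pp t (T g) z + e"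
      using ppT[of z] x z e by (subst (asm) ennreal_le_iff) (auto intro!: add_nonneg_nonneg mult_nonneg_nonneg simp: W_nonneg)
  qed
  have "Wt x * T g x + Wt x * L \<le> Wt x * pp t (T g) x"
  proof -
    have "continuous_on {0<..} (\<lambda>z. Wt z * pp t (T g) z)"
      using W_continuous_pos t
      by (intro continuous_intros continuous_on_subset[OF pp_T_continuous[OF th]] continuous_at_imp_continuous_on) auto
    then have "isCont (\<lambda>z. Wt z * pp t (T g) z) x" using x by (simp add: continuous_on_eq_continuous_at)
    then have "((\<lambda>z. Wt z * pp t (T g) z) \<longlongrightarrow> Wt x * pp t (T g) x) (at_right x)"
      unfolding isCont_def by (rule filterlim_mono[OF _ order_refl at_le]) simp
    then show ?thesis
      by (rule tendsto_lowerbound)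
         (use lower' in \<open>auto simp: eventually_at_right_field intro!: exI[of _ "x + 1"]\<close>)
  qed
  with upper have "Wt x * pp t (T g) x = Wt x * (T g x + L)" by (simp add: distrib_left)
  then show "pp t (T g) x = T g x + (LINT s:{0<..t}|lborel. pp s gam x)"
    using Wt_pos[OF x] by (simp add: L_def)
qed

end

end

section \<open>The conditioned semigroup acting on \<open>F k\<close>\<close>

context scale_setting
begin

text \<open>A continuous piecewise linear bump carried by \<open>{1 / Suc n..Suc n}\<close> and
  tending to 1 at every positive point; it brings \<open>gF k\<close> within reach of
  \<open>potential_identity_Cc\<close>.\<close>

definition cutoff :: "nat \<Rightarrow> real \<Rightarrow> real" where
  "cutoff n y = max 0 (min 1 (min (real (Suc n) * y - 1) (real (Suc n) - y)))"

lemma cutoff_bounds: "0 \<le> cutoff n y" "cutoff n y \<le> 1"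
  by (auto simp: cutoff_def)

lemma cutoff_zero: "y \<notin> {1 / real (Suc n)..real (Suc n)} \<Longrightarrow> cutoff n y = 0"
proof -
  assume "y \<notin> {1 / real (Suc n)..real (Suc n)}"
  then consider "y < 1 / real (Suc n)" | "y > real (Suc n)" by fastforce
  then show ?thesis
  proof cases
    case 1
    then have "real (Suc n) * y < 1" by (simp add: pos_less_divide_eq mult.commute del: of_nat_Suc)
    then show ?thesis by (simp add: cutoff_def)
  qed (simp add: cutoff_def)
qed

lemma cutoff_continuous [continuous_intros]: "continuous_on A (cutoff n)"
  unfolding cutoff_def by (intro continuous_intros)

lemma cutoff_measurable [measurable]: "cutoff n \<in> borel_measurable borel"
  by (intro borel_measurable_continuous_onI continuous_intros)

lemma cutoff_tendsto: "y > 0 \<Longrightarrow> (\<lambda>n. cutoff n y) \<longlonglongrightarrow> 1"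
proof -
  assume y: "y > 0"
  obtain N :: nat where N: "real N > 2 / y + y + 1" using reals_Archimedean2 by blast
  have "cutoff n y = 1" if "n \<ge> N" for n
  proof -
    have n: "real (Suc n) > 2 / y + y + 1" using N that by simp
    then have "real (Suc n) * y \<ge> 2 / y * y" using y by (intro mult_right_mono) auto
    then have "real (Suc n) * y \<ge> 2" using y by simp
    moreover have "real (Suc n) - y \<ge> 1" using n y by (smt (verit) divide_nonneg_nonneg)
    ultimately show ?thesis by (simp add: cutoff_def)
  qed
  then have "\<forall>\<^sub>F n in sequentially. cutoff n y = 1" by (auto simp: eventually_sequentially)
  then show ?thesis by (rule tendsto_eventually)
qed

text \<open>The absolute value makes \<open>gamF k\<close> bounded on the whole line; the semigroup lives on \<open>[0,\<infinity>[\<close>.\<close>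

definition gamF :: "nat \<Rightarrow> real \<Rightarrow> real" where
  "gamF k y = exp (- \<bar>y\<bar>) * F k y"

lemma gamF_measurable [measurable]: "gamF k \<in> borel_measurable borel"
  unfolding gamF_def[abs_def] by measurable

lemma gamF_bounds: "0 \<le> gamF k y" "gamF k y \<le> c k"
proof -
  show "0 \<le> gamF k y" by (simp add: gamF_def F_nonneg)
  have "gamF k y \<le> 1 * c k"
    unfolding gamF_def using F_nonneg F_le by (intro mult_mono) auto
  then show "gamF k y \<le> c k" by simp
qed

lemma gF_gamF: "gF k y = Wt y * gamF k y"
  by (cases "y > 0") (auto simp: gF_def gamF_def)

lemma gamF_vanishing: "vanishing_continuous (gamF k)"
  unfolding vanishing_continuous_def
proof
  have "continuous_on UNIV (F k)" by (intro continuous_at_imp_continuous_on ballI F_continuous)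
  then show "continuous_on {0..} (gamF k)"
    unfolding gamF_def by (intro continuous_intros) (auto elim: continuous_on_subset)
  have "((\<lambda>y::real. exp (- \<bar>y\<bar>)) \<longlongrightarrow> 0) at_top"
    by (intro filterlim_compose[OF exp_at_bot] filterlim_compose[OF filterlim_uminus_at_bot_at_top]
        filterlim_abs_real)
  from tendsto_mult[OF this F_tendsto[of k]] show "(gamF k \<longlongrightarrow> 0) at_top"
    by (simp add: gamF_def[abs_def])
qed

definition gcut :: "nat \<Rightarrow> nat \<Rightarrow> real \<Rightarrow> real" where
  "gcut k n y = gF k y * cutoff n y"

lemma gcut_nonneg: "0 \<le> gcut k n y"
  by (simp add: gcut_def gF_gamF gamF_bounds cutoff_bounds)

lemma gcut_zero: "y \<notin> {1 / real (Suc n)..real (Suc n)} \<Longrightarrow> gcut k n y = 0"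
  by (simp add: gcut_def cutoff_zero)

lemma gcut_continuous: "continuous_on UNIV (gcut k n)"
proof (intro continuous_at_imp_continuous_on ballI)
  fix y :: real
  show "isCont (gcut k n) y"
  proof (cases "y > 0")
    case True
    have "isCont (cutoff n) y"
      using cutoff_continuous[of UNIV n] by (simp add: continuous_on_eq_continuous_at)
    then show ?thesis
      unfolding gcut_def[abs_def] gF_def using W_continuous_pos[OF True] F_continuous
      by (intro continuous_intros) auto
  next
    case False
    have "(0::real) < 1 / real (Suc n)" by simp
    then have "y < 1 / real (Suc n)" using False by linarith
    then have "\<forall>\<^sub>F z in nhds y. z \<in> {..<1 / real (Suc n)}"
      by (intro eventually_nhds_in_open) auto
    then have "\<forall>\<^sub>F z in nhds y. gcut k n z = 0"
      by eventually_elim (rule gcut_zero, simp)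
    then show ?thesis using isCont_cong[of "gcut k n" "\<lambda>_. 0" y] by simp
  qed
qed

lemma gcut_context:
  shows "continuous_on UNIV (gcut k n)" "\<And>y. 0 \<le> gcut k n y" "0 < 1 / real (Suc n)"
    "\<And>y. y \<notin> {1 / real (Suc n)..real (Suc n)} \<Longrightarrow> gcut k n y = 0"
  by (rule gcut_continuous, rule gcut_nonneg, simp, rule gcut_zero)

lemma gam_gcut: "gam (gcut k n) y = gamF k y * cutoff n y"
proof (cases "y > 0")
  case True
  then show ?thesis
    using Wt_pos[OF True] by (simp only: gam_def[OF gcut_context]) (simp add: gcut_def gF_gamF)
next
  case False
  then have "y \<notin> {1 / real (Suc n)..real (Suc n)}"
    using less_le_trans[of 0 "1 / real (Suc n)" y] by auto
  then show ?thesis using cutoff_zero[of y n] by (simp only: gam_def[OF gcut_context]) (simp add: gcut_def)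
qed

lemma gcut_theta_integrable: "theta_integrable (gcut k n)"
  by (rule g_theta_integrable[OF gcut_context])

lemma T_gcut_le: "T (gcut k n) y \<le> F (Suc k) y"
  unfolding T_def F_Suc
proof (rule integral_mono[OF R_g_integrable R_g_integrable])
  show "theta_integrable (gcut k n)" "theta_integrable (gF k)"
    by (rule gcut_theta_integrable, rule gF_theta_integrable)
  fix z
  have "gF k z * cutoff n z \<le> gF k z * 1"
    by (intro mult_left_mono cutoff_bounds) (simp add: gF_gamF gamF_bounds)
  then show "R z y * gcut k n z \<le> R z y * gF k z"
    unfolding gcut_def by (intro mult_left_mono) auto
qed

lemma T_gcut_tendsto: "(\<lambda>n. T (gcut k n) y) \<longlonglongrightarrow> F (Suc k) y"
  unfolding T_def F_Suc
proof (rule integral_dominated_convergence[where w="\<lambda>z. R z y * gF k z"])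
  show "(\<lambda>z. R z y * gF k z) \<in> borel_measurable lborel" "\<And>n. (\<lambda>z. R z y * gcut k n z) \<in> borel_measurable lborel"
    using R_g_integrable[OF gF_theta_integrable] R_g_integrable[OF gcut_theta_integrable] by blast+
  show "integrable lborel (\<lambda>z. R z y * gF k z)" by (rule R_g_integrable[OF gF_theta_integrable])
  have "(\<lambda>n. R z y * gcut k n z) \<longlonglongrightarrow> R z y * gF k z" for z
  proof (cases "z > 0")
    case True
    then have "(\<lambda>n. R z y * (gF k z * cutoff n z)) \<longlonglongrightarrow> R z y * (gF k z * 1)"
      by (intro tendsto_intros cutoff_tendsto)
    then show ?thesis by (simp add: gcut_def)
  qed (simp add: gcut_def gF_gamF)
  then show "AE z in lborel. (\<lambda>n. R z y * gcut k n z) \<longlonglongrightarrow> R z y * gF k z" by simp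
  have "norm (R z y * gcut k n z) \<le> R z y * gF k z" for z n
  proof -
    have "gF k z * cutoff n z \<le> gF k z * 1"
      by (intro mult_left_mono cutoff_bounds) (simp add: gF_gamF gamF_bounds)
    then show ?thesis using gcut_nonneg[of k n z] by (simp add: abs_mult) (simp add: gcut_def mult_left_mono)
  qed
  then show "\<And>n. AE z in lborel. norm (R z y * gcut k n z) \<le> R z y * gF k z" by simp
qed

lemma measurable_p_eq: "t \<ge> 0 \<Longrightarrow> x \<ge> 0 \<Longrightarrow> borel_measurable (p t x) = borel_measurable borel"
  by (intro measurable_cong_sets sets_p) auto

lemma pp_dominated:
  assumes t: "t \<ge> 0" and x: "x \<ge> 0"
    and [measurable]: "\<And>n. f n \<in> borel_measurable borel" "f' \<in> borel_measurable borel"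
    and lim: "AE y in p t x. (\<lambda>n. f n y) \<longlonglongrightarrow> f' y" and bd: "\<And>n y. \<bar>f n y\<bar> \<le> B"
  shows "(\<lambda>n::nat. pp t (f n) x) \<longlonglongrightarrow> pp t f' x"
proof -
  interpret p: prob_space "p t x" using t x by (rule prob_p)
  show ?thesis
    unfolding pp_eq[OF t x assms(3)] pp_eq[OF t x assms(4)]
    by (rule integral_dominated_convergence[where w="\<lambda>_. B"])
       (use lim bd in \<open>auto simp: measurable_p_eq[OF t x]\<close>)
qed

text \<open>Dominated convergence along the cutoffs, once under the kernels and once in the time
  integral; the dominating constants are \<open>c k\<close> and \<open>c (Suc k)\<close>.\<close>

lemma potential_identity_pos:
  assumes t: "t > 0" and x: "x > 0"
  shows "set_integrable lborel {0<..t} (\<lambda>s. pp s (gamF k) x) \<and>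
    pp t (F (Suc k)) x = F (Suc k) x + (LINT s:{0<..t}|lborel. pp s (gamF k) x)"
proof -
  define f where "f n s = indicator {0<..t} s *\<^sub>R pp s (gam (gcut k n)) x" for n s
  have gm[measurable]: "gam (gcut k n) \<in> borel_measurable borel" for n
    by (rule gam_meas[OF gcut_context])
  have f_int: "integrable lborel (f n)" for n
    using potential_identity_Cc(1)[OF gcut_context t x] unfolding f_def set_integrable_def .
  have e: "pp t (T (gcut k n)) x = T (gcut k n) x + integral\<^sup>L lborel (f n)" for n
    using potential_identity_Cc(2)[OF gcut_context t x] unfolding f_def set_lebesgue_integral_def .
  have g_bd: "\<bar>gam (gcut k n) y\<bar> \<le> c k" for n y
  proof -
    have "gamF k y * cutoff n y \<le> c k * 1"
      using gamF_bounds cutoff_bounds c_pos[of k] by (intro mult_mono) auto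
    then show ?thesis unfolding gam_gcut using gamF_bounds[of k y] cutoff_bounds[of n y] by simp
  qed
  have pp_bd: "\<bar>pp s (gam (gcut k n)) x\<bar> \<le> c k" if "s \<ge> 0" for n s
    using pp_bounds[OF that less_imp_le[OF x] gm, of "- c k" n "c k" "c k"] g_bd[of n] by (simp add: abs_le_iff minus_le_iff)
  have lim: "(\<lambda>n. pp s (gam (gcut k n)) x) \<longlonglongrightarrow> pp s (gamF k) x" if s: "s \<ge> 0" for s
  proof (rule pp_dominated[OF s less_imp_le[OF x] gm gamF_measurable _ g_bd])
    show "AE y in p s x. (\<lambda>n. gam (gcut k n) y) \<longlonglongrightarrow> gamF k y"
      using AE_p_pos[OF s x]
    proof eventually_elim
      case (elim y)
      then have "(\<lambda>n. gamF k y * cutoff n y) \<longlonglongrightarrow> gamF k y * 1"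
        by (intro tendsto_intros cutoff_tendsto)
      then show ?case by (simp add: gam_gcut)
    qed
  qed
  let ?f = "\<lambda>s. indicator {0<..t} s *\<^sub>R pp s (gamF k) x"
  have flim: "(\<lambda>n. f n s) \<longlonglongrightarrow> ?f s" for s
    unfolding f_def using lim[of s] by (cases "s \<in> {0<..t}") auto
  have fm: "f n \<in> borel_measurable lborel" for n using f_int[of n] by auto
  have fm': "?f \<in> borel_measurable lborel"
    by (rule borel_measurable_LIMSEQ_real[OF flim fm])
  have w: "integrable lborel (\<lambda>s. indicator {0<..t} s *\<^sub>R c k)"
    using t by (intro integrable_scaleR_left) (simp add: emeasure_lborel_Ioc)
  have fb: "norm (f n s) \<le> indicator {0<..t} s *\<^sub>R c k" for n s
    unfolding f_def using pp_bd[of s n] by (auto split: split_indicator)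
  have I: "integrable lborel ?f"
    by (rule integrable_dominated_convergence[OF fm' fm w AE_I2[OF flim] AE_I2[OF fb]])
  have L: "(\<lambda>n. integral\<^sup>L lborel (f n)) \<longlonglongrightarrow> integral\<^sup>L lborel ?f"
    by (rule integral_dominated_convergence[OF fm' fm w AE_I2[OF flim] AE_I2[OF fb]])
  have Tm: "T (gcut k n) \<in> borel_measurable borel" for n
    by (intro borel_measurable_continuous_onI continuous_at_imp_continuous_on ballI T_continuous gcut_theta_integrable)
  have "(\<lambda>n. pp t (T (gcut k n)) x) \<longlonglongrightarrow> pp t (F (Suc k)) x"
  proof (rule pp_dominated[OF less_imp_le[OF t] less_imp_le[OF x] Tm F_measurable])
    show "\<bar>T (gcut k n) y\<bar> \<le> c (Suc k)" for n y
      using T_nonneg[OF gcut_theta_integrable[of k n], of y] T_gcut_le[of k n y] F_le[of "Suc k" y] by linarith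
  qed (use T_gcut_tendsto in simp)
  moreover have "(\<lambda>n. T (gcut k n) x + integral\<^sup>L lborel (f n)) \<longlonglongrightarrow> F (Suc k) x + integral\<^sup>L lborel ?f"
    by (intro tendsto_intros T_gcut_tendsto L)
  ultimately have "pp t (F (Suc k)) x = F (Suc k) x + integral\<^sup>L lborel ?f"
    unfolding e by (rule LIMSEQ_unique)
  then show ?thesis using I by (simp add: set_integrable_def set_lebesgue_integral_def)
qed

lemma pp_F_continuous:
  assumes t: "t \<ge> 0"
  shows "continuous_on {0..} (pp t (F (Suc k)))"
  unfolding F_Suc by (rule pp_T_continuous[OF gF_theta_integrable t])

text \<open>The killed process describes the kernels only for x > 0. The starting point 0, which is
  the one that matters for the process, is reached along x = 1 / Suc n by the Feller continuity of
  \<open>pp\<close>.\<close>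

lemma potential_identity:
  assumes t: "t > 0" and x: "x \<ge> 0"
  shows "set_integrable lborel {0<..t} (\<lambda>s. pp s (gamF k) x) \<and>
    pp t (F (Suc k)) x = F (Suc k) x + (LINT s:{0<..t}|lborel. pp s (gamF k) x)"
proof (cases "x > 0")
  case True then show ?thesis by (rule potential_identity_pos[OF t])
next
  case False
  then have x0: "x = 0" using x by simp
  define z where "z n = inverse (real (Suc n))" for n
  have z: "z n > 0" "z n \<ge> 0" for n by (auto simp: z_def)
  have zlim: "z \<longlonglongrightarrow> 0" unfolding z_def by (rule LIMSEQ_inverse_real_of_nat)
  have at0: "(\<lambda>n. u (z n)) \<longlonglongrightarrow> u 0" if "continuous_on {0..} u" for u :: "real \<Rightarrow> real"
    using that zlim z by (intro continuous_on_tendsto_compose[OF that zlim]) auto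
  define f where "f n s = indicator {0<..t} s *\<^sub>R pp s (gamF k) (z n)" for n s
  let ?f = "\<lambda>s. indicator {0<..t} s *\<^sub>R pp s (gamF k) 0"
  have f_int: "integrable lborel (f n)" and
    e: "pp t (F (Suc k)) (z n) = F (Suc k) (z n) + integral\<^sup>L lborel (f n)" for n
    using potential_identity_pos[OF t z(1)[of n], of k] unfolding f_def set_integrable_def set_lebesgue_integral_def by auto
  have flim: "(\<lambda>n. f n s) \<longlonglongrightarrow> ?f s" for s
  proof (cases "s \<in> {0<..t}")
    case True
    then have "continuous_on {0..} (pp s (gamF k))"
      using pp_vanishing[OF gamF_vanishing, of s k] by (simp add: vanishing_continuous_def)
    from at0[OF this] show ?thesis using True by (simp add: f_def)
  qed (simp add: f_def)
  have pp_bd: "\<bar>pp s (gamF k) y\<bar> \<le> c k" if "s \<ge> 0" "y \<ge> 0" for s y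
    using pp_bounds[OF that gamF_measurable, of 0 k "c k" "c k"] gamF_bounds[of k] by (simp add: abs_le_iff)
  have fm: "f n \<in> borel_measurable lborel" for n using f_int[of n] by auto
  have fm': "?f \<in> borel_measurable lborel"
    by (rule borel_measurable_LIMSEQ_real[OF flim fm])
  have w: "integrable lborel (\<lambda>s. indicator {0<..t} s *\<^sub>R c k)"
    using t by (intro integrable_scaleR_left) (simp add: emeasure_lborel_Ioc)
  have fb: "norm (f n s) \<le> indicator {0<..t} s *\<^sub>R c k" for n s
    unfolding f_def using pp_bd[of s "z n"] z(2) by (auto split: split_indicator)
  have I: "integrable lborel ?f"
    by (rule integrable_dominated_convergence[OF fm' fm w AE_I2[OF flim] AE_I2[OF fb]])
  have L: "(\<lambda>n. integral\<^sup>L lborel (f n)) \<longlonglongrightarrow> integral\<^sup>L lborel ?f"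
    by (rule integral_dominated_convergence[OF fm' fm w AE_I2[OF flim] AE_I2[OF fb]])
  have "(\<lambda>n. pp t (F (Suc k)) (z n)) \<longlonglongrightarrow> pp t (F (Suc k)) 0"
    using t by (intro at0 pp_F_continuous) simp
  moreover have "(\<lambda>n. F (Suc k) (z n) + integral\<^sup>L lborel (f n)) \<longlonglongrightarrow> F (Suc k) 0 + integral\<^sup>L lborel ?f"
    by (intro tendsto_add L at0 continuous_at_imp_continuous_on ballI F_continuous)
  ultimately have "pp t (F (Suc k)) 0 = F (Suc k) 0 + integral\<^sup>L lborel ?f"
    unfolding e by (rule LIMSEQ_unique)
  then show ?thesis using I x0 by (simp add: set_integrable_def set_lebesgue_integral_def)
qed

text \<open>By Feller convergence, \<open>pp s (gamF k)\<close> stays within e of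
  \<open>gamF k\<close> throughout a short time interval, uniformly in x; the potential identity
  integrates this.\<close>

lemma pp_F_step:
  assumes e: "e > 0"
  shows "\<forall>\<^sub>F h in at_right 0. \<forall>x\<ge>0. \<bar>pp h (F (Suc k)) x - F (Suc k) x - h * gamF k x\<bar> \<le> e * h"
proof -
  have "\<forall>\<^sub>F h in at_right 0. \<forall>y\<in>{0..}. dist (pp h (gamF k) y) (gamF k y) < e"
    using pp_uniform[OF gamF_vanishing] e by (intro uniform_limitD) auto
  then obtain d where d: "d > 0" "\<And>h y. 0 < h \<Longrightarrow> h < d \<Longrightarrow> y \<ge> 0 \<Longrightarrow> dist (pp h (gamF k) y) (gamF k y) < e"
    unfolding eventually_at_right_field by auto
  have "\<bar>pp h (F (Suc k)) x - F (Suc k) x - h * gamF k x\<bar> \<le> e * h" if h: "0 < h" "h < d" and x: "x \<ge> 0" for h x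
  proof -
    have si: "set_integrable lborel {0<..h} (\<lambda>s. pp s (gamF k) x)"
      and eq: "pp h (F (Suc k)) x = F (Suc k) x + (LINT s:{0<..h}|lborel. pp s (gamF k) x)"
      using potential_identity[OF h(1) x, of k] by auto
    have ci: "set_integrable lborel {0<..h} (\<lambda>s. r)" for r :: real
      unfolding set_integrable_def using h by (intro integrable_scaleR_left) (simp add: emeasure_lborel_Ioc)
    have cv: "(LINT s:{0<..h}|lborel. r) = h * r" for r :: real
      using h by (simp add: set_lebesgue_integral_def emeasure_lborel_Ioc)
    have b: "gamF k x - e \<le> pp s (gamF k) x" "pp s (gamF k) x \<le> gamF k x + e" if "s \<in> {0<..h}" for s
      using d(2)[of s x] that h x by (auto simp: dist_real_def abs_le_iff)
    have "(LINT s:{0<..h}|lborel. pp s (gamF k) x) \<le> (LINT s:{0<..h}|lborel. gamF k x + e)"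
      by (intro set_integral_mono si ci b)
    moreover have "(LINT s:{0<..h}|lborel. gamF k x - e) \<le> (LINT s:{0<..h}|lborel. pp s (gamF k) x)"
      by (intro set_integral_mono si ci b)
    ultimately show ?thesis unfolding eq cv by (simp add: abs_le_iff algebra_simps)
  qed
  then show ?thesis unfolding eventually_at_right_field using d(1) by (intro exI[of _ d]) auto
qed

lemma pp_F_0: "t \<ge> 0 \<Longrightarrow> x \<ge> 0 \<Longrightarrow> pp t (F 0) x = 1"
proof -
  assume t: "t \<ge> 0" and x: "x \<ge> 0"
  interpret p: prob_space "p t x" using t x by (rule prob_p)
  show ?thesis using t x by (simp add: pp_eq p.prob_space)
qed

section \<open>Partial sums of the power series and their one-step expansion\<close>

definition Fsum :: "real \<Rightarrow> nat \<Rightarrow> real \<Rightarrow> real" where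
  "Fsum l n x = (\<Sum>k\<le>n. l ^ k * F k x)"

lemma Fsum_measurable [measurable]: "Fsum l n \<in> borel_measurable borel"
  unfolding Fsum_def[abs_def] by measurable

lemma Fsum_nonneg: "l \<ge> 0 \<Longrightarrow> 0 \<le> Fsum l n x"
  unfolding Fsum_def by (intro sum_nonneg mult_nonneg_nonneg F_nonneg) auto

lemma Fsum_le: "l \<ge> 0 \<Longrightarrow> Fsum l n x \<le> (\<Sum>k\<le>n. l ^ k * c k)"
  unfolding Fsum_def by (intro sum_mono mult_left_mono F_le) auto

lemma Fsum_tendsto: "(Fsum l n \<longlongrightarrow> (\<Sum>k\<le>n. l ^ k * c k)) at_top"
  unfolding Fsum_def[abs_def] by (intro tendsto_intros F_tendsto)

lemma Fsum_0: "Fsum l n 0 = 1"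
proof -
  have "Fsum l n 0 = (\<Sum>k\<le>n. if k = 0 then 1 else 0)"
    unfolding Fsum_def
  proof (rule sum.cong[OF refl])
    fix k show "l ^ k * F k 0 = (if k = 0 then 1 else 0)"
      using F_at_0[of "k - 1"] by (cases k) auto
  qed
  then show ?thesis by simp
qed

lemma pp_Fsum:
  assumes t: "t \<ge> 0" and x: "x \<ge> 0"
  shows "pp t (Fsum l n) x = (\<Sum>k\<le>n. l ^ k * pp t (F k) x)"
proof -
  have i: "integrable (p t x) (F k)" for k
    by (rule integrable_p[where B="c k"]) (use t x F_le F_nonneg in \<open>auto simp: abs_le_iff intro: order_trans[OF _ F_nonneg]\<close>)
  have "pp t (Fsum l n) x = (\<Sum>k\<le>n. l ^ k * (\<integral>y. F k y \<partial>p t x))"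
    unfolding pp_eq[OF t x Fsum_measurable] Fsum_def by (simp add: i)
  then show ?thesis using t x by (simp add: pp_eq)
qed

text \<open>To first order \<open>F (Suc k)\<close> grows at rate \<open>exp (- x) * F k\<close>, so
  \<open>Fsum\<close> grows at rate \<open>l * exp (- x)\<close> times itself except for the top
  term. This missing term is the defect that separates a supermartingale from a martingale.\<close>

lemma pp_Fsum_step:
  assumes e: "e > 0" and l: "l \<ge> 0"
  shows "\<forall>\<^sub>F h in at_right 0. \<forall>x\<ge>0.
    \<bar>pp h (Fsum l n) x - Fsum l n x - h * (l * exp (- x)) * (Fsum l n x - l ^ n * F n x)\<bar> \<le> e * h"
proof -
  define e' where "e' = e / (\<Sum>k\<le>n. l ^ Suc k + 1)"
  have S: "(\<Sum>k\<le>n. l ^ Suc k + 1) > 0" using l by (intro sum_pos) (auto simp: add_nonneg_pos)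
  then have e': "e' > 0" using e by (simp add: e'_def)
  have "\<forall>\<^sub>F h in at_right 0. \<forall>k\<in>{..n}. \<forall>x\<ge>0. \<bar>pp h (F (Suc k)) x - F (Suc k) x - h * gamF k x\<bar> \<le> e' * h"
    by (intro eventually_ball_finite ballI pp_F_step e') auto
  moreover have "\<forall>\<^sub>F h in at_right 0. (0::real) < h" by (simp add: eventually_at_right_less)
  ultimately show ?thesis
  proof eventually_elim
    case (elim h)
    show ?case
    proof (intro allI impI)
      fix x :: real assume x: "x \<ge> 0"
      let ?d = "\<lambda>k. pp h (F (Suc k)) x - F (Suc k) x - h * gamF k x"
      have sp: "(\<Sum>k\<le>n. u k) = u 0 + (\<Sum>k<n. u (Suc k))" for u :: "nat \<Rightarrow> real"
        by (cases n) (simp_all add: sum.atMost_Suc_shift lessThan_Suc_atMost del: sum.atMost_Suc)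
      have a: "Fsum l n x - l ^ n * F n x = (\<Sum>k<n. l ^ k * F k x)"
        unfolding Fsum_def by (simp add: lessThan_Suc_atMost[symmetric])
      have "h * (l * exp (- x)) * (\<Sum>k<n. l ^ k * F k x) = (\<Sum>k<n. l ^ Suc k * (h * gamF k x))"
        using x by (simp add: sum_distrib_left gamF_def ac_simps)
      moreover have "pp h (Fsum l n) x = 1 + (\<Sum>k<n. l ^ Suc k * pp h (F (Suc k)) x)"
        using elim x by (subst pp_Fsum) (simp_all add: sp pp_F_0 del: F.simps)
      moreover have "Fsum l n x = 1 + (\<Sum>k<n. l ^ Suc k * F (Suc k) x)"
        unfolding Fsum_def sp by simp
      ultimately have "pp h (Fsum l n) x - Fsum l n x - h * (l * exp (- x)) * (Fsum l n x - l ^ n * F n x) =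
          (\<Sum>k<n. l ^ Suc k * ?d k)"
        unfolding a by (simp only: right_diff_distrib sum_subtractf)
      also have "\<bar>\<dots>\<bar> \<le> (\<Sum>k<n. (l ^ Suc k + 1) * (e' * h))"
      proof (rule sum_abs[THEN order_trans], rule sum_mono)
        fix k assume "k \<in> {..<n}"
        then have "\<bar>?d k\<bar> \<le> e' * h" using elim x by auto
        then have "l ^ Suc k * \<bar>?d k\<bar> \<le> (l ^ Suc k + 1) * (e' * h)"
          using l elim by (intro mult_mono) auto
        then show "\<bar>l ^ Suc k * ?d k\<bar> \<le> (l ^ Suc k + 1) * (e' * h)"
          using l by (simp only: abs_mult abs_of_nonneg zero_le_power)
      qed
      also have "\<dots> \<le> (\<Sum>k\<le>n. (l ^ Suc k + 1) * (e' * h))"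
        using l e' elim by (intro sum_mono2) (auto intro!: mult_nonneg_nonneg add_nonneg_nonneg)
      also have "\<dots> = e * h"
        unfolding sum_distrib_right[symmetric] using S by (simp add: e'_def)
      finally show "\<bar>pp h (Fsum l n) x - Fsum l n x - h * (l * exp (- x)) * (Fsum l n x - l ^ n * F n x)\<bar> \<le> e * h" .
    qed
  qed
qed

end

section \<open>The Markov property of the conditioned process\<close>

locale conditioned_setting = scale_setting M V \<Psi> W p k0
  for M :: "'a measure" and V :: "real \<Rightarrow> 'a \<Rightarrow> real" and \<Psi> W p k0 +
  fixes N :: "'b measure" and X :: "real \<Rightarrow> 'b \<Rightarrow> real"
  assumes markov: "markov_process N X {0..} p 0"
    and X_cadlag: "\<omega> \<in> space N \<Longrightarrow> cadlag (\<lambda>t. X t \<omega>)"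
begin

lemma X_props:
  shows prob_N: "prob_space N" and X_measurable: "t \<ge> 0 \<Longrightarrow> X t \<in> borel_measurable N"
    and X_nonneg: "t \<ge> 0 \<Longrightarrow> \<omega> \<in> space N \<Longrightarrow> X t \<omega> \<ge> 0"
    and X_start: "\<omega> \<in> space N \<Longrightarrow> X 0 \<omega> = 0"
    and X_markov: "s \<ge> 0 \<Longrightarrow> t \<ge> 0 \<Longrightarrow> B \<in> sets borel \<Longrightarrow> AE \<omega> in N.
        real_cond_exp N (natural_filtration N X s) (\<lambda>\<omega>. indicator B (X (s + t) \<omega>)) \<omega>
          = measure (p t (X s \<omega>)) B"
  using markov unfolding markov_process_def by auto

interpretation N: prob_space N by (rule prob_N)

lemma natural_filtration_generator:
  "(\<Union>u\<in>{0..s}. {X u -` B \<inter> space N | B. B \<in> sets borel}) \<subseteq> Pow (space N)" by auto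

lemma space_natural_filtration: "space (natural_filtration N X s) = space N"
  unfolding natural_filtration_def using natural_filtration_generator by (rule space_measure_of)

lemma natural_filtration_subalgebra: "subalgebra N (natural_filtration N X s)"
  unfolding subalgebra_def
proof
  show "space (natural_filtration N X s) = space N" by (rule space_natural_filtration)
  show "sets (natural_filtration N X s) \<subseteq> sets N"
    unfolding natural_filtration_def sets_measure_of[OF natural_filtration_generator]
  proof (rule sets.sigma_sets_subset, rule UN_least, rule subsetI)
    fix u A assume u: "u \<in> {0..s}" and "A \<in> {X u -` B \<inter> space N | B. B \<in> sets borel}"
    then obtain B where "A = X u -` B \<inter> space N" "B \<in> sets borel" by blast
    then show "A \<in> sets N" using u by (simp add: measurable_sets[OF X_measurable])
  qed
qed

lemma X_natural_filtration:
  assumes "0 \<le> u" "u \<le> s"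
  shows "X u \<in> borel_measurable (natural_filtration N X s)"
proof (rule measurableI)
  fix A :: "real set" assume "A \<in> sets borel"
  then show "X u -` A \<inter> space (natural_filtration N X s) \<in> sets (natural_filtration N X s)"
    unfolding space_natural_filtration
    unfolding natural_filtration_def sets_measure_of[OF natural_filtration_generator]
    using assms by (intro sigma_sets.Basic UN_I[of u]) auto
qed simp

text \<open>The Markov property is given for indicators, so f is approximated uniformly by step
  functions g. Continuity of \<open>pp h f\<close> on \<open>{0..}\<close> ensures that
  \<open>pp h f (X s)\<close> is measurable.\<close>

lemma markov_expectation:
  assumes s: "s \<ge> 0" and h: "h \<ge> 0" and f[measurable]: "f \<in> borel_measurable borel"
    and B: "\<And>y. 0 \<le> f y" "\<And>y. f y \<le> B" and cont: "continuous_on {0..} (pp h f)"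
    and Y: "Y \<in> borel_measurable (natural_filtration N X s)" and Y1: "\<And>\<omega>. \<bar>Y \<omega>\<bar> \<le> 1"
  shows "(\<integral>\<omega>. Y \<omega> * f (X (s + h) \<omega>) \<partial>N) = (\<integral>\<omega>. Y \<omega> * pp h f (X s \<omega>) \<partial>N)"
proof -
  let ?F = "natural_filtration N X s"
  interpret sub: finite_measure_subalgebra N ?F
    by unfold_locales (rule natural_filtration_subalgebra)
  have [measurable]: "X s \<in> borel_measurable N" "X (s + h) \<in> borel_measurable N"
    using s h by (auto intro: X_measurable)
  have YN[measurable]: "Y \<in> borel_measurable N"
    by (rule measurable_from_subalg[OF natural_filtration_subalgebra Y])
  have B0: "B \<ge> 0" using B[of 0] by linarith
  have ppX[measurable]: "(\<lambda>\<omega>. pp h f (X s \<omega>)) \<in> borel_measurable N"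
  proof -
    have "(\<lambda>y. indicator {0..} y *\<^sub>R pp h f y) \<in> borel_measurable borel"
      using cont by (intro borel_measurable_continuous_on_indicator) auto
    then have "(\<lambda>\<omega>. indicator {0..} (X s \<omega>) *\<^sub>R pp h f (X s \<omega>)) \<in> borel_measurable N" by measurable
    then show ?thesis
      by (subst measurable_cong[where g="\<lambda>\<omega>. indicator {0..} (X s \<omega>) *\<^sub>R pp h f (X s \<omega>)"])
         (use X_nonneg[OF s] in auto)
  qed
  have ppB: "\<bar>pp h f (X s \<omega>)\<bar> \<le> B" if "\<omega> \<in> space N" for \<omega>
    using pp_bounds[OF h X_nonneg[OF s that] f, of 0 B B] B by auto
  have "\<bar>(\<integral>\<omega>. Y \<omega> * f (X (s + h) \<omega>) \<partial>N) - (\<integral>\<omega>. Y \<omega> * pp h f (X s \<omega>) \<partial>N)\<bar> \<le> 2 * inverse (real (Suc n))" for n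
  proof -
    let ?n = "real (Suc n)"
    \<comment> \<open>The level sets \<open>A i\<close> have width 1 / Suc n. As f is at most B,
      only levels up to J occur, so finitely many exceptional null sets have to be united.\<close>
    define J where "J = nat \<lceil>?n * B\<rceil>"
    define A where "A i = {y. real i \<le> ?n * f y \<and> ?n * f y < real i + 1}" for i :: nat
    have A[measurable]: "A i \<in> sets borel" for i unfolding A_def by measurable
    define g where "g y = (\<Sum>i\<le>J. real i / ?n * indicator (A i) y)" for y
    have g_close: "\<bar>g y - f y\<bar> \<le> inverse ?n" for y
    proof -
      define i where "i = nat \<lfloor>?n * f y\<rfloor>"
      have nn: "0 \<le> ?n * f y" using B by (intro mult_nonneg_nonneg) auto
      then have ri: "real i = of_int \<lfloor>?n * f y\<rfloor>" by (simp add: i_def)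
      then have i: "real i \<le> ?n * f y" "?n * f y < real i + 1" by linarith+
      have "?n * f y \<le> ?n * B" using B by (intro mult_left_mono) auto
      then have iJ: "i \<le> J" unfolding i_def J_def by (intro nat_mono) linarith
      have "indicator (A j) y = (if j = i then 1 else (0::real))" for j
      proof (cases "j = i")
        case False
        then have "real j + 1 \<le> real i \<or> real i + 1 \<le> real j" by linarith
        then have "y \<notin> A j" using i unfolding A_def by auto
        then show ?thesis using False by simp
      qed (use i in \<open>simp add: A_def\<close>)
      then have "g y = (\<Sum>j\<le>J. if j = i then real j / ?n else 0)"
        unfolding g_def by (intro sum.cong) auto
      also have "\<dots> = real i / ?n" using iJ by simp
      finally have gi: "g y = real i / ?n" .
      have "?n * \<bar>g y - f y\<bar> = \<bar>?n * (g y - f y)\<bar>" unfolding abs_mult by simp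
      also have "\<dots> = \<bar>real i - ?n * f y\<bar>" unfolding gi by (simp add: right_diff_distrib del: of_nat_Suc)
      also have "\<dots> \<le> 1" using i by linarith
      finally show ?thesis by (simp add: pos_le_divide_eq inverse_eq_divide mult.commute del: of_nat_Suc)
    qed
    have gm[measurable]: "g \<in> borel_measurable borel" unfolding g_def[abs_def] by measurable
    have g_bd: "\<bar>g y\<bar> \<le> B + 1" for y
    proof -
      have "inverse ?n \<le> 1" by (simp add: inverse_le_1_iff)
      then show ?thesis using g_close[of y] B[of y] unfolding abs_le_iff by linarith
    qed
    let ?C = "\<lambda>i. real_cond_exp N ?F (\<lambda>\<omega>. indicator (A i) (X (s + h) \<omega>))"
    have intY: "integrable N (\<lambda>\<omega>. Y \<omega> * u \<omega>)" if "u \<in> borel_measurable N" "\<And>\<omega>. \<omega> \<in> space N \<Longrightarrow> \<bar>u \<omega>\<bar> \<le> r" for u and r :: real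
    proof (rule N.integrable_const_bound[where B=r])
      show "AE \<omega> in N. norm (Y \<omega> * u \<omega>) \<le> r"
      proof (rule AE_I2)
        fix \<omega> assume "\<omega> \<in> space N"
        have "\<bar>Y \<omega>\<bar> * \<bar>u \<omega>\<bar> \<le> 1 * r" using Y1 that(2)[OF \<open>\<omega> \<in> space N\<close>] by (intro mult_mono) auto
        then show "norm (Y \<omega> * u \<omega>) \<le> r" by (simp add: abs_mult)
      qed
    qed (use that(1) in measurable)
    have Ci: "(\<integral>\<omega>. Y \<omega> * indicator (A i) (X (s + h) \<omega>) \<partial>N) = (\<integral>\<omega>. Y \<omega> * ?C i \<omega> \<partial>N)"
      and Cint: "integrable N (\<lambda>\<omega>. Y \<omega> * ?C i \<omega>)" for i
    proof -
      have "integrable N (\<lambda>\<omega>. Y \<omega> * indicator (A i) (X (s + h) \<omega>))" by (rule intY[of _ 1]) (auto simp: indicator_def)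
      from sub.real_cond_exp_intg[OF this Y]
      show "(\<integral>\<omega>. Y \<omega> * indicator (A i) (X (s + h) \<omega>) \<partial>N) = (\<integral>\<omega>. Y \<omega> * ?C i \<omega> \<partial>N)"
        "integrable N (\<lambda>\<omega>. Y \<omega> * ?C i \<omega>)" by auto
    qed
    have eq: "(\<integral>\<omega>. Y \<omega> * g (X (s + h) \<omega>) \<partial>N) = (\<integral>\<omega>. Y \<omega> * (\<Sum>i\<le>J. real i / ?n * ?C i \<omega>) \<partial>N)"
    proof -
      have "(\<integral>\<omega>. Y \<omega> * g (X (s + h) \<omega>) \<partial>N) = (\<integral>\<omega>. (\<Sum>i\<le>J. real i / ?n * (Y \<omega> * indicator (A i) (X (s + h) \<omega>))) \<partial>N)"
        unfolding g_def sum_distrib_left by (simp only: mult.left_commute)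
      also have "\<dots> = (\<Sum>i\<le>J. real i / ?n * (\<integral>\<omega>. Y \<omega> * indicator (A i) (X (s + h) \<omega>) \<partial>N))"
        by (subst Bochner_Integration.integral_sum)
           (auto intro!: integrable_mult_right intY[of _ 1] simp: indicator_def simp del: of_nat_Suc)
      also have "\<dots> = (\<Sum>i\<le>J. real i / ?n * (\<integral>\<omega>. Y \<omega> * ?C i \<omega> \<partial>N))" unfolding Ci ..
      also have "\<dots> = (\<integral>\<omega>. (\<Sum>i\<le>J. real i / ?n * (Y \<omega> * ?C i \<omega>)) \<partial>N)"
        using Cint by (subst Bochner_Integration.integral_sum) (auto simp del: of_nat_Suc)
      also have "\<dots> = (\<integral>\<omega>. Y \<omega> * (\<Sum>i\<le>J. real i / ?n * ?C i \<omega>) \<partial>N)"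
        unfolding sum_distrib_left by (simp only: mult.left_commute)
      finally show ?thesis .
    qed
    have sumC: "integrable N (\<lambda>\<omega>. Y \<omega> * (\<Sum>i\<le>J. real i / ?n * ?C i \<omega>))"
      unfolding sum_distrib_left mult.left_commute[of "Y _"]
      by (intro Bochner_Integration.integrable_sum integrable_mult_right Cint)
    have close: "AE \<omega> in N. \<bar>Y \<omega> * (\<Sum>i\<le>J. real i / ?n * ?C i \<omega>) - Y \<omega> * pp h f (X s \<omega>)\<bar> \<le> inverse ?n"
    proof -
      have "AE \<omega> in N. \<forall>i\<in>{..J}. ?C i \<omega> = measure (p h (X s \<omega>)) (A i)"
        by (intro AE_finite_allI X_markov s h A) auto
      with AE_space show ?thesis
      proof eventually_elim
        case (elim \<omega>)
        let ?x = "X s \<omega>"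
        have x: "?x \<ge> 0" by (rule X_nonneg[OF s elim(1)])
        interpret p: prob_space "p h ?x" by (rule prob_p[OF h x])
        have meas: "borel_measurable (p h ?x) = borel_measurable borel" by (rule measurable_p_eq[OF h x])
        have ig: "integrable (p h ?x) g" by (rule integrable_p[OF h x gm g_bd])
        have if': "integrable (p h ?x) f" by (rule integrable_p[OF h x f, of B]) (use B in auto)
        have "(\<Sum>i\<le>J. real i / ?n * ?C i \<omega>) = (\<Sum>i\<le>J. real i / ?n * measure (p h ?x) (A i))"
          using elim(2) by (intro sum.cong) auto
        also have "\<dots> = (\<integral>y. g y \<partial>p h ?x)"
          unfolding g_def using sets_p[OF h x] A
          by (subst Bochner_Integration.integral_sum)
             (auto simp: p.emeasure_eq_measure less_top[symmetric] sets_eq_imp_space_eq[OF sets_p[OF h x]] simp del: of_nat_Suc)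
        finally have "(\<Sum>i\<le>J. real i / ?n * ?C i \<omega>) - pp h f ?x = (\<integral>y. g y - f y \<partial>p h ?x)"
          using ig if' by (simp add: pp_eq[OF h x f])
        also have "\<bar>\<dots>\<bar> \<le> (\<integral>y. \<bar>g y - f y\<bar> \<partial>p h ?x)" by (rule integral_abs_bound)
        also have "\<dots> \<le> inverse ?n" using ig if' g_close by (intro p.integral_le_const) auto
        finally have "\<bar>(\<Sum>i\<le>J. real i / ?n * ?C i \<omega>) - pp h f ?x\<bar> \<le> inverse ?n" .
        then have "\<bar>Y \<omega>\<bar> * \<bar>(\<Sum>i\<le>J. real i / ?n * ?C i \<omega>) - pp h f ?x\<bar> \<le> 1 * inverse ?n"
          using Y1 by (intro mult_mono) auto
        then show ?case unfolding right_diff_distrib[symmetric] abs_mult by simp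
      qed
    qed
    have "\<bar>(\<integral>\<omega>. Y \<omega> * f (X (s + h) \<omega>) \<partial>N) - (\<integral>\<omega>. Y \<omega> * g (X (s + h) \<omega>) \<partial>N)\<bar> \<le> inverse ?n"
    proof -
      have i1: "integrable N (\<lambda>\<omega>. Y \<omega> * f (X (s + h) \<omega>))" by (rule intY[of _ B]) (use B in auto)
      have i2: "integrable N (\<lambda>\<omega>. Y \<omega> * g (X (s + h) \<omega>))" by (rule intY[of _ "B + 1"]) (use g_bd in auto)
      have "\<bar>(\<integral>\<omega>. Y \<omega> * f (X (s + h) \<omega>) \<partial>N) - (\<integral>\<omega>. Y \<omega> * g (X (s + h) \<omega>) \<partial>N)\<bar>
        \<le> (\<integral>\<omega>. \<bar>Y \<omega> * f (X (s + h) \<omega>) - Y \<omega> * g (X (s + h) \<omega>)\<bar> \<partial>N)"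
        by (subst Bochner_Integration.integral_diff[OF i1 i2, symmetric]) (rule integral_abs_bound)
      also have "\<dots> \<le> inverse ?n"
      proof (rule N.integral_le_const)
        show "integrable N (\<lambda>\<omega>. \<bar>Y \<omega> * f (X (s + h) \<omega>) - Y \<omega> * g (X (s + h) \<omega>)\<bar>)" using i1 i2 by auto
        have "\<bar>Y \<omega>\<bar> * \<bar>f (X (s + h) \<omega>) - g (X (s + h) \<omega>)\<bar> \<le> 1 * inverse ?n" for \<omega>
          using Y1 g_close[of "X (s + h) \<omega>"] by (intro mult_mono) (simp_all add: abs_minus_commute)
        then show "AE \<omega> in N. \<bar>Y \<omega> * f (X (s + h) \<omega>) - Y \<omega> * g (X (s + h) \<omega>)\<bar> \<le> inverse ?n"
          by (simp only: right_diff_distrib[symmetric] abs_mult) simp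
      qed
      finally show ?thesis .
    qed
    moreover have "\<bar>(\<integral>\<omega>. Y \<omega> * g (X (s + h) \<omega>) \<partial>N) - (\<integral>\<omega>. Y \<omega> * pp h f (X s \<omega>) \<partial>N)\<bar> \<le> inverse ?n"
    proof -
      have i3: "integrable N (\<lambda>\<omega>. Y \<omega> * pp h f (X s \<omega>))" by (rule intY[OF ppX ppB])
      have "\<bar>(\<integral>\<omega>. Y \<omega> * g (X (s + h) \<omega>) \<partial>N) - (\<integral>\<omega>. Y \<omega> * pp h f (X s \<omega>) \<partial>N)\<bar>
        \<le> (\<integral>\<omega>. \<bar>Y \<omega> * (\<Sum>i\<le>J. real i / ?n * ?C i \<omega>) - Y \<omega> * pp h f (X s \<omega>)\<bar> \<partial>N)"
        unfolding eq by (subst Bochner_Integration.integral_diff[OF sumC i3, symmetric]) (rule integral_abs_bound)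
      also have "\<dots> \<le> inverse ?n" by (intro N.integral_le_const close integrable_abs Bochner_Integration.integrable_diff sumC i3)
      finally show ?thesis .
    qed
    ultimately show ?thesis by linarith
  qed
  moreover have "(\<lambda>n. 2 * inverse (real (Suc n))) \<longlonglongrightarrow> 2 * 0"
    by (intro tendsto_intros LIMSEQ_inverse_real_of_nat)
  ultimately have "\<bar>(\<integral>\<omega>. Y \<omega> * f (X (s + h) \<omega>) \<partial>N) - (\<integral>\<omega>. Y \<omega> * pp h f (X s \<omega>) \<partial>N)\<bar> \<le> 2 * 0"
    by (intro LIMSEQ_le_const[where X="\<lambda>n. 2 * inverse (real (Suc n))"]) auto
  then show ?thesis by simp
qed

end

section \<open>The Feynman-Kac formula\<close>

context conditioned_setting
begin

interpretation N: prob_space N by (rule prob_N)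

text \<open>Left end points make the weight of step \<open>j + 1\<close> measurable at time \<open>j * h\<close>.\<close>

definition wgt :: "real \<Rightarrow> real \<Rightarrow> nat \<Rightarrow> 'b \<Rightarrow> real" where
  "wgt l h j \<omega> = exp (- (\<Sum>i<j. h * (l * exp (- X (real i * h) \<omega>))))"

lemma wgt_bounds: "l \<ge> 0 \<Longrightarrow> h \<ge> 0 \<Longrightarrow> 0 < wgt l h j \<omega>" "l \<ge> 0 \<Longrightarrow> h \<ge> 0 \<Longrightarrow> wgt l h j \<omega> \<le> 1"
  unfolding wgt_def by (auto intro!: sum_nonneg)

lemma wgt_Suc: "wgt l h (Suc j) \<omega> = wgt l h j \<omega> * exp (- (h * (l * exp (- X (real j * h) \<omega>))))"
  by (simp add: wgt_def exp_add[symmetric])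

lemma wgt_adapted: "h \<ge> 0 \<Longrightarrow> wgt l h (Suc j) \<in> borel_measurable (natural_filtration N X (real j * h))"
proof -
  assume h: "h \<ge> 0"
  have "X (real i * h) \<in> borel_measurable (natural_filtration N X (real j * h))" if "i < Suc j" for i
    using that h by (intro X_natural_filtration) (auto intro: mult_right_mono)
  then show ?thesis unfolding wgt_def[abs_def]
    by (intro borel_measurable_uminus borel_measurable_sum measurable_compose[OF _ borel_measurable_exp]
        borel_measurable_times borel_measurable_const) (auto intro!: borel_measurable_uminus measurable_compose[OF _ borel_measurable_exp])
qed

lemma wgt_measurable: "h \<ge> 0 \<Longrightarrow> wgt l h j \<in> borel_measurable N"
proof -
  assume h: "h \<ge> 0"
  have [measurable]: "X (real i * h) \<in> borel_measurable N" for i using h by (intro X_measurable) auto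
  show ?thesis unfolding wgt_def[abs_def] by measurable
qed

lemma pp_Fsum_continuous:
  assumes t: "t \<ge> 0"
  shows "continuous_on {0..} (pp t (Fsum l n))"
proof -
  have "continuous_on {0..} (pp t (F k))" for k
  proof (cases k)
    case 0
    then show ?thesis using pp_F_0[OF t] by (subst continuous_on_cong[OF refl, of _ _ "\<lambda>_. 1"]) auto
  qed (simp only: pp_F_continuous[OF t])
  then have "continuous_on {0..} (\<lambda>x. \<Sum>k\<le>n. l ^ k * pp t (F k) x)" by (intro continuous_intros)
  then show ?thesis
    by (subst continuous_on_cong[OF refl pp_Fsum[OF t]]) auto
qed

text \<open>With \<open>o = h * l * exp (- x)\<close>, a step multiplies the weight by
  \<open>exp (- o)\<close> while \<open>Fsum\<close> gains about \<open>o\<close> times itself minus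
  the top term. The bound 1 + o \<le> exp o gives the upper estimate with error e * h only;
  \<open>exp o \<le> 1 + o + o ^ 2\<close>, valid since \<open>h * l \<le> 1\<close>, gives the
  lower one, which pays for the top term and a second-order error.\<close>

lemma grid_feynman_kac:
  assumes l: "l \<ge> 0" and h: "h > 0" and hl: "h * l \<le> 1" and e: "e \<ge> 0"
    and step: "\<And>x. x \<ge> 0 \<Longrightarrow>
      \<bar>pp h (Fsum l n) x - Fsum l n x - h * (l * exp (- x)) * (Fsum l n x - l ^ n * F n x)\<bar> \<le> e * h"
  defines "a \<equiv> \<lambda>j. \<integral>\<omega>. wgt l h j \<omega> * Fsum l n (X (real j * h) \<omega>) \<partial>N"
    and "S \<equiv> \<Sum>k\<le>n. l ^ k * c k"
  shows "a j \<le> 1 + real j * (e * h)"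
    and "a j \<ge> 1 - real j * (h * (l ^ Suc n * c n + S * l\<^sup>2 * h + e))"
proof -
  have h0: "h \<ge> 0" using h by simp
  have G: "0 \<le> Fsum l n x" "Fsum l n x \<le> S" for x
    using Fsum_nonneg[OF l] Fsum_le[OF l] by (auto simp: S_def)
  have Xm[measurable]: "X (real j * h) \<in> borel_measurable N" for j using h by (intro X_measurable) auto
  note [measurable] = wgt_measurable[OF h0]
  have int: "integrable N (\<lambda>\<omega>. wgt l h j \<omega> * Fsum l n (X (real j * h) \<omega>))" for j
  proof (rule N.integrable_const_bound[where B=S])
    have "wgt l h j \<omega> * Fsum l n (X (real j * h) \<omega>) \<le> 1 * S" for \<omega>
      using wgt_bounds[OF l h0] G by (intro mult_mono) auto
    then show "AE \<omega> in N. norm (wgt l h j \<omega> * Fsum l n (X (real j * h) \<omega>)) \<le> S"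
      using wgt_bounds(1)[OF l h0] G by (auto simp: abs_mult less_imp_le)
  qed measurable
  have a0: "a 0 = 1"
  proof -
    have "a 0 = (\<integral>\<omega>. 1 \<partial>N)" unfolding a_def
      by (rule Bochner_Integration.integral_cong) (auto simp: wgt_def X_start Fsum_0)
    then show ?thesis by (simp add: N.prob_space)
  qed
  have ppX[measurable]: "(\<lambda>\<omega>. pp h (Fsum l n) (X (real j * h) \<omega>)) \<in> borel_measurable N" for j
  proof -
    have "(\<lambda>y. indicator {0..} y *\<^sub>R pp h (Fsum l n) y) \<in> borel_measurable borel"
      using pp_Fsum_continuous[OF h0] by (intro borel_measurable_continuous_on_indicator) auto
    then have "(\<lambda>\<omega>. indicator {0..} (X (real j * h) \<omega>) *\<^sub>R pp h (Fsum l n) (X (real j * h) \<omega>)) \<in> borel_measurable N" by measurable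
    then show ?thesis
      by (subst measurable_cong[where g="\<lambda>\<omega>. indicator {0..} (X (real j * h) \<omega>) *\<^sub>R pp h (Fsum l n) (X (real j * h) \<omega>)"])
         (use X_nonneg h in auto)
  qed
  have aSuc: "a (Suc j) = (\<integral>\<omega>. wgt l h (Suc j) \<omega> * pp h (Fsum l n) (X (real j * h) \<omega>) \<partial>N)" for j
  proof -
    have "real (Suc j) * h = real j * h + h" by (simp add: distrib_right)
    then show ?thesis unfolding a_def
      using markov_expectation[OF _ h0 Fsum_measurable G pp_Fsum_continuous[OF h0] wgt_adapted[OF h0, of l j]]
        wgt_bounds[OF l h0, of "Suc j"] h by (simp add: less_imp_le del: of_nat_Suc)
  qed
  have int2: "integrable N (\<lambda>\<omega>. wgt l h (Suc j) \<omega> * pp h (Fsum l n) (X (real j * h) \<omega>))" for j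
  proof (rule N.integrable_const_bound[where B=S])
    show "AE \<omega> in N. norm (wgt l h (Suc j) \<omega> * pp h (Fsum l n) (X (real j * h) \<omega>)) \<le> S"
    proof (rule AE_I2)
      fix \<omega> assume "\<omega> \<in> space N"
      then have x: "X (real j * h) \<omega> \<ge> 0" using h by (intro X_nonneg) auto
      have p: "0 \<le> pp h (Fsum l n) (X (real j * h) \<omega>)" "pp h (Fsum l n) (X (real j * h) \<omega>) \<le> S"
        using pp_bounds[OF h0 x Fsum_measurable[of l n], of 0 S S] G by auto
      have "wgt l h (Suc j) \<omega> * pp h (Fsum l n) (X (real j * h) \<omega>) \<le> 1 * S"
        using wgt_bounds[OF l h0] p by (intro mult_mono) auto
      then show "norm (wgt l h (Suc j) \<omega> * pp h (Fsum l n) (X (real j * h) \<omega>)) \<le> S"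
        using wgt_bounds(1)[OF l h0, of "Suc j" \<omega>] p by (simp add: abs_mult less_imp_le)
    qed
  qed measurable
  let ?D = "h * (l ^ Suc n * c n + S * l\<^sup>2 * h + e)"
  have D: "?D \<ge> 0" using h l e c_pos[of n] G[of 0] by (intro mult_nonneg_nonneg add_nonneg_nonneg) auto
  have pt: "wgt l h (Suc j) \<omega> * pp h (Fsum l n) (X (real j * h) \<omega>) \<le> wgt l h j \<omega> * Fsum l n (X (real j * h) \<omega>) + e * h"
    "wgt l h j \<omega> * Fsum l n (X (real j * h) \<omega>) - ?D \<le> wgt l h (Suc j) \<omega> * pp h (Fsum l n) (X (real j * h) \<omega>)"
    if \<omega>: "\<omega> \<in> space N" for j \<omega>
  proof -
    let ?x = "X (real j * h) \<omega>" and ?w = "wgt l h (Suc j) \<omega>"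
    let ?G = "Fsum l n ?x"
    have x: "?x \<ge> 0" using h \<omega> by (intro X_nonneg) auto
    let ?o = "h * (l * exp (- ?x))"
    have ex: "exp (- ?x) \<le> 1" using x by simp
    have o: "0 \<le> ?o" "?o \<le> h * l" "?o \<le> 1"
    proof -
      show "0 \<le> ?o" using h l by simp
      have "l * exp (- ?x) \<le> l * 1" using l ex by (intro mult_left_mono) auto
      then show "?o \<le> h * l" using h by (intro mult_left_mono) auto
      then show "?o \<le> 1" using hl by linarith
    qed
    have w: "0 \<le> ?w" "?w \<le> 1" using wgt_bounds[OF l h0, of "Suc j" \<omega>] by auto
    have we: "?w * (exp ?o * ?G) = wgt l h j \<omega> * ?G"
      by (simp add: wgt_Suc exp_minus field_simps)
    have FF: "0 \<le> l ^ n * F n ?x" "l ^ n * F n ?x \<le> l ^ n * c n"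
      using l F_nonneg[of n ?x] F_le[of n ?x] by (auto intro: mult_left_mono)
    have st: "pp h (Fsum l n) ?x \<le> ?G + ?o * (?G - l ^ n * F n ?x) + e * h"
      "?G + ?o * (?G - l ^ n * F n ?x) - e * h \<le> pp h (Fsum l n) ?x"
      using step[OF x] by (simp_all add: abs_le_iff mult.assoc)
    have "pp h (Fsum l n) ?x \<le> ?G + ?o * ?G + e * h"
      using st(1) mult_nonneg_nonneg[OF o(1) FF(1)] by (simp add: right_diff_distrib)
    also have "?G + ?o * ?G \<le> exp ?o * ?G"
      using mult_right_mono[OF exp_ge_add_one_self[of ?o] G(1)[of ?x]] by (simp add: distrib_right)
    finally have "?w * pp h (Fsum l n) ?x \<le> ?w * (exp ?o * ?G + e * h)"
      using w by (intro mult_left_mono) auto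
    also have "\<dots> \<le> wgt l h j \<omega> * ?G + e * h"
      unfolding distrib_left we using mult_right_mono[OF w(2), of "e * h"] e h by simp
    finally show "?w * pp h (Fsum l n) ?x \<le> wgt l h j \<omega> * ?G + e * h" .
    have "exp ?o \<le> 1 + ?o + ?o\<^sup>2" using o by (intro exp_bound) auto
    then have "exp ?o * ?G \<le> (1 + ?o + ?o\<^sup>2) * ?G" using G by (intro mult_right_mono) auto
    moreover have "?o\<^sup>2 * ?G \<le> (h * l)\<^sup>2 * S"
      using o G h l by (intro mult_mono power_mono) auto
    moreover have "?o * (l ^ n * F n ?x) \<le> (h * l) * (l ^ n * c n)"
      by (rule mult_mono[OF o(2) FF(2) _ FF(1)]) (use h l in simp)
    ultimately have "exp ?o * ?G - ?D \<le> pp h (Fsum l n) ?x"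
      using st(2) by (simp add: algebra_simps power2_eq_square)
    then have "?w * (exp ?o * ?G - ?D) \<le> ?w * pp h (Fsum l n) ?x" using w by (intro mult_left_mono) auto
    moreover have "?w * ?D \<le> ?D" using mult_right_mono[OF w(2) D] by simp
    ultimately show "wgt l h j \<omega> * ?G - ?D \<le> ?w * pp h (Fsum l n) ?x"
      unfolding right_diff_distrib we by linarith
  qed
  have up: "a (Suc j) \<le> a j + e * h" for j
  proof -
    have "a (Suc j) \<le> (\<integral>\<omega>. wgt l h j \<omega> * Fsum l n (X (real j * h) \<omega>) + e * h \<partial>N)"
      unfolding aSuc using int pt(1) by (intro integral_mono int2) auto
    then show ?thesis using int[of j] by (simp add: a_def N.prob_space)
  qed
  have lo: "a j - ?D \<le> a (Suc j)" for j
  proof -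
    have "(\<integral>\<omega>. wgt l h j \<omega> * Fsum l n (X (real j * h) \<omega>) - ?D \<partial>N) \<le> a (Suc j)"
      unfolding aSuc using int pt(2) by (intro integral_mono int2) auto
    then show ?thesis using int[of j] by (simp add: a_def N.prob_space)
  qed
  show "a j \<le> 1 + real j * (e * h)"
  proof (induction j)
    case (Suc j) then show ?case using up[of j] by (simp add: distrib_right)
  qed (simp add: a0)
  show "a j \<ge> 1 - real j * ?D"
  proof (induction j)
    case (Suc j) then show ?case using lo[of j] by (simp only: of_nat_Suc distrib_right)
  qed (simp add: a0)
qed

definition D :: "real \<Rightarrow> 'b \<Rightarrow> real" where
  "D t \<omega> = (LINT s:{0<..t}|lborel. exp (- X s \<omega>))"

lemma D_riemann:
  assumes t: "t > 0" and \<omega>: "\<omega> \<in> space N"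
  shows "set_integrable lborel {0<..t} (\<lambda>s. exp (- X s \<omega>))"
    and "(\<lambda>n. \<Sum>j<Suc n. t / real (Suc n) * exp (- X (real j * (t / real (Suc n))) \<omega>)) \<longlonglongrightarrow> D t \<omega>"
proof -
  have rc: "continuous (at_right s) (\<lambda>s. exp (- X s \<omega>))" if "s \<ge> 0" for s
  proof -
    have "continuous (at_right s) (\<lambda>s. X s \<omega>)" using X_cadlag[OF \<omega>] that by (simp add: cadlag_def)
    then show ?thesis by (intro continuous_intros)
  qed
  have bd: "\<bar>exp (- X s \<omega>)\<bar> \<le> 1" if "0 \<le> s" "s \<le> t" for s
    using X_nonneg[OF that(1) \<omega>] by simp
  show "set_integrable lborel {0<..t} (\<lambda>s. exp (- X s \<omega>))"
    by (rule right_continuous_riemann_sum(1)[OF t rc bd])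
  show "(\<lambda>n. \<Sum>j<Suc n. t / real (Suc n) * exp (- X (real j * (t / real (Suc n))) \<omega>)) \<longlonglongrightarrow> D t \<omega>"
    unfolding D_def by (rule right_continuous_left_riemann_sum[OF t rc bd])
qed

lemma D_measurable: "t > 0 \<Longrightarrow> D t \<in> borel_measurable N"
proof -
  assume t: "t > 0"
  have [measurable]: "X (real j * (t / real (Suc n))) \<in> borel_measurable N" for j n
    using t by (intro X_measurable mult_nonneg_nonneg) auto
  show ?thesis
    by (rule borel_measurable_LIMSEQ_real[OF D_riemann(2)[OF t]]) measurable
qed

text \<open>Refining the grid removes the second-order error and then e. The remaining defect
  \<open>t * (l ^ Suc n * c n)\<close> comes from truncating the series; it grows with t but only
  hurts the lower bound.\<close>

lemma feynman_kac:
  assumes l: "l > 0" and t: "t > 0"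
  shows "(\<integral>\<omega>. exp (- (l * D t \<omega>)) * Fsum l n (X t \<omega>) \<partial>N) \<le> 1"
    and "(\<integral>\<omega>. exp (- (l * D t \<omega>)) * Fsum l n (X t \<omega>) \<partial>N) \<ge> 1 - t * (l ^ Suc n * c n)"
proof -
  let ?S = "\<Sum>k\<le>n. l ^ k * c k"
  let ?L = "\<integral>\<omega>. exp (- (l * D t \<omega>)) * Fsum l n (X t \<omega>) \<partial>N"
  have l0: "l \<ge> 0" using l by simp
  have G: "0 \<le> Fsum l n x" "Fsum l n x \<le> ?S" for x
    using Fsum_nonneg[OF l0] Fsum_le[OF l0] by auto
  define a where "a i = (\<integral>\<omega>. wgt l (t / real (Suc i)) (Suc i) \<omega> * Fsum l n (X t \<omega>) \<partial>N)" for i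
  have h0: "t / real (Suc i) \<ge> 0" for i using t by simp
  have [measurable]: "X t \<in> borel_measurable N" using t by (intro X_measurable) auto
  note [measurable] = wgt_measurable[OF h0] D_measurable[OF t]
  have lim: "a \<longlonglongrightarrow> ?L"
    unfolding a_def
  proof (rule integral_dominated_convergence[where w="\<lambda>_. ?S"])
    show "AE \<omega> in N. (\<lambda>i. wgt l (t / real (Suc i)) (Suc i) \<omega> * Fsum l n (X t \<omega>)) \<longlonglongrightarrow> exp (- (l * D t \<omega>)) * Fsum l n (X t \<omega>)"
    proof (rule AE_I2)
      fix \<omega> assume \<omega>: "\<omega> \<in> space N"
      have e: "wgt l (t / real (Suc i)) (Suc i) \<omega> = exp (- (l * (\<Sum>j<Suc i. t / real (Suc i) * exp (- X (real j * (t / real (Suc i))) \<omega>))))" for i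
        unfolding wgt_def sum_distrib_left by (simp only: mult.left_commute)
      show "(\<lambda>i. wgt l (t / real (Suc i)) (Suc i) \<omega> * Fsum l n (X t \<omega>)) \<longlonglongrightarrow> exp (- (l * D t \<omega>)) * Fsum l n (X t \<omega>)"
        unfolding e by (intro tendsto_intros D_riemann t \<omega>)
    qed
    have "wgt l (t / real (Suc i)) (Suc i) \<omega> * Fsum l n (X t \<omega>) \<le> 1 * ?S" for i \<omega>
      using wgt_bounds[OF l0 h0] G by (intro mult_mono) auto
    then show "\<And>i. AE \<omega> in N. norm (wgt l (t / real (Suc i)) (Suc i) \<omega> * Fsum l n (X t \<omega>)) \<le> ?S"
      using wgt_bounds(1)[OF l0 h0] G by (auto simp: abs_mult less_imp_le)
  next
    have FX: "(\<lambda>\<omega>. Fsum l n (X t \<omega>)) \<in> borel_measurable N" by measurable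
    show "(\<lambda>\<omega>. exp (- (l * D t \<omega>)) * Fsum l n (X t \<omega>)) \<in> borel_measurable N"
      using D_measurable[OF t] by (intro borel_measurable_times FX) measurable
    show "(\<lambda>\<omega>. wgt l (t / real (Suc i)) (Suc i) \<omega> * Fsum l n (X t \<omega>)) \<in> borel_measurable N" for i
      by (intro borel_measurable_times FX wgt_measurable h0)
    show "integrable N (\<lambda>_. ?S)" by simp
  qed
  have ev: "\<forall>\<^sub>F i in sequentially. a i \<le> 1 + t * e \<and>
      a i \<ge> 1 - t * (l ^ Suc n * c n + ?S * l\<^sup>2 * (t / real (Suc i)) + e)" if e: "e > 0" for e
  proof -
    have fl: "filterlim (\<lambda>i. t / real (Suc i)) (at_right 0) sequentially" by (rule filterlim_div_Suc_at_right[OF t])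
    have "\<forall>\<^sub>F h in at_right 0. h < 1 / l" using l by (intro eventually_at_right_less[THEN eventually_mono] eventually_at_rightI[of 0 "1 / l"]) auto
    from eventually_compose_filterlim[OF this fl] eventually_compose_filterlim[OF pp_Fsum_step[OF e l0, of n] fl]
    show ?thesis
    proof eventually_elim
      case (elim i)
      let ?h = "t / real (Suc i)"
      have h: "?h > 0" using t by simp
      have "?h * l \<le> 1" using elim(1) l by (simp add: pos_less_divide_eq less_imp_le)
      note gfk = grid_feynman_kac[OF l0 h this less_imp_le[OF e] elim(2)[rule_format], of "Suc i"]
      have th: "real (Suc i) * ?h = t" by simp
      have m1: "real (Suc i) * (e * ?h) = t * e" by (simp del: of_nat_Suc)
      have m2: "real (Suc i) * (?h * v) = t * v" for v by (simp del: of_nat_Suc)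
      show ?case
        using gfk unfolding m1 m2 unfolding th a_def by blast
    qed
  qed
  show "?L \<le> 1"
  proof (rule field_le_epsilon)
    fix e :: real assume e: "e > 0"
    then have "e / t > 0" using t by simp
    from ev[OF this] have "\<forall>\<^sub>F i in sequentially. a i \<le> 1 + t * (e / t)" by eventually_elim auto
    then have "?L \<le> 1 + t * (e / t)" by (rule tendsto_upperbound[OF lim]) simp
    then show "?L \<le> 1 + e" using t by simp
  qed
  show "?L \<ge> 1 - t * (l ^ Suc n * c n)"
  proof (rule field_le_epsilon)
    fix e :: real assume e: "e > 0"
    then have "e / t > 0" using t by simp
    from ev[OF this] have 1: "\<forall>\<^sub>F i in sequentially. 1 - t * (l ^ Suc n * c n + ?S * l\<^sup>2 * (t * inverse (real (Suc i))) + e / t) \<le> a i"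
      by eventually_elim (simp only: divide_inverse)
    have 2: "(\<lambda>i. 1 - t * (l ^ Suc n * c n + ?S * l\<^sup>2 * (t * inverse (real (Suc i))) + e / t)) \<longlonglongrightarrow>
      1 - t * (l ^ Suc n * c n + ?S * l\<^sup>2 * (t * 0) + e / t)"
      by (intro tendsto_intros LIMSEQ_inverse_real_of_nat)
    have "1 - t * (l ^ Suc n * c n + ?S * l\<^sup>2 * (t * 0) + e / t) \<le> ?L"
      by (rule tendsto_le[OF _ lim 2 1]) simp
    moreover have "t * (l ^ Suc n * c n + ?S * l\<^sup>2 * (t * 0) + e / t) = t * (l ^ Suc n * c n) + e"
      using t by (simp add: distrib_left)
    ultimately show "1 - t * (l ^ Suc n * c n) \<le> ?L + e" by simp
  qed
qed

end

section \<open>The Laplace transform of the exponential functional\<close>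

text \<open>The factors \<open>d j = min 1 (a j / b j)\<close> satisfy
  \<open>d j * b j \<le> a j\<close> and equal 1 from j0 on, so all their partial products are at
  least the product over j < j0, which serves as B.\<close>

lemma prod_lower_bound_from_tail:
  fixes a b :: "nat \<Rightarrow> real"
  assumes a: "\<And>j. a j > 0" and b: "\<And>j. b j > 0" and tail: "\<And>j. j \<ge> j0 \<Longrightarrow> b j \<le> a j"
  shows "\<exists>B>0. \<forall>k. B * (\<Prod>j<k. b j) \<le> (\<Prod>j<k. a j)"
proof -
  define d where "d j = min 1 (a j / b j)" for j
  have d: "0 < d j" "d j \<le> 1" for j using a b by (auto simp: d_def)
  have db: "d j * b j \<le> a j" for j
    using mult_right_mono[of "d j" "a j / b j" "b j"] b[of j] by (simp add: d_def)
  have d1: "d j = 1" if "j \<ge> j0" for j using tail[OF that] b[of j] by (simp add: d_def)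
  have "(\<Prod>j<j0. d j) * (\<Prod>j<k. b j) \<le> (\<Prod>j<k. a j)" for k
  proof -
    have "(\<Prod>j<j0. d j) = (\<Prod>j<j0 + k. d j)"
      by (rule prod.mono_neutral_left) (auto simp: d1)
    also have "\<dots> = (\<Prod>j<k. d j) * (\<Prod>j\<in>{k..<j0 + k}. d j)"
      by (subst prod.union_disjoint[symmetric]) (auto intro: prod.cong simp: ivl_disj_un)
    also have "\<dots> \<le> (\<Prod>j<k. d j) * 1"
      using d by (intro mult_left_mono prod_le_1 prod_nonneg) (auto simp: less_imp_le)
    finally have "(\<Prod>j<j0. d j) * (\<Prod>j<k. b j) \<le> (\<Prod>j<k. d j) * (\<Prod>j<k. b j)"
      using b by (intro mult_right_mono prod_nonneg) (auto simp: less_imp_le)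
    also have "\<dots> = (\<Prod>j<k. d j * b j)" by (simp add: prod.distrib)
    also have "\<dots> \<le> (\<Prod>j<k. a j)" using d b db by (intro prod_mono) (auto simp: less_imp_le)
    finally show ?thesis .
  qed
  moreover have "(\<Prod>j<j0. d j) > 0" using d by (intro prod_pos) auto
  ultimately show ?thesis by blast
qed

text \<open>Each term is at most the whole sum, to which r - 1 of the r powers can be raised. For
  the terms of an exponential series this gives \<open>exp (r * v)\<close> directly, without
  asymptotics of factorials.\<close>

lemma sum_powr_le_powr_sum:
  fixes a :: "'i \<Rightarrow> real"
  assumes "finite A" and a: "\<And>i. i \<in> A \<Longrightarrow> a i \<ge> 0" and r: "r \<ge> 1"
  shows "(\<Sum>i\<in>A. a i powr r) \<le> (\<Sum>i\<in>A. a i) powr r"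
proof -
  let ?S = "\<Sum>i\<in>A. a i"
  have S: "?S \<ge> 0" using a by (intro sum_nonneg)
  have split: "y powr r = y * y powr (r - 1)" if "y \<ge> 0" for y :: real
    using that by (cases "y = 0") (auto simp: powr_mult_base)
  have "(\<Sum>i\<in>A. a i powr r) \<le> (\<Sum>i\<in>A. a i * ?S powr (r - 1))"
  proof (rule sum_mono)
    fix i assume i: "i \<in> A"
    have "a i \<le> ?S" using assms(1) a i by (intro member_le_sum) auto
    then have "a i powr (r - 1) \<le> ?S powr (r - 1)" using r a[OF i] by (intro powr_mono2) auto
    then show "a i powr r \<le> a i * ?S powr (r - 1)"
      unfolding split[OF a[OF i]] using a[OF i] by (intro mult_left_mono)
  qed
  also have "\<dots> = ?S powr r" unfolding split[OF S] by (simp add: sum_distrib_right)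
  finally show ?thesis .
qed

text \<open>If all terms were smaller, damping them by \<open>r ^ k\<close> and summing a geometric
  series would give \<open>exp (r * u) \<le> exp (r * u) / 2\<close>. This takes the place of
  Stirling's formula.\<close>

lemma exp_series_large_term:
  fixes u r :: real
  assumes u: "u \<ge> 0" and r: "0 < r" "r < 1"
  shows "\<exists>k. u ^ k / fact k \<ge> (1 - r) / 2 * exp (r * u)"
proof (rule ccontr)
  assume "\<not> ?thesis"
  then have lt: "u ^ k / fact k \<le> (1 - r) / 2 * exp (r * u)" for k by (meson less_imp_le not_le)
  have s1: "(\<lambda>k. (r * u) ^ k /\<^sub>R fact k) sums exp (r * u)" by (rule exp_converges)
  have s2: "(\<lambda>k. ((1 - r) / 2 * exp (r * u)) * r ^ k) sums (((1 - r) / 2 * exp (r * u)) * (1 / (1 - r)))"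
    using r by (intro sums_mult geometric_sums) auto
  have "exp (r * u) \<le> ((1 - r) / 2 * exp (r * u)) * (1 / (1 - r))"
  proof (rule sums_le[OF _ s1 s2])
    fix k
    have "(r * u) ^ k /\<^sub>R fact k = (u ^ k / fact k) * r ^ k"
      by (simp add: power_mult_distrib divide_inverse)
    also have "\<dots> \<le> ((1 - r) / 2 * exp (r * u)) * r ^ k" using r by (intro mult_right_mono lt) auto
    finally show "(r * u) ^ k /\<^sub>R fact k \<le> ((1 - r) / 2 * exp (r * u)) * r ^ k" .
  qed
  also have "\<dots> = exp (r * u) / 2" using r by (simp add: field_simps)
  finally show False by simp
qed

text \<open>The terms of the exponential series increase as long as the index is at most u; this
  lets the index of a large term be raised to n.\<close>

lemma power_div_fact_mono:
  fixes u :: real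
  assumes u: "real n \<le> u" and k: "k \<le> n"
  shows "u ^ k / fact k \<le> u ^ n / fact n"
  using k u
proof (induction n rule: dec_induct)
  case (step n)
  have u0: "0 \<le> u" using step by linarith
  have "u ^ k / fact k \<le> u ^ n / fact n" using step by simp
  also have "\<dots> \<le> (u / real (Suc n)) * (u ^ n / fact n)"
    using step u0 mult_right_mono[of 1 "u / real (Suc n)" "u ^ n / fact n"]
    by (simp add: pos_le_divide_eq del: of_nat_Suc)
  also have "\<dots> = u ^ Suc n / fact (Suc n)" by (simp add: field_simps)
  finally show ?case .
qed simp

lemma prod_Suc_powr:
  assumes C: "C > (0::real)"
  shows "(\<Prod>j<k. 1 / (C * real (j + n + 1) powr r)) = (fact n / fact (k + n)) powr r / C ^ k"
proof (induction k)
  case (Suc k)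
  have "(fact n / fact (Suc k + n)) powr r = (fact n / fact (k + n)) powr r * (1 / real (k + n + 1)) powr r"
    by (subst powr_mult[symmetric]) (simp_all add: mult.commute)
  then show ?case using Suc C by (simp add: powr_divide ac_simps)
qed simp

lemma small_arg_filterlim:
  fixes C r :: real
  assumes "C > 0" "r > 0"
  shows "filterlim (\<lambda>x. 1 / (C * x) powr r) at_top (at_right 0)"
proof -
  have "((\<lambda>x. (C * x) powr r) \<longlongrightarrow> 0) (at_right 0)"
  proof (rule tendsto_zero_powrI[OF _ tendsto_const])
    have "((\<lambda>x. C * x) \<longlongrightarrow> C * 0) (at_right 0)" by (intro tendsto_intros)
    then show "((\<lambda>x. C * x) \<longlongrightarrow> 0) (at_right 0)" by simp
    show "\<forall>\<^sub>F x in at_right 0. 0 \<le> C * x"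
      using assms by (auto simp: eventually_at_right_field intro!: exI[of _ 1])
  qed (use assms in auto)
  moreover have "\<forall>\<^sub>F x in at_right 0. 0 < (C * x) powr r"
    using assms by (auto simp: eventually_at_right_field intro!: exI[of _ 1])
  ultimately have "filterlim (\<lambda>x. inverse ((C * x) powr r)) at_top (at_right 0)"
    by (rule filterlim_inverse_at_top)
  then show ?thesis by (simp add: inverse_eq_divide)
qed

lemma power_le_exp_eventually:
  fixes g A :: real
  assumes g: "g > 0"
  shows "\<forall>\<^sub>F u in at_top. A * u ^ n \<le> exp (g * u)"
proof -
  have "filterlim (\<lambda>u. g * u) at_top at_top"
    using g by (intro filterlim_tendsto_pos_mult_at_top[OF tendsto_const] filterlim_ident) auto
  then have "((\<lambda>u. (g * u) ^ n / exp (g * u)) \<longlongrightarrow> 0) at_top"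
    by (rule filterlim_compose[OF tendsto_power_div_exp_0])
  then have "((\<lambda>u. A / g ^ n * ((g * u) ^ n / exp (g * u))) \<longlongrightarrow> A / g ^ n * 0) at_top"
    by (intro tendsto_intros)
  then have "\<forall>\<^sub>F u in at_top. A / g ^ n * ((g * u) ^ n / exp (g * u)) < 1"
    by (rule order_tendstoD) simp
  then show ?thesis
  proof eventually_elim
    case (elim u)
    have "A / g ^ n * ((g * u) ^ n / exp (g * u)) = A * u ^ n / exp (g * u)"
      using g by (simp add: power_mult_distrib)
    then show ?case using elim by (simp add: divide_less_eq)
  qed
qed

context conditioned_setting
begin

interpretation N: prob_space N by (rule prob_N)

section \<open>The exponential functional as the limit of \<open>D t\<close>\<close>

abbreviation I :: "'b \<Rightarrow> ennreal" where
  "I \<equiv> exponential_functional X"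

text \<open>An infinite \<open>I\<close> must give 0; \<open>enn2real\<close> alone would turn it
  into 0 and the exponential into 1.\<close>

definition expI :: "real \<Rightarrow> 'b \<Rightarrow> real" where
  "expI l \<omega> = (if I \<omega> = \<top> then 0 else exp (- (l * enn2real (I \<omega>))))"

lemma D_nonneg: "0 \<le> D t \<omega>"
  unfolding D_def set_lebesgue_integral_def by (intro integral_nonneg_AE) simp

lemma D_nn_integral:
  assumes t: "t > 0" and \<omega>: "\<omega> \<in> space N"
  shows "ennreal (D t \<omega>) = (\<integral>\<^sup>+s. indicator {0<..t} s * ennreal (exp (- X s \<omega>)) \<partial>lborel)"
proof -
  have i: "integrable lborel (\<lambda>s. indicator {0<..t} s *\<^sub>R exp (- X s \<omega>))"
    using D_riemann(1)[OF assms] by (simp add: set_integrable_def)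
  have "ennreal (D t \<omega>) = (\<integral>\<^sup>+s. ennreal (indicator {0<..t} s *\<^sub>R exp (- X s \<omega>)) \<partial>lborel)"
    unfolding D_def set_lebesgue_integral_def by (rule nn_integral_eq_integral[symmetric, OF i]) simp
  also have "\<dots> = (\<integral>\<^sup>+s. indicator {0<..t} s * ennreal (exp (- X s \<omega>)) \<partial>lborel)"
    by (intro nn_integral_cong) (auto split: split_indicator)
  finally show ?thesis .
qed

lemma I_eq: "I \<omega> = (\<integral>\<^sup>+s. indicator {0<..} s * ennreal (exp (- X s \<omega>)) \<partial>lborel)"
  unfolding exponential_functional_def
proof (rule nn_integral_cong_AE)
  show "AE s in lborel. ennreal (exp (- X s \<omega>)) * indicator {0..} s = indicator {0<..} s * ennreal (exp (- X s \<omega>))"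
    using AE_lborel_singleton[of "0::real"] by eventually_elim (auto split: split_indicator)
qed

lemma D_le_I: "t > 0 \<Longrightarrow> \<omega> \<in> space N \<Longrightarrow> ennreal (D t \<omega>) \<le> I \<omega>"
  unfolding D_nn_integral I_eq by (intro nn_integral_mono) (auto split: split_indicator)

lemma D_tendsto_I: "\<omega> \<in> space N \<Longrightarrow> (\<lambda>n. ennreal (D (real (Suc n)) \<omega>)) \<longlonglongrightarrow> I \<omega>"
proof -
  assume \<omega>: "\<omega> \<in> space N"
  let ?f = "\<lambda>n s. indicator {0<..real (Suc n)} s * ennreal (exp (- X s \<omega>))"
  have inc: "incseq ?f"
    by (auto simp: incseq_def le_fun_def split: split_indicator)
  have m: "?f n \<in> borel_measurable lborel" for n
  proof -
    have "(\<lambda>s. ennreal (indicator {0<..real (Suc n)} s *\<^sub>R exp (- X s \<omega>))) \<in> borel_measurable lborel"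
      using borel_measurable_integrable[OF D_riemann(1)[unfolded set_integrable_def, of "real (Suc n)", OF _ \<omega>]] by simp
    also have "(\<lambda>s. ennreal (indicator {0<..real (Suc n)} s *\<^sub>R exp (- X s \<omega>))) = ?f n"
      by (auto split: split_indicator)
    finally show ?thesis .
  qed
  have "(SUP n. ?f n s) = indicator {0<..} s * ennreal (exp (- X s \<omega>))" for s
  proof (cases "s > 0")
    case True
    obtain n where n: "s \<le> real n" using real_arch_simple by blast
    show ?thesis
    proof (rule antisym)
      show "indicator {0<..} s * ennreal (exp (- X s \<omega>)) \<le> (SUP n. ?f n s)"
        using True n by (intro SUP_upper2[of n]) auto
    qed (use True in \<open>auto intro!: SUP_least split: split_indicator\<close>)
  qed (simp add: bot_ennreal[symmetric])
  then have "I \<omega> = (\<integral>\<^sup>+s. (SUP n. ?f n s) \<partial>lborel)" unfolding I_eq by simp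
  also have "\<dots> = (SUP n. integral\<^sup>N lborel (?f n))" by (rule nn_integral_monotone_convergence_SUP[OF inc m])
  finally have e: "I \<omega> = (SUP n. integral\<^sup>N lborel (?f n))" .
  have "incseq (\<lambda>n. integral\<^sup>N lborel (?f n))"
    using inc by (auto simp: incseq_def le_fun_def intro!: nn_integral_mono)
  then have "(\<lambda>n. integral\<^sup>N lborel (?f n)) \<longlonglongrightarrow> I \<omega>" unfolding e by (rule LIMSEQ_SUP)
  then show ?thesis using D_nn_integral[OF _ \<omega>] by simp
qed

lemma I_measurable: "I \<in> borel_measurable N"
proof (rule borel_measurable_LIMSEQ_order[OF D_tendsto_I])
  have "D (real (Suc n)) \<in> borel_measurable N" for n by (intro D_measurable) simp
  then show "(\<lambda>\<omega>. ennreal (D (real (Suc n)) \<omega>)) \<in> borel_measurable N" for n by measurable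
qed

lemma expI_bounds: "l \<ge> 0 \<Longrightarrow> 0 \<le> expI l \<omega>" "l \<ge> 0 \<Longrightarrow> expI l \<omega> \<le> 1"
  by (auto simp: expI_def)

lemma expI_le_D:
  assumes l: "l \<ge> 0" and t: "t > 0" and \<omega>: "\<omega> \<in> space N"
  shows "expI l \<omega> \<le> exp (- (l * D t \<omega>))"
proof (cases "I \<omega> = \<top>")
  case False
  then have "D t \<omega> \<le> enn2real (I \<omega>)"
    using enn2real_mono[OF D_le_I[OF t \<omega>]] D_nonneg[of t \<omega>] by (simp add: top.not_eq_extremum)
  then show ?thesis using False l by (simp add: expI_def mult_left_mono)
qed (simp add: expI_def)

lemma expI_tendsto:
  assumes l: "l > 0" and \<omega>: "\<omega> \<in> space N"
  shows "(\<lambda>n. exp (- (l * D (real (Suc n)) \<omega>))) \<longlonglongrightarrow> expI l \<omega>"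
proof (cases "I \<omega> = \<top>")
  case True
  then have "filterlim (\<lambda>n. D (real (Suc n)) \<omega>) at_top sequentially"
    using D_tendsto_I[OF \<omega>] ennreal_tendsto_top_eq_at_top[of "\<lambda>n. D (real (Suc n)) \<omega>" sequentially] by simp
  then have "filterlim (\<lambda>n. l * D (real (Suc n)) \<omega>) at_top sequentially"
    using l by (intro filterlim_tendsto_pos_mult_at_top[OF tendsto_const])
  then have "(\<lambda>n. exp (- (l * D (real (Suc n)) \<omega>))) \<longlonglongrightarrow> 0"
    by (intro filterlim_compose[OF exp_at_bot]) (simp add: filterlim_uminus_at_bot)
  then show ?thesis using True by (simp add: expI_def)
next
  case False
  then have "(\<lambda>n. ennreal (D (real (Suc n)) \<omega>)) \<longlonglongrightarrow> ennreal (enn2real (I \<omega>))"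
    using D_tendsto_I[OF \<omega>] by (simp add: top.not_eq_extremum)
  then have "(\<lambda>n. enn2real (ennreal (D (real (Suc n)) \<omega>))) \<longlonglongrightarrow> enn2real (I \<omega>)"
    by (rule tendsto_enn2real) simp
  then have "(\<lambda>n. exp (- (l * D (real (Suc n)) \<omega>))) \<longlonglongrightarrow> exp (- (l * enn2real (I \<omega>)))"
    by (intro tendsto_intros) (simp add: D_nonneg)
  then show ?thesis using False by (simp add: expI_def)
qed

lemma expI_measurable [measurable]: "expI l \<in> borel_measurable N"
proof -
  note [measurable] = I_measurable
  show ?thesis unfolding expI_def[abs_def] by measurable
qed

lemma expI_integrable: "l \<ge> 0 \<Longrightarrow> integrable N (expI l)"
  by (rule N.integrable_const_bound[where B=1]) (use expI_bounds in auto)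

text \<open>The order of limits matters: for fixed t the defect of \<open>feynman_kac\<close>, which
  grows with t, is removed by letting n grow, and t tends to infinity afterwards. In between,
  \<open>Fsum\<close> is replaced by its uniform bound S.\<close>

lemma laplace_lower:
  assumes l: "l > 0" and S: "\<And>n. (\<Sum>k\<le>n. l ^ k * c k) \<le> S" and lim: "(\<lambda>n. l ^ n * c n) \<longlonglongrightarrow> 0"
  shows "1 \<le> S * (\<integral>\<omega>. expI l \<omega> \<partial>N)"
proof -
  have D_bd: "1 \<le> S * (\<integral>\<omega>. exp (- (l * D t \<omega>)) \<partial>N)" if t: "t > 0" for t
  proof -
    note [measurable] = D_measurable[OF t]
    have [measurable]: "X t \<in> borel_measurable N" using t by (intro X_measurable) auto
    have iD: "integrable N (\<lambda>\<omega>. exp (- (l * D t \<omega>)))"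
      by (rule N.integrable_const_bound[where B=1]) (use l D_nonneg in auto)
    have "1 - t * (l * (l ^ n * c n)) \<le> S * (\<integral>\<omega>. exp (- (l * D t \<omega>)) \<partial>N)" for n
    proof -
      have G: "0 \<le> Fsum l n x" "Fsum l n x \<le> S" for x
        using Fsum_nonneg[of l n x] order_trans[OF Fsum_le[of l n x] S[of n]] l by auto
      have le: "exp (- (l * D t \<omega>)) * Fsum l n (X t \<omega>) \<le> S * exp (- (l * D t \<omega>))" for \<omega>
        using mult_left_mono[OF G(2), of "exp (- (l * D t \<omega>))" "X t \<omega>"] by (simp add: mult.commute)
      have "1 - t * (l ^ Suc n * c n) \<le> (\<integral>\<omega>. exp (- (l * D t \<omega>)) * Fsum l n (X t \<omega>) \<partial>N)"
        by (rule feynman_kac(2)[OF l t])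
      also have "\<dots> \<le> (\<integral>\<omega>. S * exp (- (l * D t \<omega>)) \<partial>N)"
      proof (rule integral_mono[OF _ _ le])
        show "integrable N (\<lambda>\<omega>. exp (- (l * D t \<omega>)) * Fsum l n (X t \<omega>))"
          by (rule Bochner_Integration.integrable_bound[OF integrable_mult_right[OF iD, of S]])
             (use le G in \<open>auto simp: abs_mult intro: order_trans[OF _ abs_ge_self]\<close>)
      qed (intro integrable_mult_right iD)
      finally show ?thesis by (simp add: mult.assoc)
    qed
    moreover have "(\<lambda>n. 1 - t * (l * (l ^ n * c n))) \<longlonglongrightarrow> 1 - t * (l * 0)"
      by (intro tendsto_intros lim)
    ultimately show ?thesis by (intro LIMSEQ_le_const2[where X="\<lambda>n. 1 - t * (l * (l ^ n * c n))"]) auto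
  qed
  have "(\<lambda>n. \<integral>\<omega>. exp (- (l * D (real (Suc n)) \<omega>)) \<partial>N) \<longlonglongrightarrow> (\<integral>\<omega>. expI l \<omega> \<partial>N)"
  proof (rule integral_dominated_convergence[where w="\<lambda>_. 1"])
    show "(\<lambda>\<omega>. exp (- (l * D (real (Suc n)) \<omega>))) \<in> borel_measurable N" for n
    proof -
      have [measurable]: "D (real (Suc n)) \<in> borel_measurable N" by (intro D_measurable) simp
      show ?thesis by measurable
    qed
  qed (use expI_tendsto[OF l] D_nonneg l in auto)
  then have "(\<lambda>n. S * (\<integral>\<omega>. exp (- (l * D (real (Suc n)) \<omega>)) \<partial>N)) \<longlonglongrightarrow> S * (\<integral>\<omega>. expI l \<omega> \<partial>N)"
    by (intro tendsto_intros)
  then show ?thesis by (rule LIMSEQ_le_const) (use D_bd in \<open>auto simp del: of_nat_Suc\<close>)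
qed

text \<open>Substitute for transience: the integral of \<open>expI l \<omega> * exp (- X t \<omega>)\<close> over all times \<open>t\<close> is
  \<open>I * exp (- l * I)\<close>, which is at most \<open>1 / l\<close>.\<close>

lemma small_time_weight:
  assumes l: "l > 0" and e: "e > 0"
  shows "\<exists>t>0. (\<integral>\<omega>. expI l \<omega> * exp (- X t \<omega>) \<partial>N) < e"
proof (rule ccontr)
  assume neg: "\<not> ?thesis"
  let ?H = "\<lambda>t. \<integral>\<omega>. expI l \<omega> * exp (- X t \<omega>) \<partial>N"
  have l0: "l \<ge> 0" using l by simp
  have Hm: "integrable N (\<lambda>\<omega>. expI l \<omega> * exp (- X t \<omega>))" if t: "t \<ge> 0" for t
  proof (rule N.integrable_const_bound[where B=1])
    have [measurable]: "X t \<in> borel_measurable N" by (rule X_measurable[OF t])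
    show "(\<lambda>\<omega>. expI l \<omega> * exp (- X t \<omega>)) \<in> borel_measurable N" by measurable
    have "expI l \<omega> * exp (- X t \<omega>) \<le> 1 * 1" if "\<omega> \<in> space N" for \<omega>
      using expI_bounds[OF l0, of \<omega>] X_nonneg[OF t that] by (intro mult_mono) auto
    then show "AE \<omega> in N. norm (expI l \<omega> * exp (- X t \<omega>)) \<le> 1"
      using expI_bounds[OF l0] by (auto simp: abs_mult)
  qed
  have H: "?H t \<ge> e" if "t \<ge> 0" for t
  proof (cases "t = 0")
    case False
    then have "t > 0" using that by simp
    then show ?thesis using neg by (meson not_less)
  next
    \<comment> \<open>The negated claim speaks of t > 0 only; at 0 the integrand is largest because
      X starts from 0.\<close>
    case True
    have "e \<le> ?H 1" using neg by (meson not_less zero_less_one)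
    also have "\<dots> \<le> ?H 0"
    proof (rule integral_mono)
      fix \<omega> assume \<omega>: "\<omega> \<in> space N"
      have "exp (- X 1 \<omega>) \<le> exp (- X 0 \<omega>)" using X_nonneg[of 1 \<omega>] X_start[OF \<omega>] \<omega> by simp
      then show "expI l \<omega> * exp (- X 1 \<omega>) \<le> expI l \<omega> * exp (- X 0 \<omega>)"
        using expI_bounds[OF l0] by (intro mult_left_mono)
    qed (auto intro: Hm)
    finally show ?thesis using True by simp
  qed
  \<comment> \<open>The lower bound \<open>t * e\<close> becomes 2 / l, twice the upper bound 1 /
    l.\<close>
  define t where "t = 2 / (l * e)"
  have t: "t > 0" using l e by (simp add: t_def)
  let ?h = "\<lambda>n. t / real (Suc n)"
  have h0: "real j * ?h n \<ge> 0" for j n using t by (intro mult_nonneg_nonneg) auto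
  define R' where "R' n \<omega> = (\<Sum>j<Suc n. ?h n * exp (- X (real j * ?h n) \<omega>))" for n \<omega>
  have Rint: "integrable N (\<lambda>\<omega>. expI l \<omega> * R' n \<omega>)"
    and Rge: "t * e \<le> (\<integral>\<omega>. expI l \<omega> * R' n \<omega> \<partial>N)" for n
  proof -
    have eq: "(\<lambda>\<omega>. expI l \<omega> * R' n \<omega>) = (\<lambda>\<omega>. \<Sum>j<Suc n. ?h n * (expI l \<omega> * exp (- X (real j * ?h n) \<omega>)))"
      unfolding R'_def sum_distrib_left by (simp only: mult.left_commute)
    show "integrable N (\<lambda>\<omega>. expI l \<omega> * R' n \<omega>)"
      unfolding eq by (intro Bochner_Integration.integrable_sum integrable_mult_right Hm h0)
    have "(\<integral>\<omega>. expI l \<omega> * R' n \<omega> \<partial>N) = (\<Sum>j<Suc n. \<integral>\<omega>. ?h n * (expI l \<omega> * exp (- X (real j * ?h n) \<omega>)) \<partial>N)"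
      unfolding eq by (rule Bochner_Integration.integral_sum) (intro integrable_mult_right Hm h0)
    also have "\<dots> = (\<Sum>j<Suc n. ?h n * ?H (real j * ?h n))" by (simp del: of_nat_Suc)
    also have "\<dots> \<ge> (\<Sum>j<Suc n. ?h n * e)"
      using t by (intro sum_mono mult_left_mono H h0) simp
    also have "(\<Sum>j<Suc n. ?h n * e) = t * e" by (simp del: of_nat_Suc)
    finally show "t * e \<le> (\<integral>\<omega>. expI l \<omega> * R' n \<omega> \<partial>N)" .
  qed
  have "(\<lambda>n. \<integral>\<omega>. expI l \<omega> * R' n \<omega> \<partial>N) \<longlonglongrightarrow> (\<integral>\<omega>. expI l \<omega> * D t \<omega> \<partial>N)"
  proof (rule integral_dominated_convergence[where w="\<lambda>_. t"])
    note [measurable] = D_measurable[OF t]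
    show "(\<lambda>\<omega>. expI l \<omega> * D t \<omega>) \<in> borel_measurable N" by measurable
    show "(\<lambda>\<omega>. expI l \<omega> * R' n \<omega>) \<in> borel_measurable N" for n using Rint by auto
    show "integrable N (\<lambda>_. t)" by simp
    show "AE \<omega> in N. (\<lambda>n. expI l \<omega> * R' n \<omega>) \<longlonglongrightarrow> expI l \<omega> * D t \<omega>"
      unfolding R'_def by (intro AE_I2 tendsto_intros D_riemann t)
    show "AE \<omega> in N. norm (expI l \<omega> * R' n \<omega>) \<le> t" for n
    proof (rule AE_I2)
      fix \<omega> assume \<omega>: "\<omega> \<in> space N"
      have hn: "?h n \<ge> 0" using t by simp
      have "0 \<le> R' n \<omega>" unfolding R'_def by (intro sum_nonneg mult_nonneg_nonneg hn) auto
      have "R' n \<omega> \<le> (\<Sum>j<Suc n. ?h n * 1)"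
        unfolding R'_def using X_nonneg[OF h0 \<omega>] by (intro sum_mono mult_left_mono hn) simp
      also have "\<dots> = t" by (simp del: of_nat_Suc)
      finally have "expI l \<omega> * R' n \<omega> \<le> 1 * t"
        using expI_bounds[OF l0] \<open>0 \<le> R' n \<omega>\<close> by (intro mult_mono) auto
      then show "norm (expI l \<omega> * R' n \<omega>) \<le> t"
        using expI_bounds[OF l0, of \<omega>] \<open>0 \<le> R' n \<omega>\<close> by (simp add: abs_mult)
    qed
  qed
  then have "t * e \<le> (\<integral>\<omega>. expI l \<omega> * D t \<omega> \<partial>N)" by (rule LIMSEQ_le_const) (use Rge in auto)
  also have "\<dots> \<le> 1 / l"
  proof -
    have b: "expI l \<omega> * D t \<omega> \<le> 1 / l" if "\<omega> \<in> space N" for \<omega>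
    proof -
      have "expI l \<omega> * D t \<omega> \<le> exp (- (l * D t \<omega>)) * D t \<omega>"
        by (intro mult_right_mono expI_le_D l0 t that D_nonneg)
      also have "\<dots> \<le> 1 / l"
      proof -
        have "l * D t \<omega> \<le> exp (l * D t \<omega>)" using exp_ge_add_one_self[of "l * D t \<omega>"] by linarith
        then have "exp (- (l * D t \<omega>)) * (l * D t \<omega>) \<le> exp (- (l * D t \<omega>)) * exp (l * D t \<omega>)"
          by (intro mult_left_mono) auto
        then show ?thesis using l by (simp add: exp_add[symmetric] pos_le_divide_eq ac_simps)
      qed
      finally show ?thesis .
    qed
    note [measurable] = D_measurable[OF t]
    have "integrable N (\<lambda>\<omega>. expI l \<omega> * D t \<omega>)"
      by (rule N.integrable_const_bound[where B="1 / l"])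
         (use b expI_bounds[OF l0] D_nonneg in \<open>auto simp: abs_mult\<close>)
    then show ?thesis by (rule N.integral_le_const) (use b in auto)
  qed
  finally show False using l e by (simp add: t_def field_simps)
qed

text \<open>Where \<open>X t \<ge> a\<close>, \<open>Fsum\<close> is close to its limit. The
  complementary event is dominated by \<open>exp a * exp (- X t)\<close>, whose mean against
  \<open>expI l\<close> is small at a suitable time by \<open>small_time_weight\<close>. As only the
  supermartingale bound enters, n stays fixed.\<close>

lemma laplace_upper:
  assumes l: "l > 0"
  shows "(\<Sum>k\<le>n. l ^ k * c k) * (\<integral>\<omega>. expI l \<omega> \<partial>N) \<le> 1"
proof -
  let ?S = "\<Sum>k\<le>n. l ^ k * c k" and ?E = "\<integral>\<omega>. expI l \<omega> \<partial>N"
  have l0: "l \<ge> 0" using l by simp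
  have E: "0 \<le> ?E" "?E \<le> 1"
    using expI_bounds[OF l0] by (auto intro!: integral_nonneg_AE N.integral_le_const expI_integrable l0)
  have "?S * ?E \<le> 1 + e" if e: "e > 0" for e
  proof -
    have "\<forall>\<^sub>F x in at_top. ?S - e / 2 < Fsum l n x"
      using e by (intro order_tendstoD(1)[OF Fsum_tendsto]) simp
    then obtain a where a: "\<And>x. x \<ge> a \<Longrightarrow> ?S - e / 2 < Fsum l n x"
      by (auto simp: eventually_at_top_linorder)
    have S0: "?S \<ge> 0" using l c_pos by (intro sum_nonneg mult_nonneg_nonneg) (auto simp: less_imp_le)
    \<comment> \<open>Chosen so that the contribution of small \<open>X t\<close> costs at most e /
      2; the other e / 2 goes into approximating the limit of \<open>Fsum\<close>.\<close>
    define e' where "e' = e / (2 * (?S + 1) * exp a)"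
    have e': "e' > 0" using e S0 by (simp add: e'_def)
    obtain t where t: "t > 0" "(\<integral>\<omega>. expI l \<omega> * exp (- X t \<omega>) \<partial>N) < e'"
      using small_time_weight[OF l e'] by blast
    have [measurable]: "X t \<in> borel_measurable N" using t by (intro X_measurable) auto
    note [measurable] = D_measurable[OF t(1)]
    have iw: "integrable N (\<lambda>\<omega>. expI l \<omega> * exp (- X t \<omega>))"
    proof (rule N.integrable_const_bound[where B=1])
      have "expI l \<omega> * exp (- X t \<omega>) \<le> 1 * 1" if "\<omega> \<in> space N" for \<omega>
        using expI_bounds[OF l0, of \<omega>] X_nonneg[OF _ that, of t] t by (intro mult_mono) auto
      then show "AE \<omega> in N. norm (expI l \<omega> * exp (- X t \<omega>)) \<le> 1"
        using expI_bounds[OF l0] by (auto simp: abs_mult)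
    qed measurable
    have G: "0 \<le> Fsum l n x" "Fsum l n x \<le> ?S" for x
      using Fsum_nonneg[OF l0] Fsum_le[OF l0] by auto
    have iF: "integrable N (\<lambda>\<omega>. exp (- (l * D t \<omega>)) * Fsum l n (X t \<omega>))"
    proof (rule N.integrable_const_bound[where B="?S"])
      have "exp (- (l * D t \<omega>)) * Fsum l n (X t \<omega>) \<le> 1 * ?S" for \<omega>
        using G l0 D_nonneg by (intro mult_mono) auto
      then show "AE \<omega> in N. norm (exp (- (l * D t \<omega>)) * Fsum l n (X t \<omega>)) \<le> ?S"
        using G by (auto simp: abs_mult)
    qed measurable
    have pt: "(?S - e / 2) * expI l \<omega> - (?S * exp a) * (expI l \<omega> * exp (- X t \<omega>)) \<le> exp (- (l * D t \<omega>)) * Fsum l n (X t \<omega>)"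
      if \<omega>: "\<omega> \<in> space N" for \<omega>
    proof (cases "X t \<omega> \<ge> a")
      case True
      have "(?S - e / 2) * expI l \<omega> \<le> Fsum l n (X t \<omega>) * expI l \<omega>"
        using a[OF True] expI_bounds[OF l0] by (intro mult_right_mono) auto
      also have "\<dots> \<le> Fsum l n (X t \<omega>) * exp (- (l * D t \<omega>))"
        by (intro mult_left_mono expI_le_D l0 t \<omega> G)
      finally have "(?S - e / 2) * expI l \<omega> \<le> exp (- (l * D t \<omega>)) * Fsum l n (X t \<omega>)"
        by (simp add: mult.commute)
      moreover have "0 \<le> (?S * exp a) * (expI l \<omega> * exp (- X t \<omega>))"
        using S0 expI_bounds[OF l0] by (intro mult_nonneg_nonneg) auto
      ultimately show ?thesis by linarith
    next
      case False
      then have "1 \<le> exp a * exp (- X t \<omega>)" by (simp add: exp_add[symmetric])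
      then have "?S * expI l \<omega> * 1 \<le> ?S * expI l \<omega> * (exp a * exp (- X t \<omega>))"
        using S0 expI_bounds[OF l0] by (intro mult_left_mono mult_nonneg_nonneg) auto
      moreover have "(?S - e / 2) * expI l \<omega> \<le> ?S * expI l \<omega>"
        using e expI_bounds[OF l0] by (intro mult_right_mono) auto
      moreover have "0 \<le> exp (- (l * D t \<omega>)) * Fsum l n (X t \<omega>)" using G by simp
      moreover have "?S * expI l \<omega> * (exp a * exp (- X t \<omega>)) = (?S * exp a) * (expI l \<omega> * exp (- X t \<omega>))"
        by (simp only: ac_simps)
      ultimately show ?thesis by linarith
    qed
    have "(?S - e / 2) * ?E - (?S * exp a) * (\<integral>\<omega>. expI l \<omega> * exp (- X t \<omega>) \<partial>N) =
      (\<integral>\<omega>. (?S - e / 2) * expI l \<omega> - (?S * exp a) * (expI l \<omega> * exp (- X t \<omega>)) \<partial>N)"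
      using iw expI_integrable[OF l0] by simp
    also have "\<dots> \<le> (\<integral>\<omega>. exp (- (l * D t \<omega>)) * Fsum l n (X t \<omega>) \<partial>N)"
      using iw expI_integrable[OF l0] iF pt by (intro integral_mono) auto
    also have "\<dots> \<le> 1" by (rule feynman_kac(1)[OF l t(1)])
    finally have 1: "(?S - e / 2) * ?E - (?S * exp a) * (\<integral>\<omega>. expI l \<omega> * exp (- X t \<omega>) \<partial>N) \<le> 1" .
    have "(?S * exp a) * (\<integral>\<omega>. expI l \<omega> * exp (- X t \<omega>) \<partial>N) \<le> (?S * exp a) * e'"
      using S0 t(2) by (intro mult_left_mono) auto
    also have "\<dots> = (?S / (?S + 1)) * (e / 2)"
    proof -
      have "(A * B) * (e / (2 * (A + 1) * B)) = A / (A + 1) * (e / 2)" if "B > 0" for A B :: real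
        using that by (simp add: mult.assoc)
      then show ?thesis unfolding e'_def by simp
    qed
    also have "\<dots> \<le> 1 * (e / 2)" using S0 e by (intro mult_right_mono) auto
    finally have 2: "(?S * exp a) * (\<integral>\<omega>. expI l \<omega> * exp (- X t \<omega>) \<partial>N) \<le> e / 2" by simp
    have "e / 2 * ?E \<le> e / 2 * 1" using E e by (intro mult_left_mono) auto
    then show ?thesis using 1 2 by (simp add: left_diff_distrib)
  qed
  then show ?thesis by (rule field_le_epsilon)
qed

lemma prob_I_upper:
  assumes l: "l \<ge> 0" and x: "x \<ge> 0"
  shows "measure N {\<omega> \<in> space N. I \<omega> \<le> ennreal x} \<le> exp (l * x) * (\<integral>\<omega>. expI l \<omega> \<partial>N)"
proof -
  let ?A = "{\<omega> \<in> space N. I \<omega> \<le> ennreal x}"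
  note [measurable] = I_measurable
  have A: "?A \<in> sets N" by measurable
  have "measure N ?A = (\<integral>\<omega>. indicator ?A \<omega> \<partial>N)" using A by simp
  also have "\<dots> \<le> (\<integral>\<omega>. exp (l * x) * expI l \<omega> \<partial>N)"
  proof (rule integral_mono)
    show "integrable N (\<lambda>\<omega>. exp (l * x) * expI l \<omega>)" by (intro integrable_mult_right expI_integrable l)
    show "integrable N (indicator ?A :: 'b \<Rightarrow> real)"
      using A by (intro integrable_real_indicator) (auto simp: N.emeasure_eq_measure)
    fix \<omega> assume "\<omega> \<in> space N"
    show "indicator ?A \<omega> \<le> exp (l * x) * expI l \<omega>"
    proof (cases "\<omega> \<in> ?A")
      case True
      then have le: "I \<omega> \<le> ennreal x" by simp
      then have "I \<omega> \<noteq> \<top>" by (metis ennreal_neq_top neq_top_trans)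
      moreover have "enn2real (I \<omega>) \<le> x" using enn2real_mono[OF le] x by simp
      then have "1 \<le> exp (l * x) * exp (- (l * enn2real (I \<omega>)))"
        using l by (simp add: exp_add[symmetric] mult_left_mono)
      ultimately show ?thesis using True by (simp add: expI_def)
    qed (use expI_bounds[OF l] in auto)
  qed
  finally show ?thesis by simp
qed

lemma prob_I_lower:
  assumes l: "l \<ge> 0" and x: "x \<ge> 0"
  shows "(\<integral>\<omega>. expI l \<omega> \<partial>N) - exp (- (l * x)) \<le> measure N {\<omega> \<in> space N. I \<omega> \<le> ennreal x}"
proof -
  let ?A = "{\<omega> \<in> space N. I \<omega> \<le> ennreal x}"
  note [measurable] = I_measurable
  have A: "?A \<in> sets N" by measurable
  have iA: "integrable N (indicator ?A :: 'b \<Rightarrow> real)"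
    using A by (intro integrable_real_indicator) (auto simp: N.emeasure_eq_measure)
  have "(\<integral>\<omega>. expI l \<omega> \<partial>N) \<le> (\<integral>\<omega>. indicator ?A \<omega> + exp (- (l * x)) \<partial>N)"
  proof (rule integral_mono)
    fix \<omega> assume \<omega>: "\<omega> \<in> space N"
    show "expI l \<omega> \<le> indicator ?A \<omega> + exp (- (l * x))"
    proof (cases "\<omega> \<in> ?A")
      case True
      then show ?thesis using expI_bounds(2)[OF l, of \<omega>] by (simp add: add_increasing2)
    next
      case False
      then have gt: "ennreal x < I \<omega>" using \<omega> by auto
      have "expI l \<omega> \<le> exp (- (l * x))"
      proof (cases "I \<omega> = \<top>")
        case I: False
        then have "x \<le> enn2real (I \<omega>)"
          using gt x by (metis enn2real_ennreal enn2real_mono less_imp_le top.not_eq_extremum)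
        then show ?thesis using I l by (simp add: expI_def mult_left_mono)
      qed (simp add: expI_def)
      then show ?thesis by (simp add: add_increasing)
    qed
  qed (use iA expI_integrable[OF l] in auto)
  also have "\<dots> = measure N ?A + exp (- (l * x))" using iA A by (simp add: N.prob_space)
  finally show ?thesis by simp
qed

end

section \<open>Small ball probabilities\<close>

context conditioned_setting
begin

text \<open>Replacing \<open>theta\<close> by an integer n above it turns the product into a
  quotient of factorials, at the price of the shift in \<open>fact (k + n)\<close>; finitely many
  small j cost a constant factor.\<close>

lemma c_lower_bound:
  assumes a: "\<alpha> > 1" and C: "C > 0" and ev: "\<forall>\<^sub>F l in at_top. \<Psi> l \<le> C * l powr \<alpha>"
  shows "\<exists>n. \<exists>B>0. \<forall>k. B * ((1 / fact (k + n)) powr \<alpha> / C ^ k) \<le> c k"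
proof -
  obtain L where L: "\<And>l. l \<ge> L \<Longrightarrow> \<Psi> l \<le> C * l powr \<alpha>" using ev by (auto simp: eventually_at_top_linorder)
  obtain n :: nat where n: "theta \<le> real n" using real_arch_simple by blast
  obtain j0 :: nat where j0: "max L (k0 + 1) \<le> real j0" using real_arch_simple by blast
  have "\<exists>B>0. \<forall>k. B * (\<Prod>j<k. 1 / (C * real (j + n + 1) powr \<alpha>)) \<le> (\<Prod>j<k. lapW (theta + 1 + real j))"
  proof (rule prod_lower_bound_from_tail[where ?j0.0=j0])
    show "lapW (theta + 1 + real j) > 0" for j using theta_nonneg by (intro lapW_pos) simp
    show "1 / (C * real (j + n + 1) powr \<alpha>) > 0" for j using C by simp
    fix j assume "j0 \<le> j"
    then have j: "L \<le> theta + 1 + real j" "k0 < theta + 1 + real j"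
      using j0 theta_nonneg by auto
    have "\<Psi> (theta + 1 + real j) \<le> C * (theta + 1 + real j) powr \<alpha>" by (rule L[OF j(1)])
    also have "\<dots> \<le> C * real (j + n + 1) powr \<alpha>"
      using n a C theta_nonneg by (intro mult_left_mono powr_mono2) auto
    finally have "1 / (C * real (j + n + 1) powr \<alpha>) \<le> 1 / \<Psi> (theta + 1 + real j)"
      using Wt_laplace_nn(2)[OF j(2)] by (intro divide_left_mono) (auto intro!: mult_pos_pos C)
    then show "1 / (C * real (j + n + 1) powr \<alpha>) \<le> lapW (theta + 1 + real j)"
      by (simp only: lapW_eq[OF j(2)])
  qed
  then obtain B where B: "B > 0" "\<And>k. B * ((fact n / fact (k + n)) powr \<alpha> / C ^ k) \<le> c k"
    unfolding prod_Suc_powr[OF C] c_def by blast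
  have "B * fact n powr \<alpha> * ((1 / fact (k + n)) powr \<alpha> / C ^ k) \<le> c k" for k
    using B(2)[of k] by (simp add: powr_divide)
  then show ?thesis using B(1) by (intro exI[of _ n] exI[of _ "B * fact n powr \<alpha>"]) auto
qed

text \<open>In this direction \<open>theta + 1 + j \<ge> j + 1\<close> is the right comparison, so
  the factorial appears without a shift.\<close>

lemma c_upper_bound:
  assumes a: "\<alpha> > 1" and C: "C > 0" and ev: "\<forall>\<^sub>F l in at_top. \<Psi> l \<ge> C * l powr \<alpha>"
  shows "\<exists>B>0. \<forall>k. c k \<le> B * ((1 / fact k) powr \<alpha> / C ^ k)"
proof -
  obtain L where L: "\<And>l. l \<ge> L \<Longrightarrow> \<Psi> l \<ge> C * l powr \<alpha>" using ev by (auto simp: eventually_at_top_linorder)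
  obtain j0 :: nat where j0: "max L (k0 + 1) \<le> real j0" using real_arch_simple by blast
  have "\<exists>B>0. \<forall>k. B * (\<Prod>j<k. lapW (theta + 1 + real j)) \<le> (\<Prod>j<k. 1 / (C * real (j + 0 + 1) powr \<alpha>))"
  proof (rule prod_lower_bound_from_tail[where ?j0.0=j0])
    show "lapW (theta + 1 + real j) > 0" for j using theta_nonneg by (intro lapW_pos) simp
    show "1 / (C * real (j + 0 + 1) powr \<alpha>) > 0" for j using C by simp
    fix j assume "j0 \<le> j"
    then have j: "L \<le> theta + 1 + real j" "k0 < theta + 1 + real j"
      using j0 theta_nonneg by auto
    have "C * real (j + 0 + 1) powr \<alpha> \<le> C * (theta + 1 + real j) powr \<alpha>"
      using a C theta_nonneg by (intro mult_left_mono powr_mono2) auto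
    also have "\<dots> \<le> \<Psi> (theta + 1 + real j)" by (rule L[OF j(1)])
    finally have "1 / \<Psi> (theta + 1 + real j) \<le> 1 / (C * real (j + 0 + 1) powr \<alpha>)"
      using Wt_laplace_nn(2)[OF j(2)] C by (intro divide_left_mono mult_pos_pos) auto
    then show "lapW (theta + 1 + real j) \<le> 1 / (C * real (j + 0 + 1) powr \<alpha>)"
      by (simp only: lapW_eq[OF j(2)])
  qed
  then obtain B where B: "B > 0" "\<And>k. B * c k \<le> (fact 0 / fact (k + 0)) powr \<alpha> / C ^ k"
    unfolding prod_Suc_powr[OF C] c_def by blast
  have "c k \<le> inverse B * ((1 / fact k) powr \<alpha> / C ^ k)" for k
    using mult_left_mono[OF B(2)[of k], of "inverse B"] B(1) by (simp add: mult.assoc[symmetric])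
  then show ?thesis using B(1) by (intro exI[of _ "inverse B"]) auto
qed

text \<open>For \<open>l = C * u powr \<alpha>\<close>, the lower bound on
  \<open>l ^ k * c k\<close> is, up to a power of u, the power \<alpha> of a term of the series of
  \<open>exp u\<close>. A largest such term is nearly \<open>exp (\<alpha> * u)\<close>, and
  \<open>laplace_upper\<close> turns it into a bound on the Laplace transform.\<close>

theorem small_ball_upper:
  assumes a: "\<alpha> > 1" and C: "C > 0" and ev: "\<forall>\<^sub>F l in at_top. \<Psi> l \<le> C * l powr \<alpha>"
    and d: "0 < \<delta>" "\<delta> < 1"
  shows "\<forall>\<^sub>F x in at_right 0. measure N {\<omega> \<in> space N. I \<omega> \<le> ennreal x}
     \<le> exp (- (\<delta> * (\<alpha> - 1) / (C * x) powr (1 / (\<alpha> - 1))))"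
proof -
  obtain n B where B: "B > 0" "\<And>k. B * ((1 / fact (k + n)) powr \<alpha> / C ^ k) \<le> c k"
    using c_lower_bound[OF a C ev] by blast
  define g where "g = (1 - \<delta>) / 2 * (\<alpha> - 1)"
  have g: "g > 0" using a d by (simp add: g_def)
  \<comment> \<open>The choice makes \<open>r * \<alpha>\<close> exceed
    \<open>1 + \<delta> * (\<alpha> - 1)\<close> by g; the spare factor \<open>exp (- g * u)\<close>
    will absorb the power of u.\<close>
  define r where "r = (1 + (1 + \<delta>) / 2 * (\<alpha> - 1)) / \<alpha>"
  have ra: "r * \<alpha> = 1 + \<delta> * (\<alpha> - 1) + g" using a by (simp add: r_def g_def field_simps)
  have r: "0 < r" "r < 1"
  proof -
    show "0 < r" using a d by (simp add: r_def add_pos_pos)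
    have "(1 + \<delta>) / 2 * (\<alpha> - 1) < 1 * (\<alpha> - 1)" using a d by (intro mult_strict_right_mono) auto
    then show "r < 1" using a by (simp add: r_def)
  qed
  obtain p' :: nat where p': "real n * \<alpha> \<le> real p'" using real_arch_simple by blast
  define A where "A = B * ((1 - r) / 2) powr \<alpha>"
  have A: "A > 0" using B r by (simp add: A_def)
  \<comment> \<open>The minimiser of \<open>C * v powr \<alpha> * x - \<alpha> * v\<close> over v >
    0. At this point \<open>l * x = u\<close>, and the minimum is
    \<open>- (\<alpha> - 1) * u\<close>.\<close>
  let ?u = "\<lambda>x. 1 / (C * x) powr (1 / (\<alpha> - 1))"
  have lap: "(\<integral>\<omega>. expI (C * u powr \<alpha>) \<omega> \<partial>N) \<le> u ^ p' / A * exp (- (r * \<alpha> * u))"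
    if u: "u \<ge> 1" "u \<ge> real n" for u
  proof -
    let ?l = "C * u powr \<alpha>" and ?E = "\<integral>\<omega>. expI (C * u powr \<alpha>) \<omega> \<partial>N"
    have l: "?l > 0" using C u by simp
    have E0: "?E \<ge> 0" using expI_bounds[of ?l] l by (intro integral_nonneg_AE) auto
    obtain k' where k': "u ^ k' / fact k' \<ge> (1 - r) / 2 * exp (r * u)"
      using exp_series_large_term[OF _ r, of u] u by auto
    \<comment> \<open>The bound on \<open>c k\<close> concerns the term of index k + n, so a large
      term of index below n is first moved up to n, where it is at least as large since
      \<open>u \<ge> n\<close>.\<close>
    define k where "k = max k' n - n"
    have kn: "k + n = max k' n" by (simp add: k_def)
    have big: "u ^ (k + n) / fact (k + n) \<ge> (1 - r) / 2 * exp (r * u)"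
    proof (cases "k' \<ge> n")
      case True then show ?thesis unfolding kn using k' by (simp add: max_absorb1)
    next
      case False
      then have "k' \<le> n" by simp
      then have "u ^ k' / fact k' \<le> u ^ n / fact n" by (intro power_div_fact_mono u)
      moreover have "k + n = n" unfolding kn using False by simp
      ultimately show ?thesis using k' by (simp only:)
    qed
    have "A * exp (r * \<alpha> * u) = B * ((1 - r) / 2 * exp (r * u)) powr \<alpha>"
    proof -
      have "((1 - r) / 2 * exp (r * u)) powr \<alpha> = ((1 - r) / 2) powr \<alpha> * exp (r * u) powr \<alpha>"
        by (rule powr_mult)
      also have "exp (r * u) powr \<alpha> = exp (r * \<alpha> * u)" by (simp add: exp_powr_real ac_simps)
      finally show ?thesis by (simp only: A_def mult.assoc)
    qed
    also have "\<dots> \<le> B * (u ^ (k + n) / fact (k + n)) powr \<alpha>"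
      using B big r a by (intro mult_left_mono powr_mono2) auto
    also have "\<dots> = B * ((u powr \<alpha>) ^ k * u powr (real n * \<alpha>) * (1 / fact (k + n)) powr \<alpha>)"
    proof -
      have "u ^ (k + n) = u powr real (k + n)" using u by (subst powr_realpow) auto
      then have "(u ^ (k + n)) powr \<alpha> = u powr (real (k + n) * \<alpha>)" by (simp add: powr_powr)
      also have "real (k + n) * \<alpha> = \<alpha> * real k + real n * \<alpha>" by (simp add: algebra_simps)
      also have "u powr (\<alpha> * real k + real n * \<alpha>) = (u powr \<alpha>) powr real k * u powr (real n * \<alpha>)"
        by (simp add: powr_add powr_powr)
      also have "(u powr \<alpha>) powr real k = (u powr \<alpha>) ^ k" using u by (intro powr_realpow) auto
      finally show ?thesis using u by (simp add: powr_divide)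
    qed
    also have "\<dots> = u powr (real n * \<alpha>) * (?l ^ k * (B * ((1 / fact (k + n)) powr \<alpha> / C ^ k)))"
      using C by (simp add: power_mult_distrib)
    also have "\<dots> \<le> u ^ p' * (?l ^ k * c k)"
    proof (intro mult_mono mult_left_mono B)
      have "u powr (real n * \<alpha>) \<le> u powr real p'" using u p' by (intro powr_mono) auto
      then show "u powr (real n * \<alpha>) \<le> u ^ p'" using u by (subst (asm) powr_realpow) auto
    qed (use l u B C in \<open>auto intro!: mult_nonneg_nonneg\<close>)
    finally have 1: "A * exp (r * \<alpha> * u) \<le> u ^ p' * (?l ^ k * c k)" .
    have "?l ^ k * c k \<le> (\<Sum>j\<le>k. ?l ^ j * c j)"
      using l c_pos by (intro member_le_sum) (auto intro!: mult_nonneg_nonneg simp: less_imp_le)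
    then have "(?l ^ k * c k) * ?E \<le> (\<Sum>j\<le>k. ?l ^ j * c j) * ?E" by (intro mult_right_mono E0)
    also have "\<dots> \<le> 1" by (rule laplace_upper[OF l])
    finally have 2: "(?l ^ k * c k) * ?E \<le> 1" .
    have "A * exp (r * \<alpha> * u) * ?E \<le> u ^ p' * (?l ^ k * c k) * ?E" by (intro mult_right_mono 1 E0)
    also have "\<dots> = u ^ p' * ((?l ^ k * c k) * ?E)" by (simp only: mult.assoc)
    also have "\<dots> \<le> u ^ p' * 1" using u by (intro mult_left_mono 2) auto
    finally have 3: "A * exp (r * \<alpha> * u) * ?E \<le> u ^ p'" by simp
    then have "?E \<le> u ^ p' / (A * exp (r * \<alpha> * u))" using A by (simp add: pos_le_divide_eq mult.commute)
    then show ?thesis by (simp add: exp_minus divide_inverse)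
  qed
  have fl: "filterlim ?u at_top (at_right 0)" using a C by (intro small_arg_filterlim) auto
  have "\<forall>\<^sub>F u in at_top. u \<ge> 1 \<and> u \<ge> real n \<and> inverse A * u ^ p' \<le> exp (g * u)"
    using eventually_ge_at_top[of 1] eventually_ge_at_top[of "real n"] power_le_exp_eventually[OF g, of "inverse A" p']
    by eventually_elim auto
  from eventually_compose_filterlim[OF this fl] eventually_at_right_less[of "0::real"]
  show ?thesis
  proof eventually_elim
    case (elim x)
    let ?v = "?u x"
    have x: "x > 0" using elim by simp
    have v: "?v \<ge> 1" "?v \<ge> real n" using elim by auto
    have lx: "C * ?v powr \<alpha> * x = ?v"
    proof -
      have "?v powr \<alpha> = ?v * ?v powr (\<alpha> - 1)" using v by (simp only: powr_mult_base)  simp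
      also have "?v powr (\<alpha> - 1) = 1 / (C * x)"
        using a C x by (simp add: powr_divide powr_powr)
      finally show ?thesis using C x by simp
    qed
    have "measure N {\<omega> \<in> space N. I \<omega> \<le> ennreal x} \<le> exp (C * ?v powr \<alpha> * x) * (\<integral>\<omega>. expI (C * ?v powr \<alpha>) \<omega> \<partial>N)"
      using C x by (intro prob_I_upper) auto
    also have "\<dots> \<le> exp ?v * (?v ^ p' / A * exp (- (r * \<alpha> * ?v)))"
      unfolding lx by (intro mult_left_mono lap v) simp
    also have "\<dots> = (inverse A * ?v ^ p') * exp (?v - r * \<alpha> * ?v)"
      by (simp add: exp_diff exp_minus divide_inverse ac_simps)
    also have "\<dots> \<le> exp (g * ?v) * exp (?v - r * \<alpha> * ?v)"
      using elim by (intro mult_right_mono) auto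
    also have "\<dots> = exp (g * ?v + (?v - r * \<alpha> * ?v))" by (simp only: exp_add)
    also have "g * ?v + (?v - r * \<alpha> * ?v) = - (\<delta> * (\<alpha> - 1) * ?v)" unfolding ra by (simp only: distrib_right left_diff_distrib)
    also have "\<delta> * (\<alpha> - 1) * ?v = \<delta> * (\<alpha> - 1) / (C * x) powr (1 / (\<alpha> - 1))" by simp
    finally show ?case .
  qed
qed

text \<open>The whole series is at most \<open>B * exp (\<alpha> * v)\<close> for
  \<open>l = C * v powr \<alpha>\<close>, which bounds the Laplace transform below. For
  \<open>prob_I_lower\<close> the term \<open>exp (- l * x)\<close> has to be smaller still, so
  \<open>l * x\<close> must exceed \<open>\<alpha> * v\<close> by a factor e > 1.\<close>

theorem small_ball_lower:
  assumes a: "\<alpha> > 1" and C: "C > 0" and ev: "\<forall>\<^sub>F l in at_top. \<Psi> l \<ge> C * l powr \<alpha>" and d: "\<delta> > 1"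
  shows "\<forall>\<^sub>F x in at_right 0. measure N {\<omega> \<in> space N. I \<omega> \<le> ennreal x}
     \<ge> exp (- (\<delta> * \<alpha> powr (\<alpha> / (\<alpha> - 1)) / (C * x) powr (1 / (\<alpha> - 1))))"
proof -
  obtain B where B: "B > 0" "\<And>k. c k \<le> B * ((1 / fact k) powr \<alpha> / C ^ k)"
    using c_upper_bound[OF a C ev] by blast
  have lap: "exp (- (\<alpha> * v)) / B \<le> (\<integral>\<omega>. expI (C * v powr \<alpha>) \<omega> \<partial>N)" if v: "v > 0" for v
  proof -
    let ?l = "C * v powr \<alpha>"
    have l: "?l > 0" using C v by simp
    have lc: "?l ^ k * c k \<le> B * (v ^ k / fact k) powr \<alpha>" for k
    proof -
      have "?l ^ k * c k \<le> ?l ^ k * (B * ((1 / fact k) powr \<alpha> / C ^ k))"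
        using l by (intro mult_left_mono B) auto
      also have "\<dots> = B * ((v powr \<alpha>) ^ k * (1 / fact k) powr \<alpha>)"
        using C by (simp add: power_mult_distrib)
      also have "(v powr \<alpha>) ^ k = (v ^ k) powr \<alpha>"
      proof -
        have "(v powr \<alpha>) ^ k = (v powr \<alpha>) powr real k" using v by (intro powr_realpow[symmetric]) simp
        also have "\<dots> = (v powr real k) powr \<alpha>" by (simp add: powr_powr mult.commute)
        finally show ?thesis using v by (simp add: powr_realpow)
      qed
      also have "(v ^ k) powr \<alpha> * (1 / fact k) powr \<alpha> = (v ^ k / fact k) powr \<alpha>"
        using v by (simp add: powr_divide)
      finally show ?thesis .
    qed
    have S: "(\<Sum>k\<le>n. ?l ^ k * c k) \<le> B * exp (\<alpha> * v)" for n
    proof -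
      have "(\<Sum>k\<le>n. ?l ^ k * c k) \<le> (\<Sum>k\<le>n. B * (v ^ k / fact k) powr \<alpha>)" by (intro sum_mono lc)
      also have "\<dots> = B * (\<Sum>k\<le>n. (v ^ k / fact k) powr \<alpha>)" by (simp add: sum_distrib_left)
      also have "\<dots> \<le> B * (\<Sum>k\<le>n. v ^ k / fact k) powr \<alpha>"
        using a v B by (intro mult_left_mono sum_powr_le_powr_sum) auto
      also have "\<dots> \<le> B * exp v powr \<alpha>"
      proof (intro mult_left_mono powr_mono2 sum_nonneg)
        have "(\<lambda>k. v ^ k / fact k) sums exp v"
          using exp_converges[of v] by (simp add: divide_inverse mult.commute)
        then show "(\<Sum>k\<le>n. v ^ k / fact k) \<le> exp v"
          using sum_le_suminf[of "\<lambda>k. v ^ k / fact k" "{..n}"] v by (auto simp: sums_iff)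
      qed (use a v B in auto)
      finally show ?thesis by (simp add: exp_powr_real mult.commute)
    qed
    have lim: "(\<lambda>k. ?l ^ k * c k) \<longlonglongrightarrow> 0"
    proof (rule tendsto_sandwich[OF _ _ tendsto_const])
      have "(\<lambda>k. v ^ k / fact k) \<longlonglongrightarrow> 0"
        using summable_LIMSEQ_zero[OF summable_exp[of v]] by (simp add: divide_inverse mult.commute)
      then have "(\<lambda>k. (v ^ k / fact k) powr \<alpha>) \<longlonglongrightarrow> 0"
        by (rule tendsto_zero_powrI[OF _ tendsto_const]) (use v a in auto)
      then have "(\<lambda>k. B * (v ^ k / fact k) powr \<alpha>) \<longlonglongrightarrow> B * 0" by (intro tendsto_intros)
      then show "(\<lambda>k. B * (v ^ k / fact k) powr \<alpha>) \<longlonglongrightarrow> 0" by simp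
      show "\<forall>\<^sub>F k in sequentially. 0 \<le> ?l ^ k * c k"
        using l c_pos by (intro always_eventually allI mult_nonneg_nonneg) (auto simp: less_imp_le)
    qed (use lc in auto)
    have "1 \<le> B * exp (\<alpha> * v) * (\<integral>\<omega>. expI ?l \<omega> \<partial>N)" by (rule laplace_lower[OF l S lim])
    then have "1 / (B * exp (\<alpha> * v)) \<le> (\<integral>\<omega>. expI ?l \<omega> \<partial>N)"
      using B(1) by (simp add: pos_divide_le_eq mult.commute)
    then show ?thesis by (simp add: exp_minus divide_inverse mult.commute)
  qed
  \<comment> \<open>The exponent is such that
    \<open>e powr (\<alpha> / (\<alpha> - 1)) = \<delta>\<close>.\<close>
  define e where "e = \<delta> powr ((\<alpha> - 1) / \<alpha>)"
  have e: "e > 1" unfolding e_def using d a by (intro gr_one_powr) auto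
  \<comment> \<open>With \<open>v = K' * ?u x\<close> one gets
    \<open>l * x = e * \<alpha> * v\<close>, because
    \<open>K' powr (\<alpha> - 1) = e * \<alpha>\<close>. At e = 1 the exponent
    \<open>\<alpha> * v\<close> would have the constant
    \<open>\<alpha> powr (\<alpha> / (\<alpha> - 1))\<close>.\<close>
  define K' where "K' = (e * \<alpha>) powr (1 / (\<alpha> - 1))"
  have K': "K' > 0" using e a by (simp add: K'_def)
  let ?u = "\<lambda>x. 1 / (C * x) powr (1 / (\<alpha> - 1))"
  have Kpow: "K' powr (\<alpha> - 1) = e * \<alpha>" using e a by (simp add: K'_def powr_powr)
  have const: "e * \<alpha> * K' = \<delta> * \<alpha> powr (\<alpha> / (\<alpha> - 1))"
  proof -
    have "e * \<alpha> * K' = (e * \<alpha>) powr (1 + 1 / (\<alpha> - 1))" using e a by (simp add: K'_def powr_add)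
    also have "1 + 1 / (\<alpha> - 1) = \<alpha> / (\<alpha> - 1)" using a by (simp add: field_simps)
    also have "(e * \<alpha>) powr (\<alpha> / (\<alpha> - 1)) = e powr (\<alpha> / (\<alpha> - 1)) * \<alpha> powr (\<alpha> / (\<alpha> - 1))"
      using e a by (simp add: powr_mult)
    also have "e powr (\<alpha> / (\<alpha> - 1)) = \<delta>" using a d by (simp add: e_def powr_powr)
    finally show ?thesis .
  qed
  define g where "g = (e - 1) * \<alpha> * K'"
  have g: "g > 0" using e a K' by (simp add: g_def)
  have fl: "filterlim ?u at_top (at_right 0)" using a C by (intro small_arg_filterlim) auto
  \<comment> \<open>The factor 2 makes \<open>exp (- l * x)\<close> at most half of the lower bound
    for the Laplace transform, so that their difference is at least
    \<open>exp (- l * x)\<close>.\<close>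
  have "\<forall>\<^sub>F u in at_top. u > 0 \<and> 2 * B * u ^ 0 \<le> exp (g * u)"
    using eventually_gt_at_top[of 0] power_le_exp_eventually[OF g, of "2 * B" 0]
    by eventually_elim auto
  from eventually_compose_filterlim[OF this fl] eventually_at_right_less[of "0::real"]
  show ?thesis
  proof eventually_elim
    case (elim x)
    have x: "x > 0" using elim by simp
    define w where "w = ?u x"
    have w: "w > 0" "2 * B \<le> exp (g * w)" using elim unfolding w_def by auto
    define v where "v = K' * w"
    have v: "v > 0" using K' w by (simp add: v_def)
    have lx: "C * v powr \<alpha> * x = e * \<alpha> * v"
    proof -
      have "v powr \<alpha> = v * v powr (\<alpha> - 1)" using v by (simp only: powr_mult_base) simp
      also have "v powr (\<alpha> - 1) = e * \<alpha> * w powr (\<alpha> - 1)"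
        unfolding v_def using K' w by (simp add: powr_mult Kpow)
      also have "w powr (\<alpha> - 1) = 1 / (C * x)"
        unfolding w_def using a C x by (simp add: powr_divide powr_powr)
      finally show ?thesis using C x by simp
    qed
    have gw: "g * w = e * \<alpha> * v - \<alpha> * v" by (simp add: g_def v_def algebra_simps)
    have "2 * B * exp (- (e * \<alpha> * v)) \<le> exp (g * w) * exp (- (e * \<alpha> * v))"
      by (intro mult_right_mono w) simp
    also have "\<dots> = exp (- (\<alpha> * v))" unfolding gw by (simp add: exp_add[symmetric])
    finally have "2 * exp (- (e * \<alpha> * v)) \<le> exp (- (\<alpha> * v)) / B"
      using B(1) by (simp add: pos_le_divide_eq ac_simps)
    also have "\<dots> \<le> (\<integral>\<omega>. expI (C * v powr \<alpha>) \<omega> \<partial>N)" by (rule lap[OF v])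
    finally have "exp (- (e * \<alpha> * v)) \<le> (\<integral>\<omega>. expI (C * v powr \<alpha>) \<omega> \<partial>N) - exp (- (C * v powr \<alpha> * x))"
      unfolding lx by simp
    also have "\<dots> \<le> measure N {\<omega> \<in> space N. I \<omega> \<le> ennreal x}"
      using C x by (intro prob_I_lower) auto
    finally have "exp (- (e * \<alpha> * v)) \<le> measure N {\<omega> \<in> space N. I \<omega> \<le> ennreal x}" .
    moreover have "e * \<alpha> * v = \<delta> * \<alpha> powr (\<alpha> / (\<alpha> - 1)) / (C * x) powr (1 / (\<alpha> - 1))"
      unfolding v_def mult.assoc[symmetric] const w_def by simp
    ultimately show ?case by simp
  qed
qed

end

theorem theorem1p2:
  fixes M :: "'a measure" and V :: "real \<Rightarrow> 'a \<Rightarrow> real"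
    and \<Psi> W :: "real \<Rightarrow> real"
    and N :: "real \<Rightarrow> 'b measure" and Vup :: "real \<Rightarrow> real \<Rightarrow> 'b \<Rightarrow> real"
  assumes "spectrally_negative_levy_process M V"
    and "\<not> subordinator M (\<lambda>t \<omega>. - V t \<omega>)"
    and "is_laplace_exponent M V \<Psi>"
    and "is_scale_function M V \<Psi> W"
    and "conditioned_to_stay_positive M V W N Vup"
  shows "(\<forall>\<alpha> C :: real. \<alpha> > 1 \<longrightarrow> C > 0 \<longrightarrow>
            (\<forall>\<^sub>F l in at_top. \<Psi> l \<le> C * l powr \<alpha>) \<longrightarrow>
            (\<forall>\<delta>::real. 0 < \<delta> \<and> \<delta> < 1 \<longrightarrow>
              (\<forall>\<^sub>F x in at_right 0.
                 measure (N 0) {\<omega> \<in> space (N 0). exponential_functional (Vup 0) \<omega> \<le> ennreal x}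
                   \<le> exp (- (\<delta> * (\<alpha> - 1) / (C * x) powr (1 / (\<alpha> - 1)))))))
       \<and> (\<forall>\<alpha> c :: real. \<alpha> > 1 \<longrightarrow> c > 0 \<longrightarrow>
            (\<forall>\<^sub>F l in at_top. \<Psi> l \<ge> c * l powr \<alpha>) \<longrightarrow>
            (\<forall>\<delta>::real. \<delta> > 1 \<longrightarrow>
              (\<forall>\<^sub>F x in at_right 0.
                 measure (N 0) {\<omega> \<in> space (N 0). exponential_functional (Vup 0) \<omega> \<le> ennreal x}
                   \<ge> exp (- (\<delta> * \<alpha> powr (\<alpha> / (\<alpha> - 1)) / (c * x) powr (1 / (\<alpha> - 1)))))))"
proof -
  obtain p where p: "feller_semigroup p" "\<forall>t\<ge>0. \<forall>x>0. p t x = conditioned_kernel M V W t x"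
    "markov_process (N 0) (Vup 0) {0..} p 0"
    using assms(5) unfolding conditioned_to_stay_positive_def by blast
  have cad: "\<forall>\<omega>\<in>space (N 0). cadlag (\<lambda>t. Vup 0 t \<omega>)"
    using assms(5) unfolding conditioned_to_stay_positive_def by (elim conjE)
  interpret spectrally_negative_levy_process M V by (rule assms(1))
  \<comment> \<open>The maximum with 0 supplies \<open>k0 \<ge> 0\<close> whatever value
    \<open>kappa\<close> takes.\<close>
  interpret conditioned_setting M V \<Psi> W p "max 0 (kappa M V \<Psi>)" "N 0" "Vup 0"
  proof unfold_locales
    show "is_laplace_exponent M V \<Psi>" by (rule assms(3))
    show "feller_semigroup p" by (rule p)
    show "markov_process (N 0) (Vup 0) {0..} p 0" by (rule p)
  qed (use assms(4) p(2) cad in \<open>auto simp: is_scale_function_def\<close>)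
  show ?thesis using small_ball_upper small_ball_lower by blast
qed

end
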